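(* Let $(T,u,m)$ and $(P,\eta,\mu)$ be pseudomonads on a 2-category $\mathscr C$ and let $(\lambda,\omega_1,\omega_2,\omega_3,\omega_4)\colon TP\to PT$ be a pseudodistributive law in pseudomonoidal form (so satisfying (W1)–(W5) of the context). Then the following five conditions hold. (W6) $\lambda\cong Pm\cdot PuT\cdot\lambda\xrightarrow{\omega_1T}Pm\cdot\lambda T\cdot uPT\cdot\lambda\cong Pm\cdot\lambda T\cdot T\lambda\cdot uTP\xrightarrow{\omega_3}\lambda\cdot mP\cdot uTP\cong\lambda$ is the identity. (W7) $\lambda\cong\lambda\cdot T\mu\cdot TP\eta\xrightarrow{\omega_4}\mu T\cdot P\lambda\cdot\lambda P\cdot TP\eta\cong\mu T\cdot P\lambda\cdot PT\eta\cdot\lambda\xrightarrow{P\omega_2}\mu T\cdot P\eta T\cdot\lambda\cong\lambda$ is the identity. (W8) The composites $Pm\cdot\lambda T\cdot T\lambda\cdot T^2\eta\xrightarrow{\omega_3}\lambda\cdot mP\cdot T^2\eta\cong\lambda\cdot T\eta\cdot m\xrightarrow{\omega_2}\eta T\cdot m$ and $Pm\cdot\lambda T\cdot T\lambda\cdot T^2\eta\xrightarrow{T\omega_2}Pm\cdot\lambda T\cdot T\eta T\xrightarrow{\omega_2T}Pm\cdot\eta T^2\cong\eta T\cdot m$ are equal. (W9) The composites $Pu\cdot\mu\xrightarrow{\omega_1}\lambda\cdot uP\cdot\mu\cong\lambda\cdot T\mu\cdot uP^2\xrightarrow{\omega_4}\mu T\cdot P\lambda\cdot\lambda P\cdot uP^2$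 and $Pu\cdot\mu\cong\mu T\cdot P^2u\xrightarrow{P\omega_1}\mu T\cdot P\lambda\cdot PuP\xrightarrow{\omega_1P}\mu T\cdot P\lambda\cdot\lambda P\cdot uP^2$ are equal. (W10) The composite $Pu\cdot\eta\xrightarrow{\omega_1}\lambda\cdot uP\cdot\eta\cong\lambda\cdot T\eta\cdot u\xrightarrow{\omega_2}\eta T\cdot u$ equals the canonical isomorphism $Pu\cdot\eta\cong\eta T\cdot u$ (pseudonaturality of $\eta$).
   Context: **Conventions.** A pseudomonad $(T,u,m)$ on $\mathscr C$ is a pseudofunctor $T$ with pseudonatural $u\colon 1\to T$, $m\colon T^2\to T$ and invertible modifications $m\cdot uT\cong \mathrm{id}$, $m\cdot Tu\cong\mathrm{id}$, $m\cdot Tm\cong m\cdot mT$ satisfying the usual triangle and pentagon equations. Composition of 1-cells is written $\cdot$ (right to left), whiskering by juxtaposition. In the chains of 2-cells, "$\cong$" is the canonical isomorphism built from pseudonaturality constraints, pseudofunctor constraints and the structure modifications of $T$ and $P$; whiskerings of named cells are implicit. All named cells are invertible. **Pseudodistributive law in pseudomonoidal form.** A pseudonatural transformation $\lambda\colon TP\to PT$ with invertible modifications $\omega_1\colon Pu\Rightarrow\lambda\cdot uP$, $\omega_2\colon\lambda\cdot T\eta\Rightarrow\eta T$, $\omega_3\colon Pm\cdot\lambda T\cdot T\lambda\Rightarrow\lambda\cdot mP$, $\omega_4\colon\lambda\cdot T\mu\Rightarrow\mu T\cdot P\lambda\cdot\lambda P$ satisfying: (W1) $\lambda\cong Pm\cdot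 PTu\cdot\lambda\cong Pm\cdot\lambda T\cdot TPu\xrightarrow{T\omega_1}Pm\cdot\lambda T\cdot T\lambda\cdot TuP\xrightarrow{\omega_3}\lambda\cdot mP\cdot TuP\cong\lambda$ is the identity. (W2) $\lambda\cong\lambda\cdot T\mu\cdot T\eta P\xrightarrow{\omega_4}\mu T\cdot P\lambda\cdot\lambda P\cdot T\eta P\xrightarrow{\omega_2P}\mu T\cdot P\lambda\cdot\eta TP\cong\mu T\cdot\eta PT\cdot\lambda\cong\lambda$ is the identity. (W3) The two 2-cells $Pm\cdot PTm\cdot\lambda T^2\cdot T\lambda T\cdot T^2\lambda\Rightarrow\lambda\cdot mP\cdot mTP$ agree: first $\cong Pm\cdot\lambda T\cdot TPm\cdot T\lambda T\cdot T^2\lambda\xrightarrow{T\omega_3}Pm\cdot\lambda T\cdot T\lambda\cdot TmP\xrightarrow{\omega_3}\lambda\cdot mP\cdot TmP\cong\lambda\cdot mP\cdot mTP$; second $\cong Pm\cdot PmT\cdot\lambda T^2\cdot T\lambda T\cdot T^2\lambda\xrightarrow{\omega_3T}Pm\cdot\lambda T\cdot mPT\cdot T^2\lambda\cong Pm\cdot\lambda T\cdot T\lambda\cdot mTP\xrightarrow{\omega_3}\lambda\cdot mP\cdot mTP$. (W4) The two 2-cells $\lambda\cdot T\mu\cdot TP\mu\Rightarrow\mu T\cdot\mu PT\cdot P^2\lambda\cdot P\lambda P\cdot\lambda P^2$ agree: first $\cong\lambda\cdot T\mu\cdot T\mu P\xrightarrow{\omega_4}\mu T\cdot P\lambda\cdot\lambda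 P\cdot T\mu P\xrightarrow{\omega_4P}\mu T\cdot P\lambda\cdot\mu TP\cdot P\lambda P\cdot\lambda P^2\cong\mu T\cdot\mu PT\cdot P^2\lambda\cdot P\lambda P\cdot\lambda P^2$; second $\xrightarrow{\omega_4}\mu T\cdot P\lambda\cdot\lambda P\cdot TP\mu\cong\mu T\cdot P\lambda\cdot PT\mu\cdot\lambda P^2\xrightarrow{P\omega_4}\mu T\cdot P\mu T\cdot P^2\lambda\cdot P\lambda P\cdot\lambda P^2\cong$ target. (W5) The two 2-cells $Pm\cdot\lambda T\cdot T\lambda\cdot T^2\mu\Rightarrow\mu T\cdot P\lambda\cdot\lambda P\cdot mP^2$ agree: first $\xrightarrow{T\omega_4}Pm\cdot\lambda T\cdot T\mu T\cdot TP\lambda\cdot T\lambda P\xrightarrow{\omega_4T}Pm\cdot\mu T^2\cdot P\lambda T\cdot\lambda PT\cdot TP\lambda\cdot T\lambda P\cong\mu T\cdot P^2m\cdot P\lambda T\cdot PT\lambda\cdot\lambda TP\cdot T\lambda P\xrightarrow{P\omega_3}\mu T\cdot P\lambda\cdot PmP\cdot\lambda TP\cdot T\lambda P\xrightarrow{\omega_3P}\mu T\cdot P\lambda\cdot\lambda P\cdot mP^2$; second $\xrightarrow{\omega_3}\lambda\cdot mP\cdot T^2\mu\cong\lambda\cdot T\mu\cdot mP^2\xrightarrow{\omega_4}\mu T\cdot P\lambda\cdot\lambda P\cdot mP^2$. *)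

theory Defs
  imports Main
begin

section \<open>Strict 2-categories\<close>

text \<open>
  Composition of 1-cells \<open>g \<cdot> f\<close> and horizontal composition of 2-cells \<open>\<beta> \<star> \<alpha>\<close> are written right
  to left; vertical composition \<open>\<alpha> \<Zsemi> \<beta>\<close> (first \<open>\<alpha>\<close>, then \<open>\<beta>\<close>) is written in diagrammatic order,
  so that chains of 2-cells read from left to right; all operations are only constrained on the
  carriers.
\<close>

record ('o, 'a, 'c) two_cat =
  Obj :: "'o set"
  Arr :: "'a set"
  Cell :: "'c set"
  Dom :: "'a \<Rightarrow> 'o"
  Cod :: "'a \<Rightarrow> 'o"
  Src :: "'c \<Rightarrow> 'a"
  Tgt :: "'c \<Rightarrow> 'a"
  Id1 :: "'o \<Rightarrow> 'a"
  comp1 :: "'a \<Rightarrow> 'a \<Rightarrow> 'a" (infixr "\<cdot>\<index>" 75)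
  Id2 :: "'a \<Rightarrow> 'c"
  vcomp :: "'c \<Rightarrow> 'c \<Rightarrow> 'c" (infixl "\<Zsemi>\<index>" 55)
  hcomp :: "'c \<Rightarrow> 'c \<Rightarrow> 'c" (infixr "\<star>\<index>" 70)

definition hom1 :: "('o, 'a, 'c, 'z) two_cat_scheme \<Rightarrow> 'o \<Rightarrow> 'o \<Rightarrow> 'a set"
  where "hom1 C A B = {f \<in> Arr C. Dom C f = A \<and> Cod C f = B}"

definition hom2 :: "('o, 'a, 'c, 'z) two_cat_scheme \<Rightarrow> 'a \<Rightarrow> 'a \<Rightarrow> 'c set"
  where "hom2 C f g = {\<alpha> \<in> Cell C. Src C \<alpha> = f \<and> Tgt C \<alpha> = g}"

definition lwhisk :: "('o, 'a, 'c, 'z) two_cat_scheme \<Rightarrow> 'a \<Rightarrow> 'c \<Rightarrow> 'c" (infixr "\<rhd>\<index>" 65)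
  where "g \<rhd>\<^bsub>C\<^esub> \<alpha> = Id2 C g \<star>\<^bsub>C\<^esub> \<alpha>"

definition rwhisk :: "('o, 'a, 'c, 'z) two_cat_scheme \<Rightarrow> 'c \<Rightarrow> 'a \<Rightarrow> 'c" (infixl "\<lhd>\<index>" 64)
  where "\<alpha> \<lhd>\<^bsub>C\<^esub> f = \<alpha> \<star>\<^bsub>C\<^esub> Id2 C f"

definition iso2 :: "('o, 'a, 'c, 'z) two_cat_scheme \<Rightarrow> 'a \<Rightarrow> 'a \<Rightarrow> 'c set"
  where "iso2 C f g =
    {\<alpha> \<in> hom2 C f g. \<exists>\<beta> \<in> hom2 C g f. \<alpha> \<Zsemi>\<^bsub>C\<^esub> \<beta> = Id2 C f \<and> \<beta> \<Zsemi>\<^bsub>C\<^esub> \<alpha> = Id2 C g}"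

definition vinverse :: "('o, 'a, 'c, 'z) two_cat_scheme \<Rightarrow> 'c \<Rightarrow> 'c" ("vinv\<index> _" [81] 80)
  where "vinv\<^bsub>C\<^esub> \<alpha> =
    (THE \<beta>. \<beta> \<in> hom2 C (Tgt C \<alpha>) (Src C \<alpha>) \<and>
      \<alpha> \<Zsemi>\<^bsub>C\<^esub> \<beta> = Id2 C (Src C \<alpha>) \<and> \<beta> \<Zsemi>\<^bsub>C\<^esub> \<alpha> = Id2 C (Tgt C \<alpha>))"

locale two_category =
  fixes C :: "('o, 'a, 'c, 'z) two_cat_scheme" (structure)
  assumes Dom_in: "f \<in> Arr C \<Longrightarrow> Dom C f \<in> Obj C"
    and Cod_in: "f \<in> Arr C \<Longrightarrow> Cod C f \<in> Obj C"
    and Src_in: "\<alpha> \<in> Cell C \<Longrightarrow> Src C \<alpha> \<in> Arr C"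
    and Tgt_in: "\<alpha> \<in> Cell C \<Longrightarrow> Tgt C \<alpha> \<in> Arr C"
    and Dom_Src: "\<alpha> \<in> Cell C \<Longrightarrow> Dom C (Src C \<alpha>) = Dom C (Tgt C \<alpha>)"
    and Cod_Src: "\<alpha> \<in> Cell C \<Longrightarrow> Cod C (Src C \<alpha>) = Cod C (Tgt C \<alpha>)"
    and Id1_in: "A \<in> Obj C \<Longrightarrow> Id1 C A \<in> hom1 C A A"
    and comp1_in: "\<lbrakk>f \<in> hom1 C A B; g \<in> hom1 C B D\<rbrakk> \<Longrightarrow> g \<cdot> f \<in> hom1 C A D"
    and comp1_Id1_left: "f \<in> hom1 C A B \<Longrightarrow> Id1 C B \<cdot> f = f"
    and comp1_Id1_right: "f \<in> hom1 C A B \<Longrightarrow> f \<cdot> Id1 C A = f"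
    and comp1_assoc: "\<lbrakk>f \<in> hom1 C A B; g \<in> hom1 C B D; h \<in> hom1 C D E\<rbrakk>
      \<Longrightarrow> (h \<cdot> g) \<cdot> f = h \<cdot> (g \<cdot> f)"
    and Id2_in: "f \<in> Arr C \<Longrightarrow> Id2 C f \<in> hom2 C f f"
    and vcomp_in: "\<lbrakk>\<alpha> \<in> hom2 C f g; \<beta> \<in> hom2 C g h\<rbrakk> \<Longrightarrow> \<alpha> \<Zsemi> \<beta> \<in> hom2 C f h"
    and vcomp_Id2_left: "\<alpha> \<in> hom2 C f g \<Longrightarrow> Id2 C f \<Zsemi> \<alpha> = \<alpha>"
    and vcomp_Id2_right: "\<alpha> \<in> hom2 C f g \<Longrightarrow> \<alpha> \<Zsemi> Id2 C g = \<alpha>"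
    and vcomp_assoc: "\<lbrakk>\<alpha> \<in> hom2 C f g; \<beta> \<in> hom2 C g h; \<gamma> \<in> hom2 C h k\<rbrakk>
      \<Longrightarrow> (\<alpha> \<Zsemi> \<beta>) \<Zsemi> \<gamma> = \<alpha> \<Zsemi> (\<beta> \<Zsemi> \<gamma>)"
    and hcomp_in: "\<lbrakk>\<alpha> \<in> hom2 C f f'; \<beta> \<in> hom2 C g g'; Cod C f = Dom C g\<rbrakk>
      \<Longrightarrow> \<beta> \<star> \<alpha> \<in> hom2 C (g \<cdot> f) (g' \<cdot> f')"
    and hcomp_Id_left: "\<lbrakk>\<alpha> \<in> hom2 C f f'; Cod C f = B\<rbrakk> \<Longrightarrow> Id2 C (Id1 C B) \<star> \<alpha> = \<alpha>"
    and hcomp_Id_right: "\<lbrakk>\<alpha> \<in> hom2 C f f'; Dom C f = A\<rbrakk> \<Longrightarrow> \<alpha> \<star> Id2 C (Id1 C A) = \<alpha>"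
    and hcomp_assoc: "\<lbrakk>\<alpha> \<in> hom2 C f f'; \<beta> \<in> hom2 C g g'; \<gamma> \<in> hom2 C h h';
        Cod C f = Dom C g; Cod C g = Dom C h\<rbrakk> \<Longrightarrow> (\<gamma> \<star> \<beta>) \<star> \<alpha> = \<gamma> \<star> (\<beta> \<star> \<alpha>)"
    and hcomp_Id2: "\<lbrakk>f \<in> hom1 C A B; g \<in> hom1 C B D\<rbrakk> \<Longrightarrow> Id2 C g \<star> Id2 C f = Id2 C (g \<cdot> f)"
    and interchange: "\<lbrakk>\<alpha> \<in> hom2 C f f'; \<alpha>' \<in> hom2 C f' f''; \<beta> \<in> hom2 C g g'; \<beta>' \<in> hom2 C g' g'';
        Cod C f = Dom C g\<rbrakk> \<Longrightarrow> (\<beta> \<Zsemi> \<beta>') \<star> (\<alpha> \<Zsemi> \<alpha>') = (\<beta> \<star> \<alpha>) \<Zsemi> (\<beta>' \<star> \<alpha>')"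


section \<open>Endo-pseudofunctors\<close>

text \<open>
  The constraints of a pseudofunctor \<open>F\<close> are \<open>fcmp F g f : F g \<cdot> F f \<Rightarrow> F (g \<cdot> f)\<close> and
  \<open>funt F A : 1 \<Rightarrow> F 1\<close>.
\<close>

record ('o, 'a, 'c) pseudofun =
  on0 :: "'o \<Rightarrow> 'o"
  on1 :: "'a \<Rightarrow> 'a"
  on2 :: "'c \<Rightarrow> 'c"
  fcmp :: "'a \<Rightarrow> 'a \<Rightarrow> 'c"
  funt :: "'o \<Rightarrow> 'c"

locale pseudofunctor = two_category C
  for C :: "('o, 'a, 'c, 'z) two_cat_scheme" (structure) +
  fixes F :: "('o, 'a, 'c) pseudofun"
  assumes on0_in: "A \<in> Obj C \<Longrightarrow> on0 F A \<in> Obj C"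
    and on1_in: "f \<in> hom1 C A B \<Longrightarrow> on1 F f \<in> hom1 C (on0 F A) (on0 F B)"
    and on2_in: "\<alpha> \<in> hom2 C f g \<Longrightarrow> on2 F \<alpha> \<in> hom2 C (on1 F f) (on1 F g)"
    and on2_Id2: "f \<in> Arr C \<Longrightarrow> on2 F (Id2 C f) = Id2 C (on1 F f)"
    and on2_vcomp: "\<lbrakk>\<alpha> \<in> hom2 C f g; \<beta> \<in> hom2 C g h\<rbrakk> \<Longrightarrow> on2 F (\<alpha> \<Zsemi> \<beta>) = on2 F \<alpha> \<Zsemi> on2 F \<beta>"
    and fcmp_iso: "\<lbrakk>f \<in> hom1 C A B; g \<in> hom1 C B D\<rbrakk>
      \<Longrightarrow> fcmp F g f \<in> iso2 C (on1 F g \<cdot> on1 F f) (on1 F (g \<cdot> f))"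
    and funt_iso: "A \<in> Obj C \<Longrightarrow> funt F A \<in> iso2 C (Id1 C (on0 F A)) (on1 F (Id1 C A))"
    and fcmp_natural: "\<lbrakk>\<alpha> \<in> hom2 C f f'; \<beta> \<in> hom2 C g g'; Cod C f = Dom C g\<rbrakk>
      \<Longrightarrow> fcmp F g f \<Zsemi> on2 F (\<beta> \<star> \<alpha>) = (on2 F \<beta> \<star> on2 F \<alpha>) \<Zsemi> fcmp F g' f'"
    and fcmp_assoc: "\<lbrakk>f \<in> hom1 C A B; g \<in> hom1 C B D; h \<in> hom1 C D E\<rbrakk>
      \<Longrightarrow> (on1 F h \<rhd> fcmp F g f) \<Zsemi> fcmp F h (g \<cdot> f) = (fcmp F h g \<lhd> on1 F f) \<Zsemi> fcmp F (h \<cdot> g) f"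
    and fcmp_unit_left: "f \<in> hom1 C A B
      \<Longrightarrow> (funt F B \<lhd> on1 F f) \<Zsemi> fcmp F (Id1 C B) f = Id2 C (on1 F f)"
    and fcmp_unit_right: "f \<in> hom1 C A B
      \<Longrightarrow> (on1 F f \<rhd> funt F A) \<Zsemi> fcmp F f (Id1 C A) = Id2 C (on1 F f)"

definition fcmp3 ::
  "('o, 'a, 'c, 'z) two_cat_scheme \<Rightarrow> ('o, 'a, 'c) pseudofun \<Rightarrow> 'a \<Rightarrow> 'a \<Rightarrow> 'a \<Rightarrow> 'c"
  where "fcmp3 C F h g f = (on1 F h \<rhd>\<^bsub>C\<^esub> fcmp F g f) \<Zsemi>\<^bsub>C\<^esub> fcmp F h (g \<cdot>\<^bsub>C\<^esub> f)"

definition pf_id :: "('o, 'a, 'c, 'z) two_cat_scheme \<Rightarrow> ('o, 'a, 'c) pseudofun"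
  where "pf_id C = \<lparr>on0 = (\<lambda>A. A), on1 = (\<lambda>f. f), on2 = (\<lambda>\<alpha>. \<alpha>),
    fcmp = (\<lambda>g f. Id2 C (g \<cdot>\<^bsub>C\<^esub> f)), funt = (\<lambda>A. Id2 C (Id1 C A))\<rparr>"

definition pf_comp :: "('o, 'a, 'c, 'z) two_cat_scheme \<Rightarrow>
    ('o, 'a, 'c) pseudofun \<Rightarrow> ('o, 'a, 'c) pseudofun \<Rightarrow> ('o, 'a, 'c) pseudofun"
    (infixr "\<bullet>\<index>" 75)
  where "G \<bullet>\<^bsub>C\<^esub> F = \<lparr>on0 = (\<lambda>A. on0 G (on0 F A)), on1 = (\<lambda>f. on1 G (on1 F f)),
    on2 = (\<lambda>\<alpha>. on2 G (on2 F \<alpha>)),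
    fcmp = (\<lambda>g f. fcmp G (on1 F g) (on1 F f) \<Zsemi>\<^bsub>C\<^esub> on2 G (fcmp F g f)),
    funt = (\<lambda>A. funt G (on0 F A) \<Zsemi>\<^bsub>C\<^esub> on2 G (funt F A))\<rparr>"


section \<open>Pseudonatural transformations and modifications\<close>

text \<open>
  A pseudonatural transformation \<open>\<alpha> : F \<rightarrow> G\<close> has components \<open>\<alpha>\<langle>A\<rangle> : F A \<rightarrow> G A\<close>; its constraint at
  \<open>f : A \<rightarrow> B\<close> is oriented as \<open>\<alpha>\<llangle>f\<rrangle> : G f \<cdot> \<alpha>\<langle>A\<rangle> \<Rightarrow> \<alpha>\<langle>B\<rangle> \<cdot> F f\<close>.
\<close>

record ('o, 'a, 'c) pseudonat =
  cmpt :: "'o \<Rightarrow> 'a" ("_\<langle>_\<rangle>" [1000, 0] 1000)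
  cnat :: "'a \<Rightarrow> 'c" ("_\<llangle>_\<rrangle>" [1000, 0] 1000)

locale pseudonatural = two_category C + F: pseudofunctor C F + G: pseudofunctor C G
  for C :: "('o, 'a, 'c, 'z) two_cat_scheme" (structure)
    and F :: "('o, 'a, 'c) pseudofun" and G :: "('o, 'a, 'c) pseudofun" +
  fixes \<alpha> :: "('o, 'a, 'c) pseudonat"
  assumes cmpt_in: "A \<in> Obj C \<Longrightarrow> \<alpha>\<langle>A\<rangle> \<in> hom1 C (on0 F A) (on0 G A)"
    and cnat_iso: "f \<in> hom1 C A B \<Longrightarrow> \<alpha>\<llangle>f\<rrangle> \<in> iso2 C (on1 G f \<cdot> \<alpha>\<langle>A\<rangle>) (\<alpha>\<langle>B\<rangle> \<cdot> on1 F f)"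
    and cnat_natural: "\<lbrakk>f \<in> hom1 C A B; \<sigma> \<in> hom2 C f g\<rbrakk>
      \<Longrightarrow> (on2 G \<sigma> \<lhd> \<alpha>\<langle>A\<rangle>) \<Zsemi> \<alpha>\<llangle>g\<rrangle> = \<alpha>\<llangle>f\<rrangle> \<Zsemi> (\<alpha>\<langle>B\<rangle> \<rhd> on2 F \<sigma>)"
    and cnat_Id1: "A \<in> Obj C
      \<Longrightarrow> (funt G A \<lhd> \<alpha>\<langle>A\<rangle>) \<Zsemi> \<alpha>\<llangle>Id1 C A\<rrangle> = \<alpha>\<langle>A\<rangle> \<rhd> funt F A"
    and cnat_comp1: "\<lbrakk>f \<in> hom1 C A B; g \<in> hom1 C B D\<rbrakk>
      \<Longrightarrow> (fcmp G g f \<lhd> \<alpha>\<langle>A\<rangle>) \<Zsemi> \<alpha>\<llangle>g \<cdot> f\<rrangle> =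
          (on1 G g \<rhd> \<alpha>\<llangle>f\<rrangle>) \<Zsemi> (\<alpha>\<llangle>g\<rrangle> \<lhd> on1 F f) \<Zsemi> (\<alpha>\<langle>D\<rangle> \<rhd> fcmp F g f)"

definition pn_id :: "('o, 'a, 'c, 'z) two_cat_scheme \<Rightarrow> ('o, 'a, 'c) pseudofun \<Rightarrow> ('o, 'a, 'c) pseudonat"
  where "pn_id C F = \<lparr>cmpt = (\<lambda>A. Id1 C (on0 F A)), cnat = (\<lambda>f. Id2 C (on1 F f))\<rparr>"

definition pn_comp :: "('o, 'a, 'c, 'z) two_cat_scheme \<Rightarrow>
    ('o, 'a, 'c) pseudonat \<Rightarrow> ('o, 'a, 'c) pseudonat \<Rightarrow> ('o, 'a, 'c) pseudonat"
    (infixr "\<odot>\<index>" 75)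
  where "\<beta> \<odot>\<^bsub>C\<^esub> \<alpha> = \<lparr>cmpt = (\<lambda>A. \<beta>\<langle>A\<rangle> \<cdot>\<^bsub>C\<^esub> \<alpha>\<langle>A\<rangle>),
    cnat = (\<lambda>f. (\<beta>\<llangle>f\<rrangle> \<lhd>\<^bsub>C\<^esub> \<alpha>\<langle>Dom C f\<rangle>) \<Zsemi>\<^bsub>C\<^esub> (\<beta>\<langle>Cod C f\<rangle> \<rhd>\<^bsub>C\<^esub> \<alpha>\<llangle>f\<rrangle>))\<rparr>"

text \<open>The whiskering \<open>\<alpha> H\<close>.\<close>

definition pn_rwhisk :: "('o, 'a, 'c) pseudonat \<Rightarrow> ('o, 'a, 'c) pseudofun \<Rightarrow> ('o, 'a, 'c) pseudonat"
  where "pn_rwhisk \<alpha> H = \<lparr>cmpt = (\<lambda>A. \<alpha>\<langle>on0 H A\<rangle>), cnat = (\<lambda>f. \<alpha>\<llangle>on1 H f\<rrangle>)\<rparr>"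

text \<open>The whiskering \<open>H \<alpha>\<close> for \<open>\<alpha> : F \<rightarrow> G\<close>.\<close>

definition pn_lwhisk :: "('o, 'a, 'c, 'z) two_cat_scheme \<Rightarrow> ('o, 'a, 'c) pseudofun \<Rightarrow>
    ('o, 'a, 'c) pseudofun \<Rightarrow> ('o, 'a, 'c) pseudofun \<Rightarrow> ('o, 'a, 'c) pseudonat \<Rightarrow> ('o, 'a, 'c) pseudonat"
  where "pn_lwhisk C H F G \<alpha> = \<lparr>cmpt = (\<lambda>A. on1 H (\<alpha>\<langle>A\<rangle>)),
    cnat = (\<lambda>f. fcmp H (on1 G f) (\<alpha>\<langle>Dom C f\<rangle>) \<Zsemi>\<^bsub>C\<^esub> on2 H (\<alpha>\<llangle>f\<rrangle>)
              \<Zsemi>\<^bsub>C\<^esub> vinv\<^bsub>C\<^esub> (fcmp H (\<alpha>\<langle>Cod C f\<rangle>) (on1 F f)))\<rparr>"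

text \<open>
  Invertible modifications \<open>\<Gamma> : \<alpha> \<Rrightarrow> \<beta>\<close> between pseudonatural transformations \<open>\<alpha>, \<beta> : F \<rightarrow> G\<close>.
\<close>

definition inv_modification :: "('o, 'a, 'c, 'z) two_cat_scheme \<Rightarrow>
    ('o, 'a, 'c) pseudofun \<Rightarrow> ('o, 'a, 'c) pseudofun \<Rightarrow>
    ('o, 'a, 'c) pseudonat \<Rightarrow> ('o, 'a, 'c) pseudonat \<Rightarrow> ('o \<Rightarrow> 'c) \<Rightarrow> bool"
  where "inv_modification C F G \<alpha> \<beta> \<Gamma> \<longleftrightarrow>
    (\<forall>A \<in> Obj C. \<Gamma> A \<in> iso2 C (\<alpha>\<langle>A\<rangle>) (\<beta>\<langle>A\<rangle>)) \<and>
    (\<forall>A B f. f \<in> hom1 C A B \<longrightarrow>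
      (on1 G f \<rhd>\<^bsub>C\<^esub> \<Gamma> A) \<Zsemi>\<^bsub>C\<^esub> \<beta>\<llangle>f\<rrangle> = \<alpha>\<llangle>f\<rrangle> \<Zsemi>\<^bsub>C\<^esub> (\<Gamma> B \<lhd>\<^bsub>C\<^esub> on1 F f))"


section \<open>Pseudomonads\<close>

record ('o, 'a, 'c) pseudomon =
  mfun :: "('o, 'a, 'c) pseudofun"
  unit :: "('o, 'a, 'c) pseudonat"
  mult :: "('o, 'a, 'c) pseudonat"
  lunit :: "'o \<Rightarrow> 'c"
  runit :: "'o \<Rightarrow> 'c"
  massoc :: "'o \<Rightarrow> 'c"

locale pseudomonad_data =
  fixes C :: "('o, 'a, 'c, 'z) two_cat_scheme" (structure)
    and M :: "('o, 'a, 'c) pseudomon"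
begin

abbreviation "T \<equiv> mfun M"
abbreviation "u \<equiv> unit M"
abbreviation "m \<equiv> mult M"

end

locale pseudomonad = two_category C + pseudomonad_data C M
  for C :: "('o, 'a, 'c, 'z) two_cat_scheme" (structure) and M +
  assumes pseudofunctor: "pseudofunctor C T"
    and unit_pseudonatural: "pseudonatural C (pf_id C) T u"
    and mult_pseudonatural: "pseudonatural C (T \<bullet> T) T m"
    and lunit_modification:
      "inv_modification C T T (m \<odot> pn_rwhisk u T) (pn_id C T) (lunit M)"
    and runit_modification:
      "inv_modification C T T (m \<odot> pn_lwhisk C T (pf_id C) T u) (pn_id C T) (runit M)"
    and massoc_modification:
      "inv_modification C (T \<bullet> T \<bullet> T) T
        (m \<odot> pn_lwhisk C T (T \<bullet> T) T m) (m \<odot> pn_rwhisk m T) (massoc M)"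
    and triangle: "A \<in> Obj C \<Longrightarrow>
      (massoc M A \<lhd> on1 T (u\<langle>on0 T A\<rangle>)) \<Zsemi> (m\<langle>A\<rangle> \<rhd> runit M (on0 T A)) =
      m\<langle>A\<rangle> \<rhd> (fcmp T (m\<langle>A\<rangle>) (u\<langle>on0 T A\<rangle>) \<Zsemi> on2 T (lunit M A) \<Zsemi> vinv (funt T (on0 T A)))"
    and pentagon: "A \<in> Obj C \<Longrightarrow>
      (m\<langle>A\<rangle> \<rhd> (fcmp T (m\<langle>A\<rangle>) (on1 T (m\<langle>A\<rangle>)) \<Zsemi> on2 T (massoc M A)
                \<Zsemi> vinv (fcmp T (m\<langle>A\<rangle>) (m\<langle>on0 T A\<rangle>))))
        \<Zsemi> (massoc M A \<lhd> on1 T (m\<langle>on0 T A\<rangle>))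
        \<Zsemi> (m\<langle>A\<rangle> \<rhd> massoc M (on0 T A)) =
      (massoc M A \<lhd> on1 T (on1 T (m\<langle>A\<rangle>)))
        \<Zsemi> (m\<langle>A\<rangle> \<rhd> vinv (m\<llangle>m\<langle>A\<rangle>\<rrangle>))
        \<Zsemi> (massoc M A \<lhd> m\<langle>on0 T (on0 T A)\<rangle>)"


section \<open>Pseudodistributive laws in pseudomonoidal form\<close>

record ('o, 'a, 'c) pseudodist =
  law :: "('o, 'a, 'c) pseudonat"
  omega1 :: "'o \<Rightarrow> 'c"
  omega2 :: "'o \<Rightarrow> 'c"
  omega3 :: "'o \<Rightarrow> 'c"
  omega4 :: "'o \<Rightarrow> 'c"

text \<open>
  In the equations below each \<open>\<Zsemi>\<close>-separated factor is one step of the chain of 2-cells, taken at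
  the component \<open>A\<close>. The letters \<open>l\<close>, \<open>r\<close>, \<open>a\<close> denote the structure modifications
  \<open>m \<cdot> uT \<cong> 1\<close>, \<open>m \<cdot> Tu \<cong> 1\<close>, \<open>m \<cdot> Tm \<cong> m \<cdot> mT\<close>, and \<open>\<Lambda>\<close> is the transformation \<open>TP \<rightarrow> PT\<close>.
\<close>

locale pseudodist_data =
  fixes C :: "('o, 'a, 'c, 'z) two_cat_scheme" (structure)
    and MT :: "('o, 'a, 'c) pseudomon"
    and MP :: "('o, 'a, 'c) pseudomon"
    and L :: "('o, 'a, 'c) pseudodist"
begin

abbreviation "T \<equiv> mfun MT"
abbreviation "T\<^sub>0 \<equiv> on0 T"
abbreviation "T\<^sub>1 \<equiv> on1 T"
abbreviation "T\<^sub>2 \<equiv> on2 T"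
abbreviation "u \<equiv> unit MT"
abbreviation "m \<equiv> mult MT"
abbreviation "lT \<equiv> lunit MT"
abbreviation "rT \<equiv> runit MT"
abbreviation "aT \<equiv> massoc MT"
abbreviation "P \<equiv> mfun MP"
abbreviation "P\<^sub>0 \<equiv> on0 P"
abbreviation "P\<^sub>1 \<equiv> on1 P"
abbreviation "P\<^sub>2 \<equiv> on2 P"
abbreviation "\<eta> \<equiv> unit MP"
abbreviation "\<mu> \<equiv> mult MP"
abbreviation "lP \<equiv> lunit MP"
abbreviation "rP \<equiv> runit MP"
abbreviation "aP \<equiv> massoc MP"
abbreviation "\<Lambda> \<equiv> law L"
abbreviation "\<omega>\<^sub>1 \<equiv> omega1 L"
abbreviation "\<omega>\<^sub>2 \<equiv> omega2 L"
abbreviation "\<omega>\<^sub>3 \<equiv> omega3 L"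
abbreviation "\<omega>\<^sub>4 \<equiv> omega4 L"

definition W1 :: bool where
  "W1 \<longleftrightarrow> (\<forall>A \<in> Obj C.
    ((funt P (T\<^sub>0 A) \<Zsemi> P\<^sub>2 (vinv (rT A)) \<Zsemi> vinv (fcmp P (m\<langle>A\<rangle>) (T\<^sub>1 (u\<langle>A\<rangle>)))) \<lhd> \<Lambda>\<langle>A\<rangle>)
    \<Zsemi> (P\<^sub>1 (m\<langle>A\<rangle>) \<rhd> \<Lambda>\<llangle>u\<langle>A\<rangle>\<rrangle>)
    \<Zsemi> (P\<^sub>1 (m\<langle>A\<rangle>) \<cdot> \<Lambda>\<langle>T\<^sub>0 A\<rangle> \<rhd> (T\<^sub>2 (\<omega>\<^sub>1 A) \<Zsemi> vinv (fcmp T (\<Lambda>\<langle>A\<rangle>) (u\<langle>P\<^sub>0 A\<rangle>))))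
    \<Zsemi> (\<omega>\<^sub>3 A \<lhd> T\<^sub>1 (u\<langle>P\<^sub>0 A\<rangle>))
    \<Zsemi> (\<Lambda>\<langle>A\<rangle> \<rhd> rT (P\<^sub>0 A))
    = Id2 C (\<Lambda>\<langle>A\<rangle>))"

definition W2 :: bool where
  "W2 \<longleftrightarrow> (\<forall>A \<in> Obj C.
    (\<Lambda>\<langle>A\<rangle> \<rhd> (funt T (P\<^sub>0 A) \<Zsemi> T\<^sub>2 (vinv (lP A)) \<Zsemi> vinv (fcmp T (\<mu>\<langle>A\<rangle>) (\<eta>\<langle>P\<^sub>0 A\<rangle>))))
    \<Zsemi> (\<omega>\<^sub>4 A \<lhd> T\<^sub>1 (\<eta>\<langle>P\<^sub>0 A\<rangle>))
    \<Zsemi> (\<mu>\<langle>T\<^sub>0 A\<rangle> \<cdot> P\<^sub>1 (\<Lambda>\<langle>A\<rangle>) \<rhd> \<omega>\<^sub>2 (P\<^sub>0 A))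
    \<Zsemi> (\<mu>\<langle>T\<^sub>0 A\<rangle> \<rhd> \<eta>\<llangle>\<Lambda>\<langle>A\<rangle>\<rrangle>)
    \<Zsemi> (lP (T\<^sub>0 A) \<lhd> \<Lambda>\<langle>A\<rangle>)
    = Id2 C (\<Lambda>\<langle>A\<rangle>))"

definition W3 :: bool where
  "W3 \<longleftrightarrow> (\<forall>A \<in> Obj C.
    (P\<^sub>1 (m\<langle>A\<rangle>) \<rhd> \<Lambda>\<llangle>m\<langle>A\<rangle>\<rrangle> \<lhd> T\<^sub>1 (\<Lambda>\<langle>T\<^sub>0 A\<rangle>) \<cdot> T\<^sub>1 (T\<^sub>1 (\<Lambda>\<langle>A\<rangle>)))
    \<Zsemi> (P\<^sub>1 (m\<langle>A\<rangle>) \<cdot> \<Lambda>\<langle>T\<^sub>0 A\<rangle> \<rhd>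
          (fcmp3 C T (P\<^sub>1 (m\<langle>A\<rangle>)) (\<Lambda>\<langle>T\<^sub>0 A\<rangle>) (T\<^sub>1 (\<Lambda>\<langle>A\<rangle>)) \<Zsemi> T\<^sub>2 (\<omega>\<^sub>3 A)
            \<Zsemi> vinv (fcmp T (\<Lambda>\<langle>A\<rangle>) (m\<langle>P\<^sub>0 A\<rangle>))))
    \<Zsemi> (\<omega>\<^sub>3 A \<lhd> T\<^sub>1 (m\<langle>P\<^sub>0 A\<rangle>))
    \<Zsemi> (\<Lambda>\<langle>A\<rangle> \<rhd> aT (P\<^sub>0 A))
    =
    ((fcmp P (m\<langle>A\<rangle>) (T\<^sub>1 (m\<langle>A\<rangle>)) \<Zsemi> P\<^sub>2 (aT A) \<Zsemi> vinv (fcmp P (m\<langle>A\<rangle>) (m\<langle>T\<^sub>0 A\<rangle>)))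
        \<lhd> \<Lambda>\<langle>T\<^sub>0 (T\<^sub>0 A)\<rangle> \<cdot> T\<^sub>1 (\<Lambda>\<langle>T\<^sub>0 A\<rangle>) \<cdot> T\<^sub>1 (T\<^sub>1 (\<Lambda>\<langle>A\<rangle>)))
    \<Zsemi> (P\<^sub>1 (m\<langle>A\<rangle>) \<rhd> \<omega>\<^sub>3 (T\<^sub>0 A) \<lhd> T\<^sub>1 (T\<^sub>1 (\<Lambda>\<langle>A\<rangle>)))
    \<Zsemi> (P\<^sub>1 (m\<langle>A\<rangle>) \<cdot> \<Lambda>\<langle>T\<^sub>0 A\<rangle> \<rhd> vinv (m\<llangle>\<Lambda>\<langle>A\<rangle>\<rrangle>))
    \<Zsemi> (\<omega>\<^sub>3 A \<lhd> m\<langle>T\<^sub>0 (P\<^sub>0 A)\<rangle>))"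

definition W4 :: bool where
  "W4 \<longleftrightarrow> (\<forall>A \<in> Obj C.
    (\<Lambda>\<langle>A\<rangle> \<rhd> (fcmp T (\<mu>\<langle>A\<rangle>) (P\<^sub>1 (\<mu>\<langle>A\<rangle>)) \<Zsemi> T\<^sub>2 (aP A) \<Zsemi> vinv (fcmp T (\<mu>\<langle>A\<rangle>) (\<mu>\<langle>P\<^sub>0 A\<rangle>))))
    \<Zsemi> (\<omega>\<^sub>4 A \<lhd> T\<^sub>1 (\<mu>\<langle>P\<^sub>0 A\<rangle>))
    \<Zsemi> (\<mu>\<langle>T\<^sub>0 A\<rangle> \<cdot> P\<^sub>1 (\<Lambda>\<langle>A\<rangle>) \<rhd> \<omega>\<^sub>4 (P\<^sub>0 A))
    \<Zsemi> (\<mu>\<langle>T\<^sub>0 A\<rangle> \<rhd> \<mu>\<llangle>\<Lambda>\<langle>A\<rangle>\<rrangle> \<lhd> P\<^sub>1 (\<Lambda>\<langle>P\<^sub>0 A\<rangle>) \<cdot> \<Lambda>\<langle>P\<^sub>0 (P\<^sub>0 A)\<rangle>)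
    =
    (\<omega>\<^sub>4 A \<lhd> T\<^sub>1 (P\<^sub>1 (\<mu>\<langle>A\<rangle>)))
    \<Zsemi> (\<mu>\<langle>T\<^sub>0 A\<rangle> \<cdot> P\<^sub>1 (\<Lambda>\<langle>A\<rangle>) \<rhd> vinv (\<Lambda>\<llangle>\<mu>\<langle>A\<rangle>\<rrangle>))
    \<Zsemi> (\<mu>\<langle>T\<^sub>0 A\<rangle> \<rhd>
          (fcmp P (\<Lambda>\<langle>A\<rangle>) (T\<^sub>1 (\<mu>\<langle>A\<rangle>)) \<Zsemi> P\<^sub>2 (\<omega>\<^sub>4 A)
            \<Zsemi> vinv (fcmp3 C P (\<mu>\<langle>T\<^sub>0 A\<rangle>) (P\<^sub>1 (\<Lambda>\<langle>A\<rangle>)) (\<Lambda>\<langle>P\<^sub>0 A\<rangle>)))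
        \<lhd> \<Lambda>\<langle>P\<^sub>0 (P\<^sub>0 A)\<rangle>)
    \<Zsemi> (aP (T\<^sub>0 A) \<lhd> P\<^sub>1 (P\<^sub>1 (\<Lambda>\<langle>A\<rangle>)) \<cdot> P\<^sub>1 (\<Lambda>\<langle>P\<^sub>0 A\<rangle>) \<cdot> \<Lambda>\<langle>P\<^sub>0 (P\<^sub>0 A)\<rangle>))"

definition W5 :: bool where
  "W5 \<longleftrightarrow> (\<forall>A \<in> Obj C.
    (P\<^sub>1 (m\<langle>A\<rangle>) \<cdot> \<Lambda>\<langle>T\<^sub>0 A\<rangle> \<rhd>
          (fcmp T (\<Lambda>\<langle>A\<rangle>) (T\<^sub>1 (\<mu>\<langle>A\<rangle>)) \<Zsemi> T\<^sub>2 (\<omega>\<^sub>4 A)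
            \<Zsemi> vinv (fcmp3 C T (\<mu>\<langle>T\<^sub>0 A\<rangle>) (P\<^sub>1 (\<Lambda>\<langle>A\<rangle>)) (\<Lambda>\<langle>P\<^sub>0 A\<rangle>))))
    \<Zsemi> (P\<^sub>1 (m\<langle>A\<rangle>) \<rhd> \<omega>\<^sub>4 (T\<^sub>0 A) \<lhd> T\<^sub>1 (P\<^sub>1 (\<Lambda>\<langle>A\<rangle>)) \<cdot> T\<^sub>1 (\<Lambda>\<langle>P\<^sub>0 A\<rangle>))
    \<Zsemi> (\<mu>\<llangle>m\<langle>A\<rangle>\<rrangle> \<lhd> P\<^sub>1 (\<Lambda>\<langle>T\<^sub>0 A\<rangle>) \<cdot> \<Lambda>\<langle>P\<^sub>0 (T\<^sub>0 A)\<rangle> \<cdot> T\<^sub>1 (P\<^sub>1 (\<Lambda>\<langle>A\<rangle>)) \<cdot> T\<^sub>1 (\<Lambda>\<langle>P\<^sub>0 A\<rangle>))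
    \<Zsemi> (\<mu>\<langle>T\<^sub>0 A\<rangle> \<cdot> P\<^sub>1 (P\<^sub>1 (m\<langle>A\<rangle>)) \<cdot> P\<^sub>1 (\<Lambda>\<langle>T\<^sub>0 A\<rangle>) \<rhd> vinv (\<Lambda>\<llangle>\<Lambda>\<langle>A\<rangle>\<rrangle>) \<lhd> T\<^sub>1 (\<Lambda>\<langle>P\<^sub>0 A\<rangle>))
    \<Zsemi> (\<mu>\<langle>T\<^sub>0 A\<rangle> \<rhd>
          (fcmp3 C P (P\<^sub>1 (m\<langle>A\<rangle>)) (\<Lambda>\<langle>T\<^sub>0 A\<rangle>) (T\<^sub>1 (\<Lambda>\<langle>A\<rangle>)) \<Zsemi> P\<^sub>2 (\<omega>\<^sub>3 A)
            \<Zsemi> vinv (fcmp P (\<Lambda>\<langle>A\<rangle>) (m\<langle>P\<^sub>0 A\<rangle>)))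
        \<lhd> \<Lambda>\<langle>T\<^sub>0 (P\<^sub>0 A)\<rangle> \<cdot> T\<^sub>1 (\<Lambda>\<langle>P\<^sub>0 A\<rangle>))
    \<Zsemi> (\<mu>\<langle>T\<^sub>0 A\<rangle> \<cdot> P\<^sub>1 (\<Lambda>\<langle>A\<rangle>) \<rhd> \<omega>\<^sub>3 (P\<^sub>0 A))
    =
    (\<omega>\<^sub>3 A \<lhd> T\<^sub>1 (T\<^sub>1 (\<mu>\<langle>A\<rangle>)))
    \<Zsemi> (\<Lambda>\<langle>A\<rangle> \<rhd> vinv (m\<llangle>\<mu>\<langle>A\<rangle>\<rrangle>))
    \<Zsemi> (\<omega>\<^sub>4 A \<lhd> m\<langle>P\<^sub>0 (P\<^sub>0 A)\<rangle>))"

definition W6 :: bool where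
  "W6 \<longleftrightarrow> (\<forall>A \<in> Obj C.
    ((funt P (T\<^sub>0 A) \<Zsemi> P\<^sub>2 (vinv (lT A)) \<Zsemi> vinv (fcmp P (m\<langle>A\<rangle>) (u\<langle>T\<^sub>0 A\<rangle>))) \<lhd> \<Lambda>\<langle>A\<rangle>)
    \<Zsemi> (P\<^sub>1 (m\<langle>A\<rangle>) \<rhd> \<omega>\<^sub>1 (T\<^sub>0 A) \<lhd> \<Lambda>\<langle>A\<rangle>)
    \<Zsemi> (P\<^sub>1 (m\<langle>A\<rangle>) \<cdot> \<Lambda>\<langle>T\<^sub>0 A\<rangle> \<rhd> vinv (u\<llangle>\<Lambda>\<langle>A\<rangle>\<rrangle>))
    \<Zsemi> (\<omega>\<^sub>3 A \<lhd> u\<langle>T\<^sub>0 (P\<^sub>0 A)\<rangle>)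
    \<Zsemi> (\<Lambda>\<langle>A\<rangle> \<rhd> lT (P\<^sub>0 A))
    = Id2 C (\<Lambda>\<langle>A\<rangle>))"

definition W7 :: bool where
  "W7 \<longleftrightarrow> (\<forall>A \<in> Obj C.
    (\<Lambda>\<langle>A\<rangle> \<rhd> (funt T (P\<^sub>0 A) \<Zsemi> T\<^sub>2 (vinv (rP A)) \<Zsemi> vinv (fcmp T (\<mu>\<langle>A\<rangle>) (P\<^sub>1 (\<eta>\<langle>A\<rangle>)))))
    \<Zsemi> (\<omega>\<^sub>4 A \<lhd> T\<^sub>1 (P\<^sub>1 (\<eta>\<langle>A\<rangle>)))
    \<Zsemi> (\<mu>\<langle>T\<^sub>0 A\<rangle> \<cdot> P\<^sub>1 (\<Lambda>\<langle>A\<rangle>) \<rhd> vinv (\<Lambda>\<llangle>\<eta>\<langle>A\<rangle>\<rrangle>))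
    \<Zsemi> (\<mu>\<langle>T\<^sub>0 A\<rangle> \<rhd> (fcmp P (\<Lambda>\<langle>A\<rangle>) (T\<^sub>1 (\<eta>\<langle>A\<rangle>)) \<Zsemi> P\<^sub>2 (\<omega>\<^sub>2 A)) \<lhd> \<Lambda>\<langle>A\<rangle>)
    \<Zsemi> (rP (T\<^sub>0 A) \<lhd> \<Lambda>\<langle>A\<rangle>)
    = Id2 C (\<Lambda>\<langle>A\<rangle>))"

definition W8 :: bool where
  "W8 \<longleftrightarrow> (\<forall>A \<in> Obj C.
    (\<omega>\<^sub>3 A \<lhd> T\<^sub>1 (T\<^sub>1 (\<eta>\<langle>A\<rangle>)))
    \<Zsemi> (\<Lambda>\<langle>A\<rangle> \<rhd> vinv (m\<llangle>\<eta>\<langle>A\<rangle>\<rrangle>))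
    \<Zsemi> (\<omega>\<^sub>2 A \<lhd> m\<langle>A\<rangle>)
    =
    (P\<^sub>1 (m\<langle>A\<rangle>) \<cdot> \<Lambda>\<langle>T\<^sub>0 A\<rangle> \<rhd> (fcmp T (\<Lambda>\<langle>A\<rangle>) (T\<^sub>1 (\<eta>\<langle>A\<rangle>)) \<Zsemi> T\<^sub>2 (\<omega>\<^sub>2 A)))
    \<Zsemi> (P\<^sub>1 (m\<langle>A\<rangle>) \<rhd> \<omega>\<^sub>2 (T\<^sub>0 A))
    \<Zsemi> \<eta>\<llangle>m\<langle>A\<rangle>\<rrangle>)"

definition W9 :: bool where
  "W9 \<longleftrightarrow> (\<forall>A \<in> Obj C.
    (\<omega>\<^sub>1 A \<lhd> \<mu>\<langle>A\<rangle>)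
    \<Zsemi> (\<Lambda>\<langle>A\<rangle> \<rhd> vinv (u\<llangle>\<mu>\<langle>A\<rangle>\<rrangle>))
    \<Zsemi> (\<omega>\<^sub>4 A \<lhd> u\<langle>P\<^sub>0 (P\<^sub>0 A)\<rangle>)
    =
    \<mu>\<llangle>u\<langle>A\<rangle>\<rrangle>
    \<Zsemi> (\<mu>\<langle>T\<^sub>0 A\<rangle> \<rhd> (P\<^sub>2 (\<omega>\<^sub>1 A) \<Zsemi> vinv (fcmp P (\<Lambda>\<langle>A\<rangle>) (u\<langle>P\<^sub>0 A\<rangle>))))
    \<Zsemi> (\<mu>\<langle>T\<^sub>0 A\<rangle> \<cdot> P\<^sub>1 (\<Lambda>\<langle>A\<rangle>) \<rhd> \<omega>\<^sub>1 (P\<^sub>0 A)))"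

definition W10 :: bool where
  "W10 \<longleftrightarrow> (\<forall>A \<in> Obj C.
    (\<omega>\<^sub>1 A \<lhd> \<eta>\<langle>A\<rangle>) \<Zsemi> (\<Lambda>\<langle>A\<rangle> \<rhd> vinv (u\<llangle>\<eta>\<langle>A\<rangle>\<rrangle>)) \<Zsemi> (\<omega>\<^sub>2 A \<lhd> u\<langle>A\<rangle>) = \<eta>\<llangle>u\<langle>A\<rangle>\<rrangle>)"

end

locale pseudodistributive_law =
  pseudodist_data C MT MP L + MT: pseudomonad C MT + MP: pseudomonad C MP
  for C :: "('o, 'a, 'c, 'z) two_cat_scheme" (structure) and MT MP L +
  assumes law_pseudonatural: "pseudonatural C (T \<bullet> P) (P \<bullet> T) \<Lambda>"
    and omega1_modification: "inv_modification C P (P \<bullet> T)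
      (pn_lwhisk C P (pf_id C) T u) (\<Lambda> \<odot> pn_rwhisk u P) \<omega>\<^sub>1"
    and omega2_modification: "inv_modification C T (P \<bullet> T)
      (\<Lambda> \<odot> pn_lwhisk C T (pf_id C) P \<eta>) (pn_rwhisk \<eta> T) \<omega>\<^sub>2"
    and omega3_modification: "inv_modification C (T \<bullet> T \<bullet> P) (P \<bullet> T)
      (pn_lwhisk C P (T \<bullet> T) T m \<odot> pn_rwhisk \<Lambda> T \<odot> pn_lwhisk C T (T \<bullet> P) (P \<bullet> T) \<Lambda>)
      (\<Lambda> \<odot> pn_rwhisk m P) \<omega>\<^sub>3"
    and omega4_modification: "inv_modification C (T \<bullet> P \<bullet> P) (P \<bullet> T)
      (\<Lambda> \<odot> pn_lwhisk C T (P \<bullet> P) P \<mu>)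
      (pn_rwhisk \<mu> T \<odot> pn_lwhisk C P (T \<bullet> P) (P \<bullet> T) \<Lambda> \<odot> pn_rwhisk \<Lambda> P) \<omega>\<^sub>4"
    and W1: W1 and W2: W2 and W3: W3 and W4: W4 and W5: W5

end

theory Submission
  imports Defs
begin

text \<open>
  The conditions follow the pattern of Kelly's redundancy of unit axioms in a monoidal category. Let \<open>e\<close> be
  the automorphism of \<open>\<lambda>\<close> in (W6). Restricting (W3) along a unit in the middle copy of \<open>T\<close> and using
  (W1) shows \<open>Pm \<cdot> \<lambda>T \<cdot> T e = 1\<close>. The assignment \<open>x \<mapsto> Pm \<cdot> \<lambda>T \<cdot> T x\<close> is faithful on 2-cells into \<open>PT\<close>, because
  precomposition with \<open>u\<close> turns it into whiskering by \<open>Pm \<cdot> \<lambda>T \<cdot> uPT \<cong> Pm \<cdot> PuT \<cong> 1\<close>; hence \<open>e = 1\<close>. Likewise (W4) and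
  (W2) give (W7). Restricting (W5) along \<open>T u P P\<close> and using (W1) gives (W9) inside \<open>Pm \<cdot> \<lambda>T \<cdot> T(-)\<close>; restricting
  it along \<open>T T P \<eta>\<close> and using (W7) gives (W8) inside \<open>\<mu>T \<cdot> P(-)\<close>, which is faithful for the dual reason;
  and (W8) restricted along \<open>T u\<close> gives (W10).
\<close>

section \<open>Strict 2-categories and diagrams\<close>

text \<open>Kelly's argument is short only while canonical isomorphisms are suppressed; here they
  are data: constraints of T and P, naturality squares, unit and associativity cells. No coherence
  theorem is invoked. Conjugating a functor with its constraints makes it act strictly on paths, and
  every other isomorphism becomes one explicit layer. A chain of 2-cells is then a list, interchange
  is a comparison of normal forms, and a proof step replaces a sublist. As all atoms are invertible,
  layers cancel at either end and can be carried across an equation.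

  The two unit conditions are not mirror images. In (W3) the composite of (W6) appears under T,
  where faithfulness removes the whiskering. In (W4) the composite of (W7) appears with no functor
  applied to it, so faithfulness gives nothing and naturality takes its place. For (W8),
  faithfulness of P needs an equation along \<eta>, while (W5) delivers one along \<lambda>T and
  T\<lambda>; \<open>omega2\<close> mediates between them.\<close>

text \<open>
  1-cells are represented by paths, i.e. lists of composable 1-cells in the order of composition
  (\<open>[g, f]\<close> stands for \<open>g \<cdot> f\<close>), so that composition becomes strictly associative and unital on the level
  of syntax. An atom is an invertible 2-cell between the composites of two paths. A diagram is a list of
  layers \<open>(n, a)\<close>, to be read downwards from a given path: the atom \<open>a\<close> is applied to the part of the
  path that starts after the first \<open>n\<close> entries.
\<close>

datatype ('o, 'a, 'c) atom =
  Atom (adom: 'o) (acod: 'o) (asrc: "'a list") (atgt: "'a list") (acell: 'c)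

type_synonym ('o, 'a, 'c) diagram = "(nat \<times> ('o, 'a, 'c) atom) list"

text \<open>Nothing checks that \<open>asrc a\<close> occurs at position \<open>n\<close>; that is
  left to \<open>fits\<close>. Thus \<open>step\<close> and \<open>run\<close> compute on any
  concrete list.\<close>

primrec step :: "'a list \<Rightarrow> nat \<times> ('o, 'a, 'c) atom \<Rightarrow> 'a list" where
  "step p (n, a) = take n p @ atgt a @ drop (n + length (asrc a)) p"

primrec run :: "'a list \<Rightarrow> ('o, 'a, 'c) diagram \<Rightarrow> 'a list" where
  "run p [] = p"
| "run p (d # ds) = run (step p d) ds"

text \<open>Whiskering on the left by \<open>k\<close> strands. Positions count from the left, so
  whiskering on the right changes no layer and needs no operation.\<close>

definition shift :: "nat \<Rightarrow> ('o, 'a, 'c) diagram \<Rightarrow> ('o, 'a, 'c) diagram" where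
  "shift k = map (\<lambda>(n, a). (k + n, a))"

lemma shift_simps [simp]:
  "shift k [] = []" "shift k ((n, a) # ds) = (k + n, a) # shift k ds"
  "shift k (xs @ ys) = shift k xs @ shift k ys" "length (shift k xs) = length xs"
  by (simp_all add: shift_def)

text \<open>
  \<open>nf\<close> postpones layers that act entirely to the right of a later one. It need not decide equality up
  to interchange; only its soundness matters.
\<close>

fun ins :: "nat \<times> ('o, 'a, 'c) atom \<Rightarrow> ('o, 'a, 'c) diagram \<Rightarrow> ('o, 'a, 'c) diagram" where
  "ins d [] = [d]"
| "ins (i, a) ((j, b) # ds) =
    (if j + length (asrc b) \<le> i
     then (j, b) # ins (i - length (asrc b) + length (atgt b), a) ds
     else (i, a) # (j, b) # ds)"

primrec nf :: "('o, 'a, 'c) diagram \<Rightarrow> ('o, 'a, 'c) diagram" where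
  "nf [] = []"
| "nf (d # ds) = ins d (nf ds)"

lemma run_append [simp]: "run p (xs @ ys) = run (run p xs) ys"
  by (induction xs arbitrary: p) auto

section \<open>Inverses, whiskering and interchange of 2-cells\<close>

context two_category
begin

lemma hom1_iff: "f \<in> hom1 C A B \<longleftrightarrow> f \<in> Arr C \<and> Dom C f = A \<and> Cod C f = B"
  by (auto simp: hom1_def)

lemma hom2D:
  assumes "\<alpha> \<in> hom2 C f g"
  shows "f \<in> Arr C" "g \<in> Arr C" "Dom C g = Dom C f" "Cod C g = Cod C f"
    "\<alpha> \<in> Cell C" "Src C \<alpha> = f" "Tgt C \<alpha> = g"
  using assms Src_in Tgt_in Dom_Src Cod_Src by (auto simp: hom2_def)

lemma iso2D: "\<alpha> \<in> iso2 C f g \<Longrightarrow> \<alpha> \<in> hom2 C f g"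
  by (simp add: iso2_def)

lemma vinv_unique:
  assumes "\<alpha> \<in> hom2 C f g" "\<beta> \<in> hom2 C g f" "\<alpha> \<Zsemi> \<beta> = Id2 C f" "\<beta> \<Zsemi> \<alpha> = Id2 C g"
  shows "vinv \<alpha> = \<beta>"
proof -
  have s: "Src C \<alpha> = f" "Tgt C \<alpha> = g"
    using assms(1) by (auto simp: hom2_def)
  show ?thesis
    unfolding vinverse_def s
  proof (rule the_equality)
    fix \<gamma> assume \<gamma>: "\<gamma> \<in> hom2 C g f \<and> \<alpha> \<Zsemi> \<gamma> = Id2 C f \<and> \<gamma> \<Zsemi> \<alpha> = Id2 C g"
    have "\<gamma> = \<gamma> \<Zsemi> (\<alpha> \<Zsemi> \<beta>)"
      using \<gamma> assms vcomp_Id2_right by auto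
    also have "\<dots> = (\<gamma> \<Zsemi> \<alpha>) \<Zsemi> \<beta>"
      using \<gamma> assms vcomp_assoc by metis
    also have "\<dots> = \<beta>"
      using \<gamma> assms vcomp_Id2_left by auto
    finally show "\<gamma> = \<beta>" .
  qed (use assms in auto)
qed

lemma iso2_vinv:
  assumes "\<alpha> \<in> iso2 C f g"
  shows "vinv \<alpha> \<in> iso2 C g f" "\<alpha> \<Zsemi> vinv \<alpha> = Id2 C f" "vinv \<alpha> \<Zsemi> \<alpha> = Id2 C g"
    "vinv (vinv \<alpha>) = \<alpha>"
proof -
  obtain \<beta> where \<beta>: "\<beta> \<in> hom2 C g f" "\<alpha> \<Zsemi> \<beta> = Id2 C f" "\<beta> \<Zsemi> \<alpha> = Id2 C g"
    using assms by (auto simp: iso2_def)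
  have e: "vinv \<alpha> = \<beta>"
    using vinv_unique[OF iso2D[OF assms] \<beta>] .
  show "vinv \<alpha> \<in> iso2 C g f" "\<alpha> \<Zsemi> vinv \<alpha> = Id2 C f" "vinv \<alpha> \<Zsemi> \<alpha> = Id2 C g"
    using \<beta> iso2D[OF assms] by (auto simp: e iso2_def)
  show "vinv (vinv \<alpha>) = \<alpha>"
    unfolding e using vinv_unique \<beta> iso2D[OF assms] by metis
qed

lemma iso2I:
  "\<lbrakk>\<alpha> \<in> hom2 C f g; \<beta> \<in> hom2 C g f; \<alpha> \<Zsemi> \<beta> = Id2 C f; \<beta> \<Zsemi> \<alpha> = Id2 C g\<rbrakk> \<Longrightarrow> \<alpha> \<in> iso2 C f g"
  by (auto simp: iso2_def)

lemma iso2_Id2: "f \<in> Arr C \<Longrightarrow> Id2 C f \<in> iso2 C f f"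
  by (rule iso2I[of _ _ _ "Id2 C f"]) (auto intro: Id2_in vcomp_Id2_left)

lemma vcomp_cancel_mid:
  assumes "\<alpha> \<in> hom2 C f g" "\<beta> \<in> iso2 C g h" "\<gamma> \<in> hom2 C g k"
  shows "(\<alpha> \<Zsemi> \<beta>) \<Zsemi> (vinv \<beta> \<Zsemi> \<gamma>) = \<alpha> \<Zsemi> \<gamma>"
proof -
  note b = iso2D[OF assms(2)] iso2D[OF iso2_vinv(1)[OF assms(2)]]
  have "(\<alpha> \<Zsemi> \<beta>) \<Zsemi> (vinv \<beta> \<Zsemi> \<gamma>) = \<alpha> \<Zsemi> (\<beta> \<Zsemi> (vinv \<beta> \<Zsemi> \<gamma>))"
    using vcomp_assoc[OF assms(1) b(1) vcomp_in[OF b(2) assms(3)]] .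
  also have "\<beta> \<Zsemi> (vinv \<beta> \<Zsemi> \<gamma>) = \<gamma>"
    using vcomp_assoc[OF b assms(3)] vcomp_Id2_left[OF assms(3)] iso2_vinv(2)[OF assms(2)] by simp
  finally show ?thesis .
qed

lemma iso2_vcomp:
  assumes a: "\<alpha> \<in> iso2 C f g" and b: "\<beta> \<in> iso2 C g h"
  shows "\<alpha> \<Zsemi> \<beta> \<in> iso2 C f h" "vinv (\<alpha> \<Zsemi> \<beta>) = vinv \<beta> \<Zsemi> vinv \<alpha>"
proof -
  note [simp] = iso2_vinv(2-4)[OF a] iso2_vinv(2-4)[OF b]
  note a' = iso2_vinv(1)[OF a] and b' = iso2_vinv(1)[OF b]
  have 1: "(\<alpha> \<Zsemi> \<beta>) \<Zsemi> (vinv \<beta> \<Zsemi> vinv \<alpha>) = Id2 C f"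
    using vcomp_cancel_mid[OF iso2D[OF a] b iso2D[OF a']] by simp
  have 2: "(vinv \<beta> \<Zsemi> vinv \<alpha>) \<Zsemi> (\<alpha> \<Zsemi> \<beta>) = Id2 C h"
    using vcomp_cancel_mid[OF iso2D[OF b'] a' iso2D[OF b]] by simp
  note t = vcomp_in[OF iso2D[OF a] iso2D[OF b]] vcomp_in[OF iso2D[OF b'] iso2D[OF a']]
  show "\<alpha> \<Zsemi> \<beta> \<in> iso2 C f h" "vinv (\<alpha> \<Zsemi> \<beta>) = vinv \<beta> \<Zsemi> vinv \<alpha>"
    using iso2I[OF t 1 2] vinv_unique[OF t 1 2] by auto
qed

lemma vcomp_cancel_left:
  assumes "\<alpha> \<in> iso2 C f g" "\<beta> \<in> hom2 C g h" "\<gamma> \<in> hom2 C g h" "\<alpha> \<Zsemi> \<beta> = \<alpha> \<Zsemi> \<gamma>"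
  shows "\<beta> = \<gamma>"
proof -
  note a = iso2D[OF iso2_vinv(1)[OF assms(1)]] iso2D[OF assms(1)]
  have "vinv \<alpha> \<Zsemi> (\<alpha> \<Zsemi> \<delta>) = \<delta>" if "\<delta> \<in> hom2 C g h" for \<delta>
    unfolding vcomp_assoc[OF a that, symmetric] iso2_vinv(3)[OF assms(1)]
    by (rule vcomp_Id2_left[OF that])
  from this[OF assms(2)] this[OF assms(3)] show ?thesis
    unfolding assms(4) by (rule trans[OF sym])
qed

lemma vcomp_cancel_right:
  assumes "\<alpha> \<in> iso2 C g h" "\<beta> \<in> hom2 C f g" "\<gamma> \<in> hom2 C f g" "\<beta> \<Zsemi> \<alpha> = \<gamma> \<Zsemi> \<alpha>"
  shows "\<beta> = \<gamma>"
proof -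
  note a = iso2D[OF assms(1)] iso2D[OF iso2_vinv(1)[OF assms(1)]]
  have "(\<delta> \<Zsemi> \<alpha>) \<Zsemi> vinv \<alpha> = \<delta>" if "\<delta> \<in> hom2 C f g" for \<delta>
    unfolding vcomp_assoc[OF that a] iso2_vinv(2)[OF assms(1)]
    by (rule vcomp_Id2_right[OF that])
  from this[OF assms(2)] this[OF assms(3)] show ?thesis
    unfolding assms(4) by (rule trans[OF sym])
qed

lemma lwhisk_in: "\<lbrakk>\<alpha> \<in> hom2 C f g; h \<in> Arr C; Cod C f = Dom C h\<rbrakk> \<Longrightarrow> h \<rhd> \<alpha> \<in> hom2 C (h \<cdot> f) (h \<cdot> g)"
  unfolding lwhisk_def by (rule hcomp_in) (auto intro: Id2_in)

lemma rwhisk_in: "\<lbrakk>\<alpha> \<in> hom2 C f g; h \<in> Arr C; Cod C h = Dom C f\<rbrakk> \<Longrightarrow> \<alpha> \<lhd> h \<in> hom2 C (f \<cdot> h) (g \<cdot> h)"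
  unfolding rwhisk_def by (rule hcomp_in) (auto intro: Id2_in)

lemma lwhisk_vcomp:
  "\<lbrakk>\<alpha> \<in> hom2 C f g; \<beta> \<in> hom2 C g h; k \<in> Arr C; Cod C f = Dom C k\<rbrakk>
    \<Longrightarrow> k \<rhd> (\<alpha> \<Zsemi> \<beta>) = (k \<rhd> \<alpha>) \<Zsemi> (k \<rhd> \<beta>)"
  unfolding lwhisk_def using interchange[of \<alpha> f g \<beta> h "Id2 C k" k k "Id2 C k" k] vcomp_Id2_left[OF Id2_in] by (simp add: Id2_in)

lemma rwhisk_vcomp:
  "\<lbrakk>\<alpha> \<in> hom2 C f g; \<beta> \<in> hom2 C g h; k \<in> Arr C; Cod C k = Dom C f\<rbrakk>
    \<Longrightarrow> (\<alpha> \<Zsemi> \<beta>) \<lhd> k = (\<alpha> \<lhd> k) \<Zsemi> (\<beta> \<lhd> k)"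
  unfolding rwhisk_def using interchange[of "Id2 C k" k k "Id2 C k" k \<alpha> f g \<beta> h]
    vcomp_Id2_left[OF Id2_in] by (simp add: Id2_in)

lemma comp1_Arr:
  "\<lbrakk>f \<in> Arr C; g \<in> Arr C; Cod C f = Dom C g\<rbrakk>
    \<Longrightarrow> g \<cdot> f \<in> Arr C \<and> Dom C (g \<cdot> f) = Dom C f \<and> Cod C (g \<cdot> f) = Cod C g"
  using comp1_in[of f "Dom C f" "Dom C g" g "Cod C g"] by (simp add: hom1_iff)

lemma lwhisk_Id2: "\<lbrakk>f \<in> Arr C; h \<in> Arr C; Cod C f = Dom C h\<rbrakk> \<Longrightarrow> h \<rhd> Id2 C f = Id2 C (h \<cdot> f)"
  unfolding lwhisk_def using hcomp_Id2[of f "Dom C f" "Dom C h" h "Cod C h"] by (simp add: hom1_iff)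

lemma rwhisk_Id2: "\<lbrakk>f \<in> Arr C; h \<in> Arr C; Cod C h = Dom C f\<rbrakk> \<Longrightarrow> Id2 C f \<lhd> h = Id2 C (f \<cdot> h)"
  unfolding rwhisk_def using hcomp_Id2[of h "Dom C h" "Dom C f" f "Cod C f"] by (simp add: hom1_iff)

lemma iso2_lwhisk:
  assumes "\<alpha> \<in> iso2 C f g" "h \<in> Arr C" "Cod C f = Dom C h"
  shows "h \<rhd> \<alpha> \<in> iso2 C (h \<cdot> f) (h \<cdot> g)" "vinv (h \<rhd> \<alpha>) = h \<rhd> vinv \<alpha>"
proof -
  note a = iso2D[OF assms(1)] and b = iso2D[OF iso2_vinv(1)[OF assms(1)]]
  have c: "Cod C g = Dom C h" using hom2D[OF a] assms by simp
  note t = lwhisk_in[OF a assms(2,3)] lwhisk_in[OF b assms(2) c]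
    lwhisk_vcomp[OF a b assms(2,3), symmetric, unfolded iso2_vinv(2)[OF assms(1)] lwhisk_Id2[OF hom2D(1)[OF a] assms(2,3)]]
    lwhisk_vcomp[OF b a assms(2) c, symmetric, unfolded iso2_vinv(3)[OF assms(1)] lwhisk_Id2[OF hom2D(2)[OF a] assms(2) c]]
  show "h \<rhd> \<alpha> \<in> iso2 C (h \<cdot> f) (h \<cdot> g)" "vinv (h \<rhd> \<alpha>) = h \<rhd> vinv \<alpha>"
    using iso2I[OF t] vinv_unique[OF t] by auto
qed

lemma iso2_rwhisk:
  assumes "\<alpha> \<in> iso2 C f g" "h \<in> Arr C" "Cod C h = Dom C f"
  shows "\<alpha> \<lhd> h \<in> iso2 C (f \<cdot> h) (g \<cdot> h)" "vinv (\<alpha> \<lhd> h) = vinv \<alpha> \<lhd> h"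
proof -
  note a = iso2D[OF assms(1)] and b = iso2D[OF iso2_vinv(1)[OF assms(1)]]
  have c: "Cod C h = Dom C g" using hom2D[OF a] assms by simp
  note t = rwhisk_in[OF a assms(2,3)] rwhisk_in[OF b assms(2) c]
    rwhisk_vcomp[OF a b assms(2,3), symmetric, unfolded iso2_vinv(2)[OF assms(1)] rwhisk_Id2[OF hom2D(1)[OF a] assms(2,3)]]
    rwhisk_vcomp[OF b a assms(2) c, symmetric, unfolded iso2_vinv(3)[OF assms(1)] rwhisk_Id2[OF hom2D(2)[OF a] assms(2) c]]
  show "\<alpha> \<lhd> h \<in> iso2 C (f \<cdot> h) (g \<cdot> h)" "vinv (\<alpha> \<lhd> h) = vinv \<alpha> \<lhd> h"
    using iso2I[OF t] vinv_unique[OF t] by auto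
qed

lemma lwhisk_lwhisk:
  assumes "\<alpha> \<in> hom2 C f g" "h \<in> Arr C" "k \<in> Arr C" "Cod C f = Dom C h" "Cod C h = Dom C k"
  shows "k \<rhd> (h \<rhd> \<alpha>) = (k \<cdot> h) \<rhd> \<alpha>"
  unfolding lwhisk_def
  using hcomp_assoc[OF assms(1) Id2_in[OF assms(2)] Id2_in[OF assms(3)] assms(4,5)]
    hcomp_Id2[of h "Dom C h" "Dom C k" k "Cod C k"] assms by (simp add: hom1_iff)

lemma rwhisk_rwhisk:
  assumes "\<alpha> \<in> hom2 C f g" "h \<in> Arr C" "k \<in> Arr C" "Cod C h = Dom C f" "Cod C k = Dom C h"
  shows "(\<alpha> \<lhd> h) \<lhd> k = \<alpha> \<lhd> (h \<cdot> k)"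
  unfolding rwhisk_def
  using hcomp_assoc[OF Id2_in[OF assms(3)] Id2_in[OF assms(2)] assms(1) assms(5,4)]
    hcomp_Id2[of k "Dom C k" "Dom C h" h "Cod C h"] assms by (simp add: hom1_iff)

lemma lwhisk_rwhisk:
  assumes "\<alpha> \<in> hom2 C f g" "h \<in> Arr C" "k \<in> Arr C" "Cod C f = Dom C h" "Cod C k = Dom C f"
  shows "(h \<rhd> \<alpha>) \<lhd> k = h \<rhd> (\<alpha> \<lhd> k)"
  unfolding lwhisk_def rwhisk_def
  using hcomp_assoc[OF Id2_in[OF assms(3)] assms(1) Id2_in[OF assms(2)]] assms by simp

text \<open>Both composites are the horizontal composite, with identities inserted on opposite
  sides. The first equation is what allows two layers of a diagram to change places.\<close>

lemma whisk_interchange: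
  assumes "\<alpha> \<in> hom2 C f f'" "\<beta> \<in> hom2 C g g'" "Cod C f = Dom C g"
  shows "(g \<rhd> \<alpha>) \<Zsemi> (\<beta> \<lhd> f') = (\<beta> \<lhd> f) \<Zsemi> (g' \<rhd> \<alpha>)"
    and "(g \<rhd> \<alpha>) \<Zsemi> (\<beta> \<lhd> f') = \<beta> \<star> \<alpha>"
proof -
  note t = hom2D[OF assms(1)] hom2D[OF assms(2)]
  have "\<beta> \<star> \<alpha> = (Id2 C g \<Zsemi> \<beta>) \<star> (\<alpha> \<Zsemi> Id2 C f')"
    by (simp add: vcomp_Id2_left[OF assms(2)] vcomp_Id2_right[OF assms(1)])
  also have "\<dots> = (g \<rhd> \<alpha>) \<Zsemi> (\<beta> \<lhd> f')"
    unfolding lwhisk_def rwhisk_def using interchange[OF assms(1) Id2_in Id2_in assms(2) assms(3)] t by simp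
  finally show 1: "(g \<rhd> \<alpha>) \<Zsemi> (\<beta> \<lhd> f') = \<beta> \<star> \<alpha>" by simp
  have "\<beta> \<star> \<alpha> = (\<beta> \<Zsemi> Id2 C g') \<star> (Id2 C f \<Zsemi> \<alpha>)"
    by (simp add: vcomp_Id2_right[OF assms(2)] vcomp_Id2_left[OF assms(1)])
  also have "\<dots> = (\<beta> \<lhd> f) \<Zsemi> (g' \<rhd> \<alpha>)"
    unfolding lwhisk_def rwhisk_def using interchange[OF Id2_in assms(1) assms(2) Id2_in assms(3)] t by simp
  finally show "(g \<rhd> \<alpha>) \<Zsemi> (\<beta> \<lhd> f') = (\<beta> \<lhd> f) \<Zsemi> (g' \<rhd> \<alpha>)"
    using 1 by simp
qed

lemma lwhisk_Id1: "\<lbrakk>\<alpha> \<in> hom2 C f g; Cod C f = B\<rbrakk> \<Longrightarrow> Id1 C B \<rhd> \<alpha> = \<alpha>"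
  unfolding lwhisk_def by (rule hcomp_Id_left)

lemma rwhisk_Id1: "\<lbrakk>\<alpha> \<in> hom2 C f g; Dom C f = A\<rbrakk> \<Longrightarrow> \<alpha> \<lhd> Id1 C A = \<alpha>"
  unfolding rwhisk_def by (rule hcomp_Id_right)

end

section \<open>Equality of diagrams\<close>

context two_category
begin

text \<open>An empty list does not know its endpoints, so the domain \<open>A\<close> and the
  codomain \<open>B\<close> are arguments. The recursion starts at the codomain, in the order of
  composition.\<close>

primrec path :: "'o \<Rightarrow> 'o \<Rightarrow> 'a list \<Rightarrow> bool" where
  "path A B [] \<longleftrightarrow> A \<in> Obj C \<and> B = A"
| "path A B (f # p) \<longleftrightarrow> f \<in> Arr C \<and> Cod C f = B \<and> path A (Dom C f) p"

primrec pcomp :: "'o \<Rightarrow> 'a list \<Rightarrow> 'a" where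
  "pcomp A [] = Id1 C A"
| "pcomp A (f # p) = f \<cdot> pcomp A p"

definition atom_ok :: "('o, 'a, 'c) atom \<Rightarrow> bool" where
  "atom_ok a \<longleftrightarrow> path (adom a) (acod a) (asrc a) \<and> path (adom a) (acod a) (atgt a) \<and>
    acell a \<in> iso2 C (pcomp (adom a) (asrc a)) (pcomp (adom a) (atgt a))"

definition ainv :: "('o, 'a, 'c) atom \<Rightarrow> ('o, 'a, 'c) atom" where
  "ainv a = Atom (adom a) (acod a) (atgt a) (asrc a) (vinv (acell a))"

definition layer :: "'o \<Rightarrow> 'a list \<Rightarrow> ('o, 'a, 'c) atom \<Rightarrow> 'a list \<Rightarrow> 'c" where
  "layer A l a r = pcomp (acod a) l \<rhd> acell a \<lhd> pcomp A r"

primrec fits :: "'o \<Rightarrow> 'o \<Rightarrow> 'a list \<Rightarrow> nat \<times> ('o, 'a, 'c) atom \<Rightarrow> bool" where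
  "fits A B p (n, a) \<longleftrightarrow> atom_ok a \<and> n \<le> length p \<and> take (length (asrc a)) (drop n p) = asrc a \<and>
    path (acod a) B (take n p) \<and> path A (adom a) (drop (n + length (asrc a)) p)"

primrec lay :: "'o \<Rightarrow> 'a list \<Rightarrow> nat \<times> ('o, 'a, 'c) atom \<Rightarrow> 'c" where
  "lay A p (n, a) = layer A (take n p) a (drop (n + length (asrc a)) p)"

primrec wt :: "'o \<Rightarrow> 'o \<Rightarrow> 'a list \<Rightarrow> ('o, 'a, 'c) diagram \<Rightarrow> bool" where
  "wt A B p [] \<longleftrightarrow> path A B p"
| "wt A B p (d # ds) \<longleftrightarrow> fits A B p d \<and> wt A B (step p d) ds"

primrec deval :: "'o \<Rightarrow> 'a list \<Rightarrow> ('o, 'a, 'c) diagram \<Rightarrow> 'c" where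
  "deval A p [] = Id2 C (pcomp A p)"
| "deval A p (d # ds) = lay A p d \<Zsemi> deval A (step p d) ds"

text \<open>The end paths are compared as lists: different paths may have the same composite, and
  later layers are located by position in the list.\<close>

definition deq :: "'o \<Rightarrow> 'o \<Rightarrow> 'a list \<Rightarrow> ('o, 'a, 'c) diagram \<Rightarrow> ('o, 'a, 'c) diagram \<Rightarrow> bool" where
  "deq A B p xs ys \<longleftrightarrow> wt A B p xs \<and> wt A B p ys \<and> run p xs = run p ys \<and> deval A p xs = deval A p ys"

text \<open>Positions survive the reversal, because a layer leaves the first \<open>n\<close>
  entries alone.\<close>

definition dinv :: "('o, 'a, 'c) diagram \<Rightarrow> ('o, 'a, 'c) diagram" where
  "dinv xs = rev (map (apsnd ainv) xs)"

declare step.simps [simp del] fits.simps [simp del] lay.simps [simp del]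

lemma path_append: "path A B (p @ q) \<longleftrightarrow> (\<exists>X. path X B p \<and> path A X q)"
proof (induction p arbitrary: B)
  case Nil
  have "B \<in> Obj C" if "path A B q" using that Cod_in by (cases q) auto
  then show ?case by auto
qed auto

lemma path_Obj: "path A B p \<Longrightarrow> A \<in> Obj C \<and> B \<in> Obj C"
  by (induction p arbitrary: B) (auto intro: Cod_in)

lemma path_unique: "\<lbrakk>path A B p; path A' B' p; p \<noteq> []\<rbrakk> \<Longrightarrow> A' = A \<and> B' = B"
proof (induction p arbitrary: B B')
  case (Cons f p) then show ?case by (cases p) auto
qed auto

lemma path_unique_dom: "\<lbrakk>path A B p; path A' B p\<rbrakk> \<Longrightarrow> A' = A"
  by (cases "p = []") (auto dest: path_unique)

lemma pcomp_in: "path A B p \<Longrightarrow> pcomp A p \<in> hom1 C A B"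
proof (induction p arbitrary: B)
  case Nil then show ?case using Id1_in by auto
next
  case (Cons f p)
  then show ?case using comp1_in[of "pcomp A p" A "Dom C f" f B] by (auto simp: hom1_iff)
qed

lemmas pcomp_Arr = pcomp_in[unfolded hom1_iff, THEN conjunct1]
lemmas pcomp_Dom = pcomp_in[unfolded hom1_iff, THEN conjunct2, THEN conjunct1]
lemmas pcomp_Cod = pcomp_in[unfolded hom1_iff, THEN conjunct2, THEN conjunct2]

lemma pcomp_append: "\<lbrakk>path X B p; path A X q\<rbrakk> \<Longrightarrow> pcomp A (p @ q) = pcomp X p \<cdot> pcomp A q"
proof (induction p arbitrary: B)
  case Nil
  then show ?case using comp1_Id1_left[OF pcomp_in] by auto
next
  case (Cons f p)
  then show ?case
    using comp1_assoc[OF pcomp_in[of A X q] pcomp_in[of X "Dom C f" p], of f B] by (auto simp: hom1_iff)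
qed

lemma ainv_simps [simp]:
  "adom (ainv a) = adom a" "acod (ainv a) = acod a" "asrc (ainv a) = atgt a" "atgt (ainv a) = asrc a"
  "acell (ainv a) = vinv (acell a)"
  by (simp_all add: ainv_def)

lemma ainv_ok [simp]: "atom_ok a \<Longrightarrow> atom_ok (ainv a)"
  by (simp add: atom_ok_def iso2_vinv)

lemma ainv_ainv [simp]: "atom_ok a \<Longrightarrow> ainv (ainv a) = a"
  by (cases a) (auto simp: atom_ok_def ainv_def iso2_vinv)

lemma atom_ok_hom2: "atom_ok a \<Longrightarrow> acell a \<in> iso2 C (pcomp (adom a) (asrc a)) (pcomp (adom a) (atgt a))"
  by (simp add: atom_ok_def)

lemma layer_in:
  assumes "atom_ok a" "path (acod a) B l" "path A (adom a) r"
  shows "layer A l a r \<in> iso2 C (pcomp A (l @ asrc a @ r)) (pcomp A (l @ atgt a @ r))"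
    and "vinv (layer A l a r) = layer A l (ainv a) r"
proof -
  note a = assms(1)[unfolded atom_ok_def]
  have s: "path (adom a) (acod a) (asrc a)" and t: "path (adom a) (acod a) (atgt a)" using a by auto
  note i = iso2_lwhisk[OF atom_ok_hom2[OF assms(1)] pcomp_Arr[OF assms(2)]]
  have c: "Cod C (pcomp (adom a) (asrc a)) = Dom C (pcomp (acod a) l)"
    using pcomp_Cod[OF s] pcomp_Dom[OF assms(2)] by simp
  have e: "pcomp (acod a) l \<cdot> pcomp (adom a) (asrc a) = pcomp (adom a) (l @ asrc a)"
    "pcomp (acod a) l \<cdot> pcomp (adom a) (atgt a) = pcomp (adom a) (l @ atgt a)"
    using pcomp_append[OF assms(2)] s t by auto
  have p: "path (adom a) B (l @ asrc a)" "path (adom a) B (l @ atgt a)"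
    using assms(2) s t by (auto simp: path_append)
  note j = iso2_rwhisk[OF i(1)[OF c, unfolded e] pcomp_Arr[OF assms(3)]]
  have d: "Cod C (pcomp A r) = Dom C (pcomp (adom a) (l @ asrc a))"
    using pcomp_Cod[OF assms(3)] pcomp_Dom[OF p(1)] by simp
  have f: "pcomp (adom a) (l @ asrc a) \<cdot> pcomp A r = pcomp A (l @ asrc a @ r)"
    "pcomp (adom a) (l @ atgt a) \<cdot> pcomp A r = pcomp A (l @ atgt a @ r)"
    using pcomp_append[OF p(1) assms(3)] pcomp_append[OF p(2) assms(3)] by auto
  show "layer A l a r \<in> iso2 C (pcomp A (l @ asrc a @ r)) (pcomp A (l @ atgt a @ r))"
    using j(1)[OF d, unfolded f] by (simp add: layer_def)
  show "vinv (layer A l a r) = layer A l (ainv a) r"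
    using j(2)[OF d] i(2)[OF c] by (simp add: layer_def)
qed

text \<open>The form with explicit contexts is the one for general reasoning; the definition by
  \<open>take\<close> and \<open>drop\<close> is the one that computes on concrete diagrams.\<close>

lemma fits_iff:
  "fits A B p (n, a) \<longleftrightarrow> (\<exists>l r. p = l @ asrc a @ r \<and> n = length l \<and> atom_ok a \<and>
    path (acod a) B l \<and> path A (adom a) r)"
proof
  assume f: "fits A B p (n, a)"
  have "p = take n p @ take (length (asrc a)) (drop n p) @ drop (n + length (asrc a)) p"
    by (metis append_take_drop_id drop_drop add.commute)
  then show "\<exists>l r. p = l @ asrc a @ r \<and> n = length l \<and> atom_ok a \<and> path (acod a) B l \<and> path A (adom a) r"
    using f by (intro exI[of _ "take n p"] exI[of _ "drop (n + length (asrc a)) p"]) (auto simp: fits.simps)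
qed (auto simp: fits.simps)

lemma fits_path:
  assumes "fits A B p d"
  shows "path A B p" "path A B (step p d)"
proof -
  obtain n a where d: "d = (n, a)" by (cases d)
  obtain l r where "p = l @ asrc a @ r" "n = length l" "atom_ok a" "path (acod a) B l" "path A (adom a) r"
    using assms unfolding d fits_iff by blast
  then show "path A B p" "path A B (step p d)"
    unfolding d by (auto simp: path_append atom_ok_def step.simps)
qed

lemma lay_in:
  assumes "fits A B p d"
  shows "lay A p d \<in> iso2 C (pcomp A p) (pcomp A (step p d))"
proof -
  obtain n a where d: "d = (n, a)" by (cases d)
  obtain l r where "p = l @ asrc a @ r" "n = length l" "atom_ok a" "path (acod a) B l" "path A (adom a) r"
    using assms unfolding d fits_iff by blast
  then show ?thesis
    unfolding d using layer_in(1)[of a B l A r] by (simp add: step.simps lay.simps)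
qed

lemma wt_path: "wt A B p xs \<Longrightarrow> path A B p \<and> path A B (run p xs)"
  by (induction xs arbitrary: p) (auto dest: fits_path)

lemma deval_in: "wt A B p xs \<Longrightarrow> deval A p xs \<in> iso2 C (pcomp A p) (pcomp A (run p xs))"
proof (induction xs arbitrary: p)
  case Nil then show ?case using iso2_Id2[OF pcomp_Arr] by auto
next
  case (Cons d xs) then show ?case using iso2_vcomp(1)[OF lay_in[of A B p d] Cons.IH] by auto
qed

lemma wt_append [simp]: "wt A B p (xs @ ys) \<longleftrightarrow> wt A B p xs \<and> wt A B (run p xs) ys"
  by (induction xs arbitrary: p) (auto dest: wt_path)

lemma deval_append:
  "\<lbrakk>wt A B p xs; wt A B (run p xs) ys\<rbrakk> \<Longrightarrow> deval A p (xs @ ys) = deval A p xs \<Zsemi> deval A (run p xs) ys"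
proof (induction xs arbitrary: p)
  case Nil then show ?case using vcomp_Id2_left[OF iso2D[OF deval_in]] by simp
next
  case (Cons d xs)
  then show ?case
    using vcomp_assoc[OF iso2D[OF lay_in[of A B p d]] iso2D[OF deval_in[of A B _ xs]]
        iso2D[OF deval_in[of A B _ ys]]] by simp
qed

section \<open>Cancellation, whiskering and interchange in equations of diagrams\<close>

lemma deq_refl: "wt A B p xs \<Longrightarrow> deq A B p xs xs"
  by (simp add: deq_def)

lemma deq_sym: "deq A B p xs ys \<Longrightarrow> deq A B p ys xs"
  by (simp add: deq_def)

lemma deq_trans [trans]: "\<lbrakk>deq A B p xs ys; deq A B p ys zs\<rbrakk> \<Longrightarrow> deq A B p xs zs"
  by (simp add: deq_def)

lemma deq_append:
  "\<lbrakk>deq A B p xs ys; deq A B (run p xs) us vs\<rbrakk> \<Longrightarrow> deq A B p (xs @ us) (ys @ vs)"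
  unfolding deq_def using deval_append[of A B p] by simp

text \<open>All atoms are invertible, hence so is the value of every diagram.\<close>

lemma deq_cancel_left:
  assumes "deq A B p (zs @ xs) (zs @ ys)"
  shows "deq A B (run p zs) xs ys"
proof -
  have w: "wt A B p zs" "wt A B (run p zs) xs" "wt A B (run p zs) ys" "run (run p zs) xs = run (run p zs) ys"
    using assms by (auto simp: deq_def)
  have "deval A p zs \<Zsemi> deval A (run p zs) xs = deval A p zs \<Zsemi> deval A (run p zs) ys"
    using assms w by (simp add: deq_def deval_append)
  then have "deval A (run p zs) xs = deval A (run p zs) ys"
    using vcomp_cancel_left[OF deval_in[OF w(1)] iso2D[OF deval_in[OF w(2)]]] deval_in[OF w(3)] w(4) iso2D by simp
  then show ?thesis using w by (simp add: deq_def)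
qed

lemma step_inv: "fits A B p (n, a) \<Longrightarrow> fits A B (step p (n, a)) (n, ainv a) \<and> step (step p (n, a)) (n, ainv a) = p
    \<and> lay A (step p (n, a)) (n, ainv a) = vinv (lay A p (n, a))"
proof -
  assume f: "fits A B p (n, a)"
  then obtain l r where "p = l @ asrc a @ r" "n = length l" "atom_ok a" "path (acod a) B l" "path A (adom a) r"
    unfolding fits_iff by blast
  then show ?thesis
    using layer_in(2)[of a B l A r] unfolding fits_iff by (auto simp: step.simps lay.simps)
qed

lemma deq_dinv_right: "wt A B p xs \<Longrightarrow> deq A B p (xs @ dinv xs) []"
proof (induction xs arbitrary: p)
  case Nil then show ?case by (simp add: dinv_def deq_def)
next
  case (Cons d xs)
  obtain n a where d: "d = (n, a)" by (cases d)
  have f: "fits A B p (n, a)" and w: "wt A B (step p (n, a)) xs" using Cons.prems by (auto simp: d)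
  note s = step_inv[OF f]
  have p: "path A B p" using fits_path[OF f] by blast
  have w1: "wt A B p [(n, a)]" using f fits_path[OF f] by simp
  have 0: "deq A B p ([(n, a)] @ [(n, ainv a)]) []"
    using f s p iso2_vinv(2)[OF lay_in[OF f]] vcomp_Id2_right[OF iso2D[OF iso2_vinv(1)[OF lay_in[OF f]]]]
    by (simp add: deq_def)
  have 1: "deq A B (run p [(n, a)]) (xs @ dinv xs) []" using Cons.IH[OF w] by simp
  have wi: "wt A B (run p [(n, a)]) [(n, ainv a)]" using s p by (simp)
  have "deq A B p ([(n, a)] @ (xs @ dinv xs)) ([(n, a)] @ [])"
    by (rule deq_append[OF deq_refl[OF w1] 1])
  then have "deq A B p (([(n, a)] @ (xs @ dinv xs)) @ [(n, ainv a)]) ([(n, a)] @ [(n, ainv a)])"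
    using deq_append[of A B p "[(n, a)] @ (xs @ dinv xs)" "[(n, a)]" "[(n, ainv a)]" "[(n, ainv a)]"]
      deq_refl[OF wi] by (simp add: deq_def)
  from deq_trans[OF this 0] show ?case by (simp add: d dinv_def)
qed

lemma wt_dinv:
  assumes "wt A B p xs"
  shows "wt A B (run p xs) (dinv xs)" "run (run p xs) (dinv xs) = p"
  using deq_dinv_right[OF assms] by (auto simp: deq_def)

lemma dinv_dinv: "wt A B p xs \<Longrightarrow> dinv (dinv xs) = xs"
  by (induction xs arbitrary: p) (auto simp: dinv_def fits.simps)

lemma deq_dinv_left: "wt A B p xs \<Longrightarrow> deq A B (run p xs) (dinv xs @ xs) []"
  using deq_dinv_right[OF wt_dinv(1)] dinv_dinv by metis

lemma deq_cancel_right: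
  assumes "deq A B p (xs @ zs) (ys @ zs)" "run p xs = run p ys"
  shows "deq A B p xs ys"
proof -
  have w: "wt A B p xs" "wt A B p ys" "wt A B (run p xs) zs" "run (run p xs) zs = run (run p ys) zs"
    using assms by (auto simp: deq_def)
  have "deq A B p ((xs @ zs) @ dinv zs) ((ys @ zs) @ dinv zs)"
    by (rule deq_append[OF assms(1)]) (use wt_dinv(1)[OF w(3)] in \<open>simp add: deq_refl\<close>)
  moreover have "deq A B p (xs @ (zs @ dinv zs)) (xs @ [])" "deq A B p (ys @ (zs @ dinv zs)) (ys @ [])"
    using w assms(2) by (auto intro!: deq_append deq_refl deq_dinv_right simp del: append_assoc append_Nil2)
  ultimately show ?thesis using deq_sym deq_trans by (metis append_assoc append_Nil2)
qed

lemma deq_move_right: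
  assumes "deq A B p (xs @ ys) zs"
  shows "deq A B p xs (zs @ dinv ys)"
proof -
  have w: "wt A B p xs" "wt A B (run p xs) ys" "run (run p xs) ys = run p zs"
    using assms by (auto simp: deq_def)
  have "deq A B p ((xs @ ys) @ dinv ys) (zs @ dinv ys)"
    by (rule deq_append[OF assms]) (use wt_dinv(1)[OF w(2)] in \<open>simp add: deq_refl\<close>)
  moreover have "deq A B p (xs @ (ys @ dinv ys)) (xs @ [])"
    by (rule deq_append[OF deq_refl[OF w(1)] deq_dinv_right[OF w(2)]])
  ultimately show ?thesis using deq_sym deq_trans by (metis append_assoc append_Nil2)
qed

lemma deq_move_left:
  assumes "deq A B p (xs @ ys) zs"
  shows "deq A B (run p xs) ys (dinv xs @ zs)"
proof -
  have w: "wt A B p xs" "wt A B (run p xs) ys" "wt A B p zs"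
    using assms by (auto simp: deq_def)
  have "deq A B (run p xs) (dinv xs @ (xs @ ys)) (dinv xs @ zs)"
    by (rule deq_append[OF deq_refl[OF wt_dinv(1)[OF w(1)]]]) (simp add: wt_dinv(2)[OF w(1)] assms)
  moreover have "deq A B (run p xs) ((dinv xs @ xs) @ ys) ([] @ ys)"
    by (rule deq_append[OF deq_dinv_left[OF w(1)]]) (use w wt_dinv in \<open>auto intro: deq_refl\<close>)
  ultimately show ?thesis using deq_sym deq_trans by (metis append_assoc append_Nil)
qed

text \<open>The value of the remaining layers depends on the path reached so far, so typing, end
  path and value go through one induction.\<close>

lemma shift_in:
  assumes "wt A' B' q xs" "path A A' r" "path B' B l"
  shows "wt A B (l @ q @ r) (shift (length l) xs)"
    and "run (l @ q @ r) (shift (length l) xs) = l @ run q xs @ r"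
    and "deval A (l @ q @ r) (shift (length l) xs) = pcomp B' l \<rhd> deval A' q xs \<lhd> pcomp A r"
proof -
  have "wt A B (l @ q @ r) (shift (length l) xs) \<and> run (l @ q @ r) (shift (length l) xs) = l @ run q xs @ r
    \<and> deval A (l @ q @ r) (shift (length l) xs) = pcomp B' l \<rhd> deval A' q xs \<lhd> pcomp A r"
    using assms(1)
  proof (induction xs arbitrary: q)
    case Nil
    then have q: "path A' B' q" by simp
    have lq: "path A' B (l @ q)" using assms(3) q by (auto simp: path_append)
    have "pcomp B' l \<rhd> Id2 C (pcomp A' q) = Id2 C (pcomp A' (l @ q))"
      using lwhisk_Id2[OF pcomp_Arr[OF q] pcomp_Arr[OF assms(3)]] pcomp_append[OF assms(3) q]
        pcomp_Cod[OF q] pcomp_Dom[OF assms(3)] by simp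
    moreover have "Id2 C (pcomp A' (l @ q)) \<lhd> pcomp A r = Id2 C (pcomp A ((l @ q) @ r))"
      using rwhisk_Id2[OF pcomp_Arr[OF lq] pcomp_Arr[OF assms(2)]] pcomp_append[OF lq assms(2)]
        pcomp_Dom[OF lq] pcomp_Cod[OF assms(2)] by simp
    ultimately show ?case
      using lq assms(2) by (auto simp: path_append)
  next
    case (Cons d xs)
    obtain n a where d: "d = (n, a)" by (cases d)
    have f: "fits A' B' q (n, a)" and w: "wt A' B' (step q (n, a)) xs"
      using Cons.prems d by auto
    obtain l' r' where *: "q = l' @ asrc a @ r'" "n = length l'" "atom_ok a" "path (acod a) B' l'" "path A' (adom a) r'"
      using f unfolding fits_iff by blast
    have pl: "path (acod a) B (l @ l')" and pr: "path A (adom a) (r' @ r)"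
      using *(4,5) assms(2,3) by (auto simp: path_append)
    have f': "fits A B (l @ q @ r) (length l + n, a)"
      unfolding fits_iff using * pl pr by (intro exI[of _ "l @ l'"] exI[of _ "r' @ r"]) auto
    have st: "step (l @ q @ r) (length l + n, a) = l @ step q (n, a) @ r"
      using * by (simp add: step.simps)
    note IH = Cons.IH[OF w]
    have s: "path (adom a) (acod a) (asrc a)" "path (adom a) (acod a) (atgt a)"
      using *(3) by (auto simp: atom_ok_def)
    \<comment> \<open>The contexts \<open>l'\<close>, \<open>r'\<close> inside \<open>q\<close> and
      the outer contexts \<open>l\<close>, \<open>r\<close> merge by associativity of
      whiskering.\<close>
    have la: "lay A (l @ q @ r) (length l + n, a) = pcomp B' l \<rhd> lay A' q (n, a) \<lhd> pcomp A r"
    proof -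
      let ?L = "pcomp B' l" and ?L' = "pcomp (acod a) l'" and ?R = "pcomp A r" and ?R' = "pcomp A' r'"
      note c = *(3)[THEN atom_ok_hom2, THEN iso2D]
      note arr = pcomp_Arr[OF assms(3)] pcomp_Arr[OF *(4)] pcomp_Arr[OF assms(2)] pcomp_Arr[OF *(5)]
      have e: "Cod C (pcomp (adom a) (asrc a)) = Dom C ?L'" "Cod C ?L' = Dom C ?L"
        "Cod C ?R' = Dom C (pcomp (adom a) (asrc a))" "Cod C ?R = Dom C ?R'"
        using pcomp_Dom[OF assms(3)] pcomp_Dom[OF *(4)] pcomp_Cod[OF *(4)] pcomp_Cod[OF *(5)] pcomp_Dom[OF *(5)]
          pcomp_Cod[OF s(1)] pcomp_Dom[OF s(1)] pcomp_Cod[OF assms(2)] by auto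
      note c1 = lwhisk_in[OF c arr(2) e(1)]
      have e5: "Cod C (?L' \<cdot> pcomp (adom a) (asrc a)) = Dom C ?L" "Cod C ?R' = Dom C (?L' \<cdot> pcomp (adom a) (asrc a))"
        using comp1_Arr[OF pcomp_Arr[OF s(1)] arr(2) e(1)] e by auto
      have ee: "Cod C (?L \<cdot> ?L') = Cod C ?L" "?L \<cdot> ?L' \<in> Arr C" "Dom C (?L \<cdot> ?L') = Dom C ?L'"
        using comp1_Arr[OF arr(2,1) e(2)] by auto
      have "?L \<rhd> lay A' q (n, a) \<lhd> ?R = ?L \<rhd> ((?L' \<rhd> acell a) \<lhd> ?R') \<lhd> ?R"
        using * by (simp add: layer_def lay.simps)
      also have "?L \<rhd> ((?L' \<rhd> acell a) \<lhd> ?R') = ((?L \<cdot> ?L') \<rhd> acell a) \<lhd> ?R'"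
        using lwhisk_rwhisk[OF c1 arr(1,4) e5] lwhisk_lwhisk[OF c arr(2,1) e(1,2)] by simp
      also have "(((?L \<cdot> ?L') \<rhd> acell a) \<lhd> ?R') \<lhd> ?R = ((?L \<cdot> ?L') \<rhd> acell a) \<lhd> (?R' \<cdot> ?R)"
        using rwhisk_rwhisk[OF lwhisk_in[OF c ee(2)] arr(4,3) _ e(4)] e(1,3) ee
          comp1_Arr[OF pcomp_Arr[OF s(1)] ee(2)] by auto
      also have "\<dots> = lay A (l @ q @ r) (length l + n, a)"
        using * pcomp_append[OF assms(3) *(4)] pcomp_append[OF *(5) assms(2)] by (simp add: layer_def lay.simps)
      finally show ?thesis by simp
    qed
    have lq: "lay A' q (n, a) \<in> hom2 C (pcomp A' q) (pcomp A' (step q (n, a)))"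
      using iso2D[OF lay_in[OF f]] .
    have dq: "deval A' (step q (n, a)) xs \<in> hom2 C (pcomp A' (step q (n, a))) (pcomp A' (run (step q (n, a)) xs))"
      using iso2D[OF deval_in[OF w]] .
    have p: "path A' B' q" "path A' B' (step q (n, a))" using fits_path[OF f] by auto
    have g1: "Cod C (pcomp A' q) = Dom C (pcomp B' l)" "Cod C (pcomp A' (step q (n, a))) = Dom C (pcomp B' l)"
      using pcomp_Cod[OF p(1)] pcomp_Cod[OF p(2)] pcomp_Dom[OF assms(3)] by auto
    have g2: "Cod C (pcomp A r) = Dom C (pcomp B' l \<cdot> pcomp A' q)"
      using comp1_Arr[OF pcomp_Arr[OF p(1)] pcomp_Arr[OF assms(3)] g1(1)] pcomp_Dom[OF p(1)] pcomp_Cod[OF assms(2)] by simp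
    have "pcomp B' l \<rhd> (lay A' q (n, a) \<Zsemi> deval A' (step q (n, a)) xs) \<lhd> pcomp A r
       = (pcomp B' l \<rhd> lay A' q (n, a) \<lhd> pcomp A r) \<Zsemi> (pcomp B' l \<rhd> deval A' (step q (n, a)) xs \<lhd> pcomp A r)"
      unfolding lwhisk_vcomp[OF lq dq pcomp_Arr[OF assms(3)] g1(1)]
      by (rule rwhisk_vcomp[OF lwhisk_in[OF lq pcomp_Arr[OF assms(3)] g1(1)]
          lwhisk_in[OF dq pcomp_Arr[OF assms(3)] g1(2)] pcomp_Arr[OF assms(2)] g2])
    then show ?case
      using IH f' la unfolding d by (simp add: st)
  qed
  then show "wt A B (l @ q @ r) (shift (length l) xs)"
    "run (l @ q @ r) (shift (length l) xs) = l @ run q xs @ r"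
    "deval A (l @ q @ r) (shift (length l) xs) = pcomp B' l \<rhd> deval A' q xs \<lhd> pcomp A r"
    by auto
qed

lemma deq_whisk:
  assumes "deq A' B' q xs ys" "path A A' r" "path B' B l"
  shows "deq A B (l @ q @ r) (shift (length l) xs) (shift (length l) ys)"
  using assms shift_in[OF _ assms(2,3)] by (auto simp: deq_def)

text \<open>Since \<open>b\<close> ends before position \<open>i\<close>, the two atoms act on
  disjoint stretches of the path, and the swap is the interchange law. Applying \<open>b\<close>
  first changes the number of strands on the left of \<open>a\<close>, whence
  \<open>i'\<close>.\<close>

lemma lay_swap:
  assumes f: "fits A B p (i, a)" and g: "fits A B (step p (i, a)) (j, b)" and le: "j + length (asrc b) \<le> i"
  defines "i' \<equiv> i - length (asrc b) + length (atgt b)"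
  shows "fits A B p (j, b)" "fits A B (step p (j, b)) (i', a)"
    "step (step p (j, b)) (i', a) = step (step p (i, a)) (j, b)"
    "lay A p (j, b) \<Zsemi> lay A (step p (j, b)) (i', a) = lay A p (i, a) \<Zsemi> lay A (step p (i, a)) (j, b)"
proof -
  obtain l r where 1: "p = l @ asrc a @ r" "i = length l" "atom_ok a" "path (acod a) B l" "path A (adom a) r"
    using f unfolding fits_iff by blast
  obtain l' r' where 2: "step p (i, a) = l' @ asrc b @ r'" "j = length l'" "atom_ok b" "path (acod b) B l'"
    using g unfolding fits_iff by blast
  have "take (length l) (l @ atgt a @ r) = take (length l) (l' @ asrc b @ r')"
    using 1 2 by (simp add: step.simps)
  \<comment> \<open>\<open>m\<close> is the stretch of strands between the two atoms.\<close>
  then obtain m where l: "l = l' @ asrc b @ m"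
    using le 1(2) 2(2) by (simp add: le_diff_conv2)
  have s: "path (adom a) (acod a) (asrc a)" "path (adom a) (acod a) (atgt a)"
      "path (adom b) (acod b) (asrc b)" "path (adom b) (acod b) (atgt b)"
    using 1(3) 2(3) by (auto simp: atom_ok_def)
  obtain X where X: "path X B (l' @ asrc b)" "path (acod a) X m"
    using 1(4) unfolding l append_assoc[symmetric] path_append[of _ _ "l' @ asrc b" m] by blast
  \<comment> \<open>\<open>X\<close> is only known to be some intermediate object; it is
    \<open>adom b\<close>, because a path together with its codomain determines its domain.\<close>
  have m: "path (acod a) (adom b) m"
  proof -
    have "path (adom b) B (l' @ asrc b)" using 2(4) s(3) by (auto simp: path_append)
    then show ?thesis using X path_unique_dom by blast
  qed
  have i': "i' = length (l' @ atgt b @ m)" by (simp add: i'_def 1(2) l)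
  have pl: "path (acod a) B (l' @ atgt b @ m)" and pr: "path A (adom b) (m @ asrc a @ r)"
    "path A (adom b) (m @ atgt a @ r)"
    using m s 2(4) 1(5) by (auto simp: path_append)
  show f': "fits A B p (j, b)"
    unfolding fits_iff using 1 2 l pr by (intro exI[of _ l'] exI[of _ "m @ asrc a @ r"]) auto
  have st: "step p (j, b) = l' @ atgt b @ m @ asrc a @ r" "step p (i, a) = l' @ asrc b @ m @ atgt a @ r"
    using 1 2 l by (auto simp: step.simps)
  show g': "fits A B (step p (j, b)) (i', a)"
    unfolding fits_iff st using 1 i' pl by (intro exI[of _ "l' @ atgt b @ m"] exI[of _ r]) auto
  show "step (step p (j, b)) (i', a) = step (step p (i, a)) (j, b)"
    unfolding st i' using 1 2 by (simp add: l step.simps)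
  \<comment> \<open>With the outer contexts \<open>l'\<close> and \<open>r\<close> stripped off,
    this is interchange of the cell of \<open>b\<close> with the cell of \<open>a\<close> whiskered
    by \<open>m\<close>.\<close>
  have core: "layer (adom a) (asrc b @ m) a [] \<Zsemi> layer (adom a) [] b (m @ atgt a)
      = layer (adom a) [] b (m @ asrc a) \<Zsemi> layer (adom a) (atgt b @ m) a []"
  proof -
    let ?m = "pcomp (acod a) m"
    have ma: "path (adom a) (adom b) (m @ asrc a)" "path (adom a) (adom b) (m @ atgt a)"
      using m s by (auto simp: path_append)
    have ob: "adom a \<in> Obj C" using path_Obj[OF s(1)] by simp
    have A1: "?m \<rhd> acell a \<in> hom2 C (pcomp (adom a) (m @ asrc a)) (pcomp (adom a) (m @ atgt a))"
      using lwhisk_in[OF iso2D[OF atom_ok_hom2[OF 1(3)]] pcomp_Arr[OF m]]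
        pcomp_append[OF m s(1)] pcomp_append[OF m s(2)] pcomp_Cod[OF s(1)] pcomp_Dom[OF m] by simp
    note B1 = iso2D[OF atom_ok_hom2[OF 2(3)]]
    have la: "layer (adom a) (c @ m) a [] = pcomp (adom b) c \<rhd> (?m \<rhd> acell a)"
      if c: "path (adom b) (acod b) c" for c
    proof -
      have "pcomp (acod a) (c @ m) \<rhd> acell a = pcomp (adom b) c \<rhd> (?m \<rhd> acell a)"
        using lwhisk_lwhisk[OF iso2D[OF atom_ok_hom2[OF 1(3)]] pcomp_Arr[OF m] pcomp_Arr[OF c]]
          pcomp_append[OF c m] pcomp_Cod[OF s(1)] pcomp_Dom[OF m] pcomp_Cod[OF m] pcomp_Dom[OF c] by simp
      moreover have "pcomp (adom b) c \<rhd> (?m \<rhd> acell a) \<in> hom2 C (pcomp (adom b) c \<cdot> pcomp (adom a) (m @ asrc a))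
          (pcomp (adom b) c \<cdot> pcomp (adom a) (m @ atgt a))"
        using lwhisk_in[OF A1 pcomp_Arr[OF c]] pcomp_Cod[OF ma(1)] pcomp_Dom[OF c] by simp
      moreover have "Dom C (pcomp (adom b) c \<cdot> pcomp (adom a) (m @ asrc a)) = adom a"
        using comp1_Arr[OF pcomp_Arr[OF ma(1)] pcomp_Arr[OF c]] pcomp_Dom[OF ma(1)] pcomp_Cod[OF ma(1)] pcomp_Dom[OF c] by simp
      ultimately show ?thesis by (simp add: layer_def rwhisk_Id1)
    qed
    have lb: "layer (adom a) [] b r = acell b \<lhd> pcomp (adom a) r" for r
      using lwhisk_Id1[OF B1 pcomp_Cod[OF s(3)]] by (simp add: layer_def)
    show ?thesis
      unfolding la[OF s(3)] la[OF s(4)] lb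
      using whisk_interchange(1)[OF A1 B1] pcomp_Cod[OF ma(1)] pcomp_Dom[OF s(3)] by simp
  qed
  let ?q = "asrc b @ m @ asrc a"
  let ?xs = "[(length (asrc b @ m), a), (0, b)]" and ?ys = "[(0, b), (length (atgt b @ m), a)]"
  have mm: "path (acod a) (acod b) (asrc b @ m)" "path (acod a) (acod b) (atgt b @ m)"
    "path (adom a) (adom b) (m @ asrc a)" "path (adom a) (adom b) (m @ atgt a)"
    "path (adom a) (acod b) (atgt b @ m @ atgt a)"
    using m s by (auto simp: path_append)
  have bo: "acod b \<in> Obj C" "adom a \<in> Obj C" using path_Obj s by auto
  have "deq (adom a) (acod b) ?q ?xs ?ys"
  proof -
    have w: "wt (adom a) (acod b) ?q ?xs" "wt (adom a) (acod b) ?q ?ys"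
      using mm bo 1(3) 2(3) by (auto simp: fits.simps step.simps)
    have L1: "layer (adom a) (atgt b @ m) a [] \<in> hom2 C (pcomp (adom a) (atgt b @ m @ asrc a)) (pcomp (adom a) (atgt b @ m @ atgt a))"
      using iso2D[OF layer_in(1)[OF 1(3) mm(2), of "adom a" "[]"]] bo by simp
    have L2: "layer (adom a) [] b (m @ atgt a) \<in> hom2 C (pcomp (adom a) (asrc b @ m @ atgt a)) (pcomp (adom a) (atgt b @ m @ atgt a))"
      using iso2D[OF layer_in(1)[OF 2(3), of "acod b" "[]" "adom a" "m @ atgt a"]] bo mm by simp
    show ?thesis
      unfolding deq_def using w core by (simp add: step.simps lay.simps vcomp_Id2_right[OF L1] vcomp_Id2_right[OF L2])
  qed
  from deq_whisk[OF this 1(5) 2(4)]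
  have D: "deq A B p [(i, a), (j, b)] [(j, b), (i', a)]"
    using 1 2 l i' by simp
  have e: "deval A p [(i, a), (j, b)] = lay A p (i, a) \<Zsemi> lay A (step p (i, a)) (j, b)"
    using vcomp_Id2_right[OF iso2D[OF lay_in[OF g]]] by simp
  have e': "deval A p [(j, b), (i', a)] = lay A p (j, b) \<Zsemi> lay A (step p (j, b)) (i', a)"
    using vcomp_Id2_right[OF iso2D[OF lay_in[OF g']]] by simp
  show "lay A p (j, b) \<Zsemi> lay A (step p (j, b)) (i', a) = lay A p (i, a) \<Zsemi> lay A (step p (i, a)) (j, b)"
    using D[unfolded deq_def e e'] by simp
qed

lemma deq_swap:
  assumes "wt A B p ((i, a) # (j, b) # ds)" "j + length (asrc b) \<le> i"
  shows "deq A B p ((i, a) # (j, b) # ds) ((j, b) # (i - length (asrc b) + length (atgt b), a) # ds)"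
proof -
  have f: "fits A B p (i, a)" and g: "fits A B (step p (i, a)) (j, b)"
    and w: "wt A B (step (step p (i, a)) (j, b)) ds" using assms(1) by auto
  note s = lay_swap[OF f g assms(2)]
  have "deq A B p [(i, a), (j, b)] [(j, b), (i - length (asrc b) + length (atgt b), a)]"
    using s f g fits_path(2)[OF g] vcomp_Id2_right[OF iso2D[OF lay_in[OF g]]] vcomp_Id2_right[OF iso2D[OF lay_in[OF s(2)]]]
    by (simp add: deq_def)
  from deq_append[OF this, of ds ds] show ?thesis
    using deq_refl[OF w] by simp
qed

lemma deq_Cons: "\<lbrakk>fits A B p d; deq A B (step p d) xs ys\<rbrakk> \<Longrightarrow> deq A B p (d # xs) (d # ys)"
  by (simp add: deq_def)

lemma deq_ins: "wt A B p (d # ds) \<Longrightarrow> deq A B p (d # ds) (ins d ds)"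
proof (induction d ds arbitrary: p rule: ins.induct)
  case (1 d) then show ?case by (simp add: deq_refl)
next
  case (2 i a j b ds)
  show ?case
  proof (cases "j + length (asrc b) \<le> i")
    case True
    note s = deq_swap[OF "2.prems" True]
    then have "wt A B p ((j, b) # (i - length (asrc b) + length (atgt b), a) # ds)" by (simp add: deq_def)
    then have "deq A B p ((j, b) # (i - length (asrc b) + length (atgt b), a) # ds)
        ((j, b) # ins (i - length (asrc b) + length (atgt b), a) ds)"
      by (intro deq_Cons "2.IH"[OF True]) simp_all
    from deq_trans[OF s this] show ?thesis using True by simp
  next
    case False
    then have "ins (i, a) ((j, b) # ds) = (i, a) # (j, b) # ds" by simp
    then show ?thesis using "2.prems" by (simp only: deq_refl)
  qed
qed

lemma deq_nf: "wt A B p ds \<Longrightarrow> deq A B p ds (nf ds)"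
proof (induction ds arbitrary: p)
  case Nil then show ?case by (simp add: deq_refl)
next
  case (Cons d ds)
  then have "deq A B p (d # ds) (d # nf ds)"
    by (intro deq_Cons Cons.IH) simp_all
  moreover from this have "deq A B p (d # nf ds) (ins d (nf ds))"
    by (intro deq_ins) (simp add: deq_def)
  ultimately show ?case by (auto intro: deq_trans)
qed

text \<open>On concrete lists the last hypothesis is settled by evaluating \<open>nf\<close>, so
  that no interchange has to be written out in the derivations.\<close>

lemma deq_interchange:
  assumes "wt A B p xs" "wt A B p ys" "nf xs = nf ys"
  shows "deq A B p xs ys"
  using deq_nf[OF assms(1)] deq_nf[OF assms(2)] deq_sym deq_trans assms(3) by metis

end

section \<open>The action of pseudofunctors on diagrams\<close>

lemma pf_comp_simps [simp]:
  "on0 (G \<bullet>\<^bsub>C\<^esub> F) A = on0 G (on0 F A)" "on1 (G \<bullet>\<^bsub>C\<^esub> F) f = on1 G (on1 F f)"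
  "on2 (G \<bullet>\<^bsub>C\<^esub> F) \<alpha> = on2 G (on2 F \<alpha>)"
  by (simp_all add: pf_comp_def)

lemma pf_id_simps [simp]:
  "on0 (pf_id C) A = A" "on1 (pf_id C) f = f" "on2 (pf_id C) \<alpha> = \<alpha>"
  "fcmp (pf_id C) g f = Id2 C (g \<cdot>\<^bsub>C\<^esub> f)" "funt (pf_id C) A = Id2 C (Id1 C A)"
  "map (on1 (pf_id C)) p = p"
  by (simp_all add: pf_id_def)

context two_category
begin

lemma cellD:
  assumes "\<alpha> \<in> hom2 C f g"
  shows "\<alpha> \<in> Cell C" "Src C \<alpha> = f" "Tgt C \<alpha> = g"
  using hom2D[OF assms] by auto

lemma Cell_hom2: "\<alpha> \<in> Cell C \<Longrightarrow> \<alpha> \<in> hom2 C (Src C \<alpha>) (Tgt C \<alpha>)"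
  by (simp add: hom2_def)

lemma comp1_simps:
  assumes "f \<in> Arr C" "g \<in> Arr C" "Cod C f = Dom C g"
  shows "g \<cdot> f \<in> Arr C" "Dom C (g \<cdot> f) = Dom C f" "Cod C (g \<cdot> f) = Cod C g"
  using comp1_Arr[OF assms] by auto

lemma vcomp_simps:
  assumes "\<alpha> \<in> Cell C" "\<beta> \<in> Cell C" "Tgt C \<alpha> = Src C \<beta>"
  shows "\<alpha> \<Zsemi> \<beta> \<in> Cell C" "Src C (\<alpha> \<Zsemi> \<beta>) = Src C \<alpha>" "Tgt C (\<alpha> \<Zsemi> \<beta>) = Tgt C \<beta>"
  using vcomp_in[of \<alpha> "Src C \<alpha>" "Tgt C \<alpha>" \<beta> "Tgt C \<beta>"] assms by (auto simp: hom2_def)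

lemma lwhisk_simps:
  assumes "\<alpha> \<in> Cell C" "h \<in> Arr C" "Cod C (Src C \<alpha>) = Dom C h"
  shows "h \<rhd> \<alpha> \<in> Cell C" "Src C (h \<rhd> \<alpha>) = h \<cdot> Src C \<alpha>" "Tgt C (h \<rhd> \<alpha>) = h \<cdot> Tgt C \<alpha>"
  using lwhisk_in[OF Cell_hom2[OF assms(1)] assms(2,3)] by (auto simp: hom2_def)

lemma rwhisk_simps:
  assumes "\<alpha> \<in> Cell C" "h \<in> Arr C" "Cod C h = Dom C (Src C \<alpha>)"
  shows "\<alpha> \<lhd> h \<in> Cell C" "Src C (\<alpha> \<lhd> h) = Src C \<alpha> \<cdot> h" "Tgt C (\<alpha> \<lhd> h) = Tgt C \<alpha> \<cdot> h"
  using rwhisk_in[OF Cell_hom2[OF assms(1)] assms(2,3)] by (auto simp: hom2_def)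

lemma Id2_simps:
  "f \<in> Arr C \<Longrightarrow> Id2 C f \<in> Cell C" "f \<in> Arr C \<Longrightarrow> Src C (Id2 C f) = f" "f \<in> Arr C \<Longrightarrow> Tgt C (Id2 C f) = f"
  using Id2_in by (auto simp: hom2_def)

lemma vcomp_assoc_Cell:
  "\<lbrakk>\<alpha> \<in> Cell C; \<beta> \<in> Cell C; \<gamma> \<in> Cell C; Tgt C \<alpha> = Src C \<beta>; Tgt C \<beta> = Src C \<gamma>\<rbrakk>
    \<Longrightarrow> (\<alpha> \<Zsemi> \<beta>) \<Zsemi> \<gamma> = \<alpha> \<Zsemi> (\<beta> \<Zsemi> \<gamma>)"
  using vcomp_assoc[of \<alpha> _ _ \<beta> _ \<gamma>] by (auto simp: hom2_def)

lemma lwhisk_vcomp_Cell: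
  "\<lbrakk>\<alpha> \<in> Cell C; \<beta> \<in> Cell C; Tgt C \<alpha> = Src C \<beta>; k \<in> Arr C; Cod C (Src C \<alpha>) = Dom C k\<rbrakk>
    \<Longrightarrow> k \<rhd> (\<alpha> \<Zsemi> \<beta>) = (k \<rhd> \<alpha>) \<Zsemi> (k \<rhd> \<beta>)"
  using lwhisk_vcomp[of \<alpha> _ _ \<beta>] by (auto simp: hom2_def)

lemma rwhisk_vcomp_Cell:
  "\<lbrakk>\<alpha> \<in> Cell C; \<beta> \<in> Cell C; Tgt C \<alpha> = Src C \<beta>; k \<in> Arr C; Cod C k = Dom C (Src C \<alpha>)\<rbrakk>
    \<Longrightarrow> (\<alpha> \<Zsemi> \<beta>) \<lhd> k = (\<alpha> \<lhd> k) \<Zsemi> (\<beta> \<lhd> k)"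
  using rwhisk_vcomp[of \<alpha> _ _ \<beta>] by (auto simp: hom2_def)

lemma lwhisk_rwhisk_Cell:
  "\<lbrakk>\<alpha> \<in> Cell C; h \<in> Arr C; k \<in> Arr C; Cod C (Src C \<alpha>) = Dom C h; Cod C k = Dom C (Src C \<alpha>)\<rbrakk>
    \<Longrightarrow> (h \<rhd> \<alpha>) \<lhd> k = h \<rhd> (\<alpha> \<lhd> k)"
  using lwhisk_rwhisk by (auto simp: hom2_def)

lemmas cell_simps = comp1_simps vcomp_simps lwhisk_simps rwhisk_simps Id2_simps
  vcomp_assoc_Cell lwhisk_vcomp_Cell rwhisk_vcomp_Cell lwhisk_rwhisk_Cell

lemma vcomp_inv_right:
  "\<lbrakk>\<alpha> \<in> hom2 C f g; \<beta> \<in> iso2 C g h\<rbrakk> \<Longrightarrow> (\<alpha> \<Zsemi> \<beta>) \<Zsemi> vinv \<beta> = \<alpha>"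
  using vcomp_cancel_mid[of \<alpha> f g \<beta> h "Id2 C g" g] vcomp_Id2_right[OF iso2D[OF iso2_vinv(1)]]
    vcomp_Id2_right iso2D hom2D(2) Id2_in by metis

lemma vcomp_inv_left:
  "\<lbrakk>\<alpha> \<in> hom2 C f h; \<beta> \<in> iso2 C g h\<rbrakk> \<Longrightarrow> (\<alpha> \<Zsemi> vinv \<beta>) \<Zsemi> \<beta> = \<alpha>"
  using vcomp_inv_right[of \<alpha> f h "vinv \<beta>"] iso2_vinv(1,4)[of \<beta> g h] by simp

text \<open>The cell from the composite of the images to the image of the composite. It is bracketed
  to the right and starts from the unit constraint, because \<open>pcomp\<close> is bracketed in
  this way and ends in an identity.\<close>

primrec fpc :: "('o, 'a, 'c) pseudofun \<Rightarrow> 'o \<Rightarrow> 'a list \<Rightarrow> 'c" where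
  "fpc F A [] = funt F A"
| "fpc F A (f # p) = (on1 F f \<rhd> fpc F A p) \<Zsemi> fcmp F f (pcomp A p)"

text \<open>
  Conjugation with the constraints \<open>fpc\<close> makes a pseudofunctor act strictly on paths and diagrams.
\<close>

definition fatom :: "('o, 'a, 'c) pseudofun \<Rightarrow> ('o, 'a, 'c) atom \<Rightarrow> ('o, 'a, 'c) atom" where
  "fatom F a = Atom (on0 F (adom a)) (on0 F (acod a)) (map (on1 F) (asrc a)) (map (on1 F) (atgt a))
    (fpc F (adom a) (asrc a) \<Zsemi> on2 F (acell a) \<Zsemi> vinv (fpc F (adom a) (atgt a)))"

definition fdiag :: "('o, 'a, 'c) pseudofun \<Rightarrow> ('o, 'a, 'c) diagram \<Rightarrow> ('o, 'a, 'c) diagram" where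
  "fdiag F = map (apsnd (fatom F))"

lemma fatom_simps [simp]:
  "adom (fatom F a) = on0 F (adom a)" "acod (fatom F a) = on0 F (acod a)"
  "asrc (fatom F a) = map (on1 F) (asrc a)" "atgt (fatom F a) = map (on1 F) (atgt a)"
  by (simp_all add: fatom_def)

lemma fdiag_simps [simp]:
  "fdiag F [] = []" "fdiag F ((n, a) # xs) = (n, fatom F a) # fdiag F xs"
  "fdiag F (xs @ ys) = fdiag F xs @ fdiag F ys"
  by (simp_all add: fdiag_def)

definition natom :: "('o, 'a, 'c) pseudofun \<Rightarrow> ('o, 'a, 'c) pseudofun \<Rightarrow> ('o, 'a, 'c) pseudonat \<Rightarrow> 'a \<Rightarrow>
    ('o, 'a, 'c) atom" where
  "natom F G \<alpha> f = Atom (on0 F (Dom C f)) (on0 G (Cod C f)) [on1 G f, \<alpha>\<langle>Dom C f\<rangle>] [\<alpha>\<langle>Cod C f\<rangle>, on1 F f] (\<alpha>\<llangle>f\<rrangle>)"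

lemma natom_simps [simp]:
  "adom (natom F G \<alpha> f) = on0 F (Dom C f)" "acod (natom F G \<alpha> f) = on0 G (Cod C f)"
  "asrc (natom F G \<alpha> f) = [on1 G f, \<alpha>\<langle>Dom C f\<rangle>]" "atgt (natom F G \<alpha> f) = [\<alpha>\<langle>Cod C f\<rangle>, on1 F f]"
  "acell (natom F G \<alpha> f) = \<alpha>\<llangle>f\<rrangle>"
  by (simp_all add: natom_def)

text \<open>The pasting of naturality squares along a path: the component starts at the right end
  and passes the 1-cells one at a time, the innermost first.\<close>

primrec cross :: "('o, 'a, 'c) pseudofun \<Rightarrow> ('o, 'a, 'c) pseudofun \<Rightarrow> ('o, 'a, 'c) pseudonat \<Rightarrow> 'a list \<Rightarrow>
    ('o, 'a, 'c) diagram" where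
  "cross F G \<alpha> [] = []"
| "cross F G \<alpha> (f # p) = shift 1 (cross F G \<alpha> p) @ [(0, natom F G \<alpha> f)]"

lemma pcomp_single: "f \<in> Arr C \<Longrightarrow> Dom C f = A \<Longrightarrow> pcomp A [f] = f"
  using comp1_Id1_right[of f A "Cod C f"] by (simp add: hom1_iff)

lemma layer_left: "\<lbrakk>atom_ok a; path A (adom a) r\<rbrakk> \<Longrightarrow> layer A [] a r = acell a \<lhd> pcomp A r"
  using lwhisk_Id1[OF iso2D[OF atom_ok_hom2]] pcomp_Cod by (simp add: layer_def atom_ok_def)

lemma layer_right: "\<lbrakk>atom_ok a; path (acod a) B l\<rbrakk> \<Longrightarrow> layer (adom a) l a [] = pcomp (acod a) l \<rhd> acell a"
proof -
  assume a: "atom_ok a" and l: "path (acod a) B l"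
  have s: "path (adom a) (acod a) (asrc a)" using a by (simp add: atom_ok_def)
  have c: "Cod C (pcomp (adom a) (asrc a)) = Dom C (pcomp (acod a) l)"
    using pcomp_Cod[OF s] pcomp_Dom[OF l] by simp
  show ?thesis
    using rwhisk_Id1[OF lwhisk_in[OF iso2D[OF atom_ok_hom2[OF a]] pcomp_Arr[OF l] c]]
      comp1_Arr[OF pcomp_Arr[OF s] pcomp_Arr[OF l] c] pcomp_Dom[OF s] by (simp add: layer_def)
qed

lemma layer_both: "atom_ok a \<Longrightarrow> layer (adom a) [] a [] = acell a"
  using layer_left[of a "adom a" "[]"] rwhisk_Id1[OF iso2D[OF atom_ok_hom2]] pcomp_Dom path_Obj
  by (fastforce simp: atom_ok_def)

text \<open>A whole diagram packed into one atom, so that naturality and interchange, which are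
  proved for atoms, apply to diagrams.\<close>

definition box :: "'o \<Rightarrow> 'o \<Rightarrow> 'a list \<Rightarrow> ('o, 'a, 'c) diagram \<Rightarrow> ('o, 'a, 'c) atom" where
  "box A B p xs = Atom A B p (run p xs) (deval A p xs)"

lemma box_simps [simp]:
  "adom (box A B p xs) = A" "acod (box A B p xs) = B" "asrc (box A B p xs) = p"
  "atgt (box A B p xs) = run p xs" "acell (box A B p xs) = deval A p xs"
  by (simp_all add: box_def)

lemma box_ok: "wt A B p xs \<Longrightarrow> atom_ok (box A B p xs)"
  using wt_path deval_in by (auto simp: atom_ok_def)

lemma wt_atom: "atom_ok a \<Longrightarrow> wt (adom a) (acod a) (asrc a) [(0, a)]"
  using path_Obj by (auto simp: fits.simps step.simps atom_ok_def)

lemma deval_atom: "atom_ok a \<Longrightarrow> deval (adom a) (asrc a) [(0, a)] = acell a"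
  using layer_both[of a] vcomp_Id2_right[OF iso2D[OF atom_ok_hom2[of a]]]
  by (simp add: lay.simps step.simps)

lemma deq_box: "wt A B p xs \<Longrightarrow> deq A B p [(0, box A B p xs)] xs"
  using wt_atom[OF box_ok] deval_atom[OF box_ok] by (simp add: deq_def step.simps)

end

section \<open>Constraints of a pseudofunctor along paths\<close>

context pseudofunctor
begin

lemma on1_simps [simp]:
  "f \<in> Arr C \<Longrightarrow> on1 F f \<in> Arr C" "f \<in> Arr C \<Longrightarrow> Dom C (on1 F f) = on0 F (Dom C f)"
  "f \<in> Arr C \<Longrightarrow> Cod C (on1 F f) = on0 F (Cod C f)"
  using on1_in[of f "Dom C f" "Cod C f"] by (auto simp: hom1_iff)

lemma path_map: "path A B p \<Longrightarrow> path (on0 F A) (on0 F B) (map (on1 F) p)"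
  by (induction p arbitrary: B) (auto intro: on0_in)

lemma on2_iso:
  assumes "\<alpha> \<in> iso2 C f g"
  shows "on2 F \<alpha> \<in> iso2 C (on1 F f) (on1 F g)" "vinv (on2 F \<alpha>) = on2 F (vinv \<alpha>)"
proof -
  note i = iso2D[OF assms] iso2D[OF iso2_vinv(1)[OF assms]]
  have e: "on2 F \<alpha> \<Zsemi> on2 F (vinv \<alpha>) = Id2 C (on1 F f)" "on2 F (vinv \<alpha>) \<Zsemi> on2 F \<alpha> = Id2 C (on1 F g)"
    using on2_vcomp[OF i] on2_vcomp[OF i(2,1)] iso2_vinv(2,3)[OF assms] on2_Id2 hom2D[OF i(1)] by auto
  show "on2 F \<alpha> \<in> iso2 C (on1 F f) (on1 F g)" "vinv (on2 F \<alpha>) = on2 F (vinv \<alpha>)"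
    using iso2I[OF on2_in[OF i(1)] on2_in[OF i(2)] e] vinv_unique[OF on2_in[OF i(1)] on2_in[OF i(2)] e] by auto
qed

lemma fcmp_iso_Arr: "\<lbrakk>f \<in> Arr C; g \<in> Arr C; Cod C f = Dom C g\<rbrakk> \<Longrightarrow> fcmp F g f \<in> iso2 C (on1 F g \<cdot> on1 F f) (on1 F (g \<cdot> f))"
  using fcmp_iso[of f "Dom C f" "Dom C g" g "Cod C g"] by (simp add: hom1_iff)

lemma fpc_iso: "path A B p \<Longrightarrow> fpc F A p \<in> iso2 C (pcomp (on0 F A) (map (on1 F) p)) (on1 F (pcomp A p))"
proof (induction p arbitrary: B)
  case Nil then show ?case using funt_iso by simp
next
  case (Cons f p)
  have f: "f \<in> Arr C" and p: "path A (Dom C f) p" using Cons.prems by auto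
  note i = Cons.IH[OF p]
  have "on1 F f \<rhd> fpc F A p \<in> iso2 C (on1 F f \<cdot> pcomp (on0 F A) (map (on1 F) p)) (on1 F f \<cdot> on1 F (pcomp A p))"
    by (rule iso2_lwhisk[OF i]) (use f pcomp_Cod[OF path_map[OF p]] in auto)
  then show ?case
    using iso2_vcomp(1)[OF _ fcmp_iso_Arr[OF pcomp_Arr[OF p] f pcomp_Cod[OF p]]] by simp
qed

lemmas fpc_in = fpc_iso[THEN iso2D]

text \<open>Coherence of the constraints for one cut of the path. The empty case is the left unit
  law; the step is the associativity law of \<open>fcmp\<close>, after interchange has separated the
  constraints of \<open>p\<close> and \<open>q\<close>.\<close>

lemma fpc_append:
  assumes p: "path X B p" and q: "path A X q"
  shows "fpc F A (p @ q) = (fpc F X p \<star> fpc F A q) \<Zsemi> fcmp F (pcomp X p) (pcomp A q)"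
  using p
proof (induction p arbitrary: B)
  case Nil
  have X: "X \<in> Obj C" using Nil by simp
  note u = iso2D[OF funt_iso[OF X]]
  have c: "Cod C (pcomp (on0 F A) (map (on1 F) q)) = on0 F X" "Cod C (on1 F (pcomp A q)) = on0 F X"
    using pcomp_Cod[OF path_map[OF q]] pcomp_Cod[OF q] pcomp_Arr[OF q] by auto
  have I: "Id1 C (on0 F X) \<in> Arr C" "Dom C (Id1 C (on0 F X)) = on0 F X"
    using Id1_in[OF on0_in[OF X]] by (auto simp: hom1_iff)
  have i: "fcmp F (Id1 C X) (pcomp A q) \<in> hom2 C (on1 F (Id1 C X) \<cdot> on1 F (pcomp A q)) (on1 F (pcomp A q))"
    using iso2D[OF fcmp_iso[OF pcomp_in[OF q] Id1_in[OF X]]] comp1_Id1_left[OF pcomp_in[OF q]] by simp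
  have r: "funt F X \<lhd> on1 F (pcomp A q) \<in> hom2 C (Id1 C (on0 F X) \<cdot> on1 F (pcomp A q)) (on1 F (Id1 C X) \<cdot> on1 F (pcomp A q))"
    by (rule rwhisk_in[OF u]) (use pcomp_Arr[OF q] c I in auto)
  have e: "Id1 C (on0 F X) \<cdot> on1 F (pcomp A q) = on1 F (pcomp A q)"
    using comp1_Id1_left[OF on1_in[OF pcomp_in[OF q]]] .
  have "funt F X \<star> fpc F A q = (Id1 C (on0 F X) \<rhd> fpc F A q) \<Zsemi> (funt F X \<lhd> on1 F (pcomp A q))"
    using whisk_interchange(2)[OF fpc_in[OF q] u] c I by simp
  also have "\<dots> = fpc F A q \<Zsemi> (funt F X \<lhd> on1 F (pcomp A q))"
    using lwhisk_Id1[OF fpc_in[OF q] c(1)] by simp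
  finally have "(funt F X \<star> fpc F A q) \<Zsemi> fcmp F (Id1 C X) (pcomp A q)
      = fpc F A q \<Zsemi> ((funt F X \<lhd> on1 F (pcomp A q)) \<Zsemi> fcmp F (Id1 C X) (pcomp A q))"
    using vcomp_assoc[OF fpc_in[OF q] r[unfolded e] i] by simp
  also have "\<dots> = fpc F A q"
    using fcmp_unit_left[OF pcomp_in[OF q]] vcomp_Id2_right[OF fpc_in[OF q]] by simp
  finally show ?case by simp
next
  case (Cons f p)
  have f: "f \<in> Arr C" and p: "path X (Dom C f) p" using Cons.prems by auto
  note IH = Cons.IH[OF p]
  let ?P = "pcomp X p" and ?Q = "pcomp A q" and ?Ff = "on1 F f"
  have arr: "?P \<in> Arr C" "Dom C ?P = X" "Cod C ?P = Dom C f" "?Q \<in> Arr C" "Dom C ?Q = A" "Cod C ?Q = X"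
    using p q pcomp_Arr pcomp_Dom pcomp_Cod by auto
  note mp = path_map[OF p] path_map[OF q]
  have arr': "Cod C (pcomp (on0 F X) (map (on1 F) p)) = on0 F (Dom C f)" "Cod C (pcomp (on0 F A) (map (on1 F) q)) = on0 F X"
    "Dom C (pcomp (on0 F X) (map (on1 F) p)) = on0 F X"
    using mp pcomp_Cod pcomp_Dom by auto
  note cp = fpc_in[OF p] and cq = fpc_in[OF q]
  have h: "fpc F X p \<star> fpc F A q \<in> hom2 C (pcomp (on0 F X) (map (on1 F) p) \<cdot> pcomp (on0 F A) (map (on1 F) q))
      (on1 F ?P \<cdot> on1 F ?Q)"
    by (rule hcomp_in[OF cq cp]) (use arr' in simp)
  have PQ: "?P \<cdot> ?Q \<in> Arr C" "Dom C (?P \<cdot> ?Q) = A" "Cod C (?P \<cdot> ?Q) = Dom C f"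
    using comp1_Arr[OF arr(4,1)] arr by auto
  have fP: "f \<cdot> ?P \<in> Arr C" "Dom C (f \<cdot> ?P) = X" using comp1_Arr[OF arr(1) f arr(3)] arr by auto
  note k1 = iso2D[OF fcmp_iso_Arr[OF arr(4,1)]] note k2 = iso2D[OF fcmp_iso_Arr[OF PQ(1) f PQ(3)]]
  note k3 = iso2D[OF fcmp_iso_Arr[OF arr(1) f arr(3)]] note k4 = iso2D[OF fcmp_iso_Arr[OF arr(4) fP(1)]]
  have mpA: "pcomp (on0 F X) (map (on1 F) p) \<in> Arr C" "pcomp (on0 F A) (map (on1 F) q) \<in> Arr C"
    using mp pcomp_Arr by auto
  have hl: "?Ff \<rhd> (fpc F X p \<star> fpc F A q) = (?Ff \<rhd> fpc F X p) \<star> fpc F A q"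
    unfolding lwhisk_def
    by (rule hcomp_assoc[OF cq cp Id2_in, symmetric]) (use f arr' in auto)
  have lwi: "?Ff \<rhd> fpc F X p \<in> hom2 C (?Ff \<cdot> pcomp (on0 F X) (map (on1 F) p)) (?Ff \<cdot> on1 F ?P)"
    by (rule lwhisk_in[OF cp]) (use f arr' in auto)
  have as: "(?Ff \<rhd> fcmp F ?P ?Q) \<Zsemi> fcmp F f (?P \<cdot> ?Q) = (fcmp F f ?P \<lhd> on1 F ?Q) \<Zsemi> fcmp F (f \<cdot> ?P) ?Q"
    by (rule fcmp_assoc[of ?Q A X ?P "Dom C f" f B]) (use arr f Cons.prems in \<open>auto simp: hom1_iff\<close>)
  have FPQ: "on1 F ?P \<cdot> on1 F ?Q \<in> Arr C" "Cod C (on1 F ?P \<cdot> on1 F ?Q) = on0 F (Dom C f)"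
    using comp1_Arr[of "on1 F ?Q" "on1 F ?P"] arr by auto
  have s1: "?Ff \<rhd> fcmp F ?P ?Q \<in> hom2 C (?Ff \<cdot> (on1 F ?P \<cdot> on1 F ?Q)) (?Ff \<cdot> on1 F (?P \<cdot> ?Q))"
    by (rule lwhisk_in[OF k1]) (use arr f FPQ in auto)
  have s2: "fcmp F f ?P \<lhd> on1 F ?Q \<in> hom2 C ((?Ff \<cdot> on1 F ?P) \<cdot> on1 F ?Q) (on1 F (f \<cdot> ?P) \<cdot> on1 F ?Q)"
    by (rule rwhisk_in[OF k3]) (use arr f comp1_Arr[of "on1 F ?P" ?Ff] in auto)
  have hh: "(?Ff \<rhd> fpc F X p) \<star> fpc F A q \<in> hom2 C ((?Ff \<cdot> pcomp (on0 F X) (map (on1 F) p)) \<cdot> pcomp (on0 F A) (map (on1 F) q))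
      ((?Ff \<cdot> on1 F ?P) \<cdot> on1 F ?Q)"
    by (rule hcomp_in[OF cq lwi]) (use arr' f comp1_Arr[OF mpA(1), of ?Ff] in auto)
  have "fpc F A ((f # p) @ q) = (?Ff \<rhd> ((fpc F X p \<star> fpc F A q) \<Zsemi> fcmp F ?P ?Q)) \<Zsemi> fcmp F f (?P \<cdot> ?Q)"
    using IH pcomp_append[OF p q] by simp
  also have "\<dots> = ((?Ff \<rhd> (fpc F X p \<star> fpc F A q)) \<Zsemi> (?Ff \<rhd> fcmp F ?P ?Q)) \<Zsemi> fcmp F f (?P \<cdot> ?Q)"
    using lwhisk_vcomp[OF h k1, of ?Ff] arr arr' f comp1_Arr[OF mpA(2,1)] by simp
  also have "\<dots> = ((?Ff \<rhd> (fpc F X p \<star> fpc F A q)) \<Zsemi> ((?Ff \<rhd> fcmp F ?P ?Q) \<Zsemi> fcmp F f (?P \<cdot> ?Q)))"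
    by (rule vcomp_assoc[OF lwhisk_in[OF h] s1 k2]) (use arr' f comp1_Arr[OF mpA(2,1)] arr in auto)
  also have "\<dots> = ((?Ff \<rhd> fpc F X p) \<star> fpc F A q) \<Zsemi> ((fcmp F f ?P \<lhd> on1 F ?Q) \<Zsemi> fcmp F (f \<cdot> ?P) ?Q)"
    by (simp add: as hl)
  also have "\<dots> = (((?Ff \<rhd> fpc F X p) \<star> fpc F A q) \<Zsemi> (fcmp F f ?P \<lhd> on1 F ?Q)) \<Zsemi> fcmp F (f \<cdot> ?P) ?Q"
    by (rule vcomp_assoc[OF hh s2 k4, symmetric]) (use arr fP in auto)
  also have "((?Ff \<rhd> fpc F X p) \<star> fpc F A q) \<Zsemi> (fcmp F f ?P \<lhd> on1 F ?Q)
      = ((?Ff \<rhd> fpc F X p) \<Zsemi> fcmp F f ?P) \<star> (fpc F A q \<Zsemi> Id2 C (on1 F ?Q))"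
    unfolding rwhisk_def
    by (rule interchange[OF cq Id2_in lwi k3, symmetric]) (use arr arr' f comp1_Arr[OF mpA(1), of ?Ff] in auto)
  also have "fpc F A q \<Zsemi> Id2 C (on1 F ?Q) = fpc F A q"
    by (rule vcomp_Id2_right[OF cq])
  finally show ?case by simp
qed

text \<open>\<open>sq\<close> says that \<open>y\<close> is the conjugate of the image of
  \<open>x\<close> by the constraints. This relation survives whiskering because \<open>fcmp\<close>
  is natural; the next lemma is the same on the other side.\<close>

lemma fpc_square_right:
  assumes q: "path A' B q" "path A' B q'" and r: "path A A' r"
    and x: "x \<in> hom2 C (pcomp A' q) (pcomp A' q')"
    and y: "y \<in> hom2 C (pcomp (on0 F A') (map (on1 F) q)) (pcomp (on0 F A') (map (on1 F) q'))"
    and sq: "fpc F A' q \<Zsemi> on2 F x = y \<Zsemi> fpc F A' q'"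
  shows "fpc F A (q @ r) \<Zsemi> on2 F (x \<lhd> pcomp A r)
    = (y \<lhd> pcomp (on0 F A) (map (on1 F) r)) \<Zsemi> fpc F A (q' @ r)"
proof -
  let ?R = "pcomp A r" and ?Q = "pcomp A' q" and ?Q' = "pcomp A' q'"
  note cr = fpc_in[OF r] and cq = fpc_in[OF q(1)] fpc_in[OF q(2)]
  have arr: "?R \<in> Arr C" "Cod C ?R = A'" "?Q \<in> Arr C" "Dom C ?Q = A'" "?Q' \<in> Arr C" "Dom C ?Q' = A'"
    using assms pcomp_Arr pcomp_Cod pcomp_Dom by auto
  note mp = path_map[OF q(1)] path_map[OF q(2)] path_map[OF r]
  have d: "Cod C (pcomp (on0 F A) (map (on1 F) r)) = Dom C (pcomp (on0 F A') (map (on1 F) q))"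
    "Cod C (pcomp (on0 F A) (map (on1 F) r)) = Dom C (pcomp (on0 F A') (map (on1 F) q'))"
    using pcomp_Cod[OF mp(3)] pcomp_Dom[OF mp(1)] pcomp_Dom[OF mp(2)] by auto
  have d': "Cod C (on1 F ?R) = Dom C (on1 F ?Q)" "Cod C (on1 F ?R) = Dom C (on1 F ?Q')" using arr by auto
  note ar = pcomp_Arr[OF mp(3)]
  have n: "fcmp F ?Q ?R \<Zsemi> on2 F (x \<lhd> ?R) = (on2 F x \<star> Id2 C (on1 F ?R)) \<Zsemi> fcmp F ?Q' ?R"
    unfolding rwhisk_def using fcmp_natural[OF Id2_in[OF arr(1)] x] arr on2_Id2[OF arr(1)] by simp
  have t: "fpc F A' q \<star> fpc F A r \<in> hom2 C (pcomp (on0 F A') (map (on1 F) q) \<cdot> pcomp (on0 F A) (map (on1 F) r))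
      (on1 F ?Q \<cdot> on1 F ?R)" by (rule hcomp_in[OF cr cq(1) d(1)])
  have t1: "on2 F x \<star> Id2 C (on1 F ?R) \<in> hom2 C (on1 F ?Q \<cdot> on1 F ?R) (on1 F ?Q' \<cdot> on1 F ?R)"
    by (rule hcomp_in[OF Id2_in on2_in[OF x] d'(1)]) (use arr in auto)
  have t2: "x \<lhd> ?R \<in> hom2 C (?Q \<cdot> ?R) (?Q' \<cdot> ?R)" by (rule rwhisk_in[OF x]) (use arr in auto)
  have k: "fcmp F ?Q ?R \<in> hom2 C (on1 F ?Q \<cdot> on1 F ?R) (on1 F (?Q \<cdot> ?R))"
    "fcmp F ?Q' ?R \<in> hom2 C (on1 F ?Q' \<cdot> on1 F ?R) (on1 F (?Q' \<cdot> ?R))"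
    using iso2D[OF fcmp_iso_Arr[of ?R ?Q]] iso2D[OF fcmp_iso_Arr[of ?R ?Q']] arr by simp_all
  have "fpc F A (q @ r) \<Zsemi> on2 F (x \<lhd> ?R) = (fpc F A' q \<star> fpc F A r) \<Zsemi> (fcmp F ?Q ?R \<Zsemi> on2 F (x \<lhd> ?R))"
    unfolding fpc_append[OF q(1) r] by (rule vcomp_assoc[OF t k(1) on2_in[OF t2]])
  also have "\<dots> = ((fpc F A' q \<star> fpc F A r) \<Zsemi> (on2 F x \<star> Id2 C (on1 F ?R))) \<Zsemi> fcmp F ?Q' ?R"
    unfolding n by (rule vcomp_assoc[OF t t1 k(2), symmetric])
  also have "(fpc F A' q \<star> fpc F A r) \<Zsemi> (on2 F x \<star> Id2 C (on1 F ?R))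
      = (fpc F A' q \<Zsemi> on2 F x) \<star> (fpc F A r \<Zsemi> Id2 C (on1 F ?R))"
    by (rule interchange[OF cr Id2_in cq(1) on2_in[OF x] d(1), symmetric]) (use arr in auto)
  also have "\<dots> = (y \<Zsemi> fpc F A' q') \<star> (Id2 C (pcomp (on0 F A) (map (on1 F) r)) \<Zsemi> fpc F A r)"
    by (simp add: vcomp_Id2_right[OF cr] vcomp_Id2_left[OF cr] sq)
  also have "\<dots> = (y \<lhd> pcomp (on0 F A) (map (on1 F) r)) \<Zsemi> (fpc F A' q' \<star> fpc F A r)"
    unfolding rwhisk_def by (rule interchange[OF Id2_in[OF ar] cr y cq(2) d(1)])
  also have "\<dots> \<Zsemi> fcmp F ?Q' ?R = (y \<lhd> pcomp (on0 F A) (map (on1 F) r)) \<Zsemi> fpc F A (q' @ r)"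
    unfolding fpc_append[OF q(2) r]
    by (rule vcomp_assoc[OF rwhisk_in[OF y ar d(1)] hcomp_in[OF cr cq(2) d(2)] k(2)])
  finally show ?thesis .
qed

lemma fpc_square_left:
  assumes q: "path A B' q" "path A B' q'" and l: "path B' B l"
    and x: "x \<in> hom2 C (pcomp A q) (pcomp A q')"
    and y: "y \<in> hom2 C (pcomp (on0 F A) (map (on1 F) q)) (pcomp (on0 F A) (map (on1 F) q'))"
    and sq: "fpc F A q \<Zsemi> on2 F x = y \<Zsemi> fpc F A q'"
  shows "fpc F A (l @ q) \<Zsemi> on2 F (pcomp B' l \<rhd> x)
    = (pcomp (on0 F B') (map (on1 F) l) \<rhd> y) \<Zsemi> fpc F A (l @ q')"
proof -
  let ?L = "pcomp B' l" and ?Q = "pcomp A q" and ?Q' = "pcomp A q'"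
  note cl = fpc_in[OF l] and cq = fpc_in[OF q(1)] fpc_in[OF q(2)]
  have arr: "?L \<in> Arr C" "Dom C ?L = B'" "?Q \<in> Arr C" "Cod C ?Q = B'" "?Q' \<in> Arr C" "Cod C ?Q' = B'"
    using assms pcomp_Arr pcomp_Cod pcomp_Dom by auto
  note mp = path_map[OF q(1)] path_map[OF q(2)] path_map[OF l]
  have d: "Cod C (pcomp (on0 F A) (map (on1 F) q)) = Dom C (pcomp (on0 F B') (map (on1 F) l))"
    "Cod C (pcomp (on0 F A) (map (on1 F) q')) = Dom C (pcomp (on0 F B') (map (on1 F) l))"
    using pcomp_Dom[OF mp(3)] pcomp_Cod[OF mp(1)] pcomp_Cod[OF mp(2)] by auto
  have d': "Cod C (on1 F ?Q) = Dom C (on1 F ?L)" "Cod C (on1 F ?Q') = Dom C (on1 F ?L)" using arr by auto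
  note al = pcomp_Arr[OF mp(3)]
  have n: "fcmp F ?L ?Q \<Zsemi> on2 F (?L \<rhd> x) = (Id2 C (on1 F ?L) \<star> on2 F x) \<Zsemi> fcmp F ?L ?Q'"
    unfolding lwhisk_def using fcmp_natural[OF x Id2_in[OF arr(1)]] arr on2_Id2[OF arr(1)] by simp
  have t: "fpc F B' l \<star> fpc F A q \<in> hom2 C (pcomp (on0 F B') (map (on1 F) l) \<cdot> pcomp (on0 F A) (map (on1 F) q))
      (on1 F ?L \<cdot> on1 F ?Q)" by (rule hcomp_in[OF cq(1) cl d(1)])
  have t1: "Id2 C (on1 F ?L) \<star> on2 F x \<in> hom2 C (on1 F ?L \<cdot> on1 F ?Q) (on1 F ?L \<cdot> on1 F ?Q')"
    by (rule hcomp_in[OF on2_in[OF x] Id2_in d'(1)]) (use arr in auto)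
  have t2: "?L \<rhd> x \<in> hom2 C (?L \<cdot> ?Q) (?L \<cdot> ?Q')" by (rule lwhisk_in[OF x]) (use arr in auto)
  have k: "fcmp F ?L ?Q \<in> hom2 C (on1 F ?L \<cdot> on1 F ?Q) (on1 F (?L \<cdot> ?Q))"
    "fcmp F ?L ?Q' \<in> hom2 C (on1 F ?L \<cdot> on1 F ?Q') (on1 F (?L \<cdot> ?Q'))"
    using iso2D[OF fcmp_iso_Arr[of ?Q ?L]] iso2D[OF fcmp_iso_Arr[of ?Q' ?L]] arr by simp_all
  have "fpc F A (l @ q) \<Zsemi> on2 F (?L \<rhd> x) = (fpc F B' l \<star> fpc F A q) \<Zsemi> (fcmp F ?L ?Q \<Zsemi> on2 F (?L \<rhd> x))"
    unfolding fpc_append[OF l q(1)] by (rule vcomp_assoc[OF t k(1) on2_in[OF t2]])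
  also have "\<dots> = ((fpc F B' l \<star> fpc F A q) \<Zsemi> (Id2 C (on1 F ?L) \<star> on2 F x)) \<Zsemi> fcmp F ?L ?Q'"
    unfolding n by (rule vcomp_assoc[OF t t1 k(2), symmetric])
  also have "(fpc F B' l \<star> fpc F A q) \<Zsemi> (Id2 C (on1 F ?L) \<star> on2 F x)
      = (fpc F B' l \<Zsemi> Id2 C (on1 F ?L)) \<star> (fpc F A q \<Zsemi> on2 F x)"
    by (rule interchange[OF cq(1) on2_in[OF x] cl Id2_in d(1), symmetric]) (use arr in auto)
  also have "\<dots> = (Id2 C (pcomp (on0 F B') (map (on1 F) l)) \<Zsemi> fpc F B' l) \<star> (y \<Zsemi> fpc F A q')"
    by (simp add: vcomp_Id2_right[OF cl] vcomp_Id2_left[OF cl] sq)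
  also have "\<dots> = (pcomp (on0 F B') (map (on1 F) l) \<rhd> y) \<Zsemi> (fpc F B' l \<star> fpc F A q')"
    unfolding lwhisk_def by (rule interchange[OF y cq(2) Id2_in[OF al] cl d(1)])
  also have "\<dots> \<Zsemi> fcmp F ?L ?Q' = (pcomp (on0 F B') (map (on1 F) l) \<rhd> y) \<Zsemi> fpc F A (l @ q')"
    unfolding fpc_append[OF l q(2)]
    by (rule vcomp_assoc[OF lwhisk_in[OF y al d(1)] hcomp_in[OF cq(2) cl d(2)] k(2)])
  finally show ?thesis .
qed

lemma fatom_ok: 
  assumes "atom_ok a"
  shows "atom_ok (fatom F a)"
    and "fpc F (adom a) (asrc a) \<Zsemi> on2 F (acell a) = acell (fatom F a) \<Zsemi> fpc F (adom a) (atgt a)"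
    and "ainv (fatom F a) = fatom F (ainv a)"
proof -
  have s: "path (adom a) (acod a) (asrc a)" "path (adom a) (acod a) (atgt a)"
    using assms by (auto simp: atom_ok_def)
  note x = on2_iso[OF atom_ok_hom2[OF assms]]
  note i = iso2_vcomp[OF fpc_iso[OF s(1)] x(1)]
  note j = iso2_vcomp[OF i(1) iso2_vinv(1)[OF fpc_iso[OF s(2)]]]
  show "atom_ok (fatom F a)"
    unfolding atom_ok_def using path_map[OF s(1)] path_map[OF s(2)] j(1) by (simp add: fatom_def)
  show "fpc F (adom a) (asrc a) \<Zsemi> on2 F (acell a) = acell (fatom F a) \<Zsemi> fpc F (adom a) (atgt a)"
    using vcomp_inv_left[OF iso2D[OF i(1)] fpc_iso[OF s(2)]] by (simp add: fatom_def)
  show "ainv (fatom F a) = fatom F (ainv a)"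
    using j(2) i(2) iso2_vinv(4)[OF fpc_iso[OF s(2)]] x(2)
      vcomp_assoc[OF fpc_in[OF s(2)] iso2D[OF iso2_vinv(1)[OF x(1)]] iso2D[OF iso2_vinv(1)[OF fpc_iso[OF s(1)]]]]
    by (simp add: ainv_def fatom_def)
qed

lemma lay_fatom:
  assumes "fits A B p (n, a)"
  shows "fits (on0 F A) (on0 F B) (map (on1 F) p) (n, fatom F a)"
    "step (map (on1 F) p) (n, fatom F a) = map (on1 F) (step p (n, a))"
    "fpc F A p \<Zsemi> on2 F (lay A p (n, a)) = lay (on0 F A) (map (on1 F) p) (n, fatom F a) \<Zsemi> fpc F A (step p (n, a))"
proof -
  obtain l r where *: "p = l @ asrc a @ r" "n = length l" "atom_ok a" "path (acod a) B l" "path A (adom a) r"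
    using assms unfolding fits_iff by blast
  have s: "path (adom a) (acod a) (asrc a)" "path (adom a) (acod a) (atgt a)"
    using *(3) by (auto simp: atom_ok_def)
  show f: "fits (on0 F A) (on0 F B) (map (on1 F) p) (n, fatom F a)"
    unfolding fits_iff using *(1,2) fatom_ok(1)[OF *(3)] path_map[OF *(4)] path_map[OF *(5)]
    by (intro exI[of _ "map (on1 F) l"] exI[of _ "map (on1 F) r"]) auto
  show st: "step (map (on1 F) p) (n, fatom F a) = map (on1 F) (step p (n, a))"
    using * by (simp add: step.simps)
  note x = iso2D[OF atom_ok_hom2[OF *(3)]] note y = iso2D[OF atom_ok_hom2[OF fatom_ok(1)[OF *(3)]], simplified]
  have cd: "Cod C (pcomp (adom a) (asrc a)) = Dom C (pcomp (acod a) l)"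
    "Cod C (pcomp (on0 F (adom a)) (map (on1 F) (asrc a))) = Dom C (pcomp (on0 F (acod a)) (map (on1 F) l))"
    using pcomp_Cod[OF s(1)] pcomp_Dom[OF *(4)] pcomp_Cod[OF path_map[OF s(1)]] pcomp_Dom[OF path_map[OF *(4)]] by auto
  have e: "pcomp (acod a) l \<cdot> pcomp (adom a) (asrc a) = pcomp (adom a) (l @ asrc a)"
    "pcomp (acod a) l \<cdot> pcomp (adom a) (atgt a) = pcomp (adom a) (l @ atgt a)"
    "pcomp (on0 F (acod a)) (map (on1 F) l) \<cdot> pcomp (on0 F (adom a)) (map (on1 F) (asrc a))
      = pcomp (on0 F (adom a)) (map (on1 F) (l @ asrc a))"
    "pcomp (on0 F (acod a)) (map (on1 F) l) \<cdot> pcomp (on0 F (adom a)) (map (on1 F) (atgt a))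
      = pcomp (on0 F (adom a)) (map (on1 F) (l @ atgt a))"
    using pcomp_append[OF *(4) s(1)] pcomp_append[OF *(4) s(2)]
      pcomp_append[OF path_map[OF *(4)] path_map[OF s(1)]] pcomp_append[OF path_map[OF *(4)] path_map[OF s(2)]] by auto
  have lp: "path (adom a) B (l @ asrc a)" "path (adom a) B (l @ atgt a)" using *(4) s by (auto simp: path_append)
  note sl = fpc_square_left[OF s *(4) x y fatom_ok(2)[OF *(3)]]
  note sr = fpc_square_right[OF lp *(5)
      lwhisk_in[OF x pcomp_Arr[OF *(4)] cd(1), unfolded e]
      lwhisk_in[OF y pcomp_Arr[OF path_map[OF *(4)]] cd(2), unfolded e] sl]
  show "fpc F A p \<Zsemi> on2 F (lay A p (n, a)) = lay (on0 F A) (map (on1 F) p) (n, fatom F a) \<Zsemi> fpc F A (step p (n, a))"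
    using sr * by (simp add: lay.simps step.simps layer_def)
qed

text \<open>The squares of the single layers paste, since the constraint at each intermediate path
  is the lower edge of one square and the upper edge of the next.\<close>

lemma fdiag_in:
  assumes "wt A B p xs"
  shows "wt (on0 F A) (on0 F B) (map (on1 F) p) (fdiag F xs)"
    "run (map (on1 F) p) (fdiag F xs) = map (on1 F) (run p xs)"
    "fpc F A p \<Zsemi> on2 F (deval A p xs) = deval (on0 F A) (map (on1 F) p) (fdiag F xs) \<Zsemi> fpc F A (run p xs)"
proof -
  have "wt (on0 F A) (on0 F B) (map (on1 F) p) (fdiag F xs) \<and>
    run (map (on1 F) p) (fdiag F xs) = map (on1 F) (run p xs) \<and>
    fpc F A p \<Zsemi> on2 F (deval A p xs) = deval (on0 F A) (map (on1 F) p) (fdiag F xs) \<Zsemi> fpc F A (run p xs)"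
    using assms
  proof (induction xs arbitrary: p)
    case Nil
    then have p: "path A B p" by simp
    show ?case
      using path_map[OF p] on2_Id2[OF pcomp_Arr[OF p]] vcomp_Id2_right[OF fpc_in[OF p]] vcomp_Id2_left[OF fpc_in[OF p]] by simp
  next
    case (Cons d xs)
    obtain n a where d: "d = (n, a)" by (cases d)
    have f: "fits A B p (n, a)" and w: "wt A B (step p (n, a)) xs" using Cons.prems by (auto simp: d)
    note L = lay_fatom[OF f] note IH = Cons.IH[OF w]
    have p: "path A B p" "path A B (step p (n, a))" using fits_path[OF f] by auto
    note l1 = iso2D[OF lay_in[OF f]] note l2 = iso2D[OF lay_in[OF L(1)], unfolded L(2)]
    note d1 = iso2D[OF deval_in[OF w]]
    have d2: "deval (on0 F A) (map (on1 F) (step p (n, a))) (fdiag F xs)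
       \<in> hom2 C (pcomp (on0 F A) (map (on1 F) (step p (n, a)))) (pcomp (on0 F A) (map (on1 F) (run (step p (n, a)) xs)))"
      using iso2D[OF deval_in] IH by metis
    have p3: "path A B (run (step p (n, a)) xs)" using wt_path[OF w] by blast
    have "fpc F A p \<Zsemi> on2 F (deval A p (d # xs))
        = (fpc F A p \<Zsemi> on2 F (lay A p (n, a))) \<Zsemi> on2 F (deval A (step p (n, a)) xs)"
      using on2_vcomp[OF l1 d1] vcomp_assoc[OF fpc_in[OF p(1)] on2_in[OF l1] on2_in[OF d1]] by (simp add: d)
    also have "\<dots> = lay (on0 F A) (map (on1 F) p) (n, fatom F a) \<Zsemi> (fpc F A (step p (n, a)) \<Zsemi> on2 F (deval A (step p (n, a)) xs))"
      unfolding L(3) by (rule vcomp_assoc[OF l2 fpc_in[OF p(2)] on2_in[OF d1]])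
    also have "\<dots> = lay (on0 F A) (map (on1 F) p) (n, fatom F a) \<Zsemi>
        (deval (on0 F A) (map (on1 F) (step p (n, a))) (fdiag F xs) \<Zsemi> fpc F A (run (step p (n, a)) xs))"
      using IH by simp
    also have "\<dots> = deval (on0 F A) (map (on1 F) p) (fdiag F (d # xs)) \<Zsemi> fpc F A (run p (d # xs))"
      using vcomp_assoc[OF l2 d2 fpc_in[OF p3]] by (simp add: d L(2))
    finally show ?case using IH L(1,2) by (simp add: d)
  qed
  then show "wt (on0 F A) (on0 F B) (map (on1 F) p) (fdiag F xs)"
    "run (map (on1 F) p) (fdiag F xs) = map (on1 F) (run p xs)"
    "fpc F A p \<Zsemi> on2 F (deval A p xs) = deval (on0 F A) (map (on1 F) p) (fdiag F xs) \<Zsemi> fpc F A (run p xs)"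
    by auto
qed

text \<open>Conjugation by constraints that depend only on the first and the last path: the one at
  the last path is invertible and cancels.\<close>

lemma deq_fdiag:
  assumes "deq A B p xs ys"
  shows "deq (on0 F A) (on0 F B) (map (on1 F) p) (fdiag F xs) (fdiag F ys)"
proof -
  have w: "wt A B p xs" "wt A B p ys" "run p xs = run p ys" "deval A p xs = deval A p ys"
    using assms by (auto simp: deq_def)
  note X = fdiag_in[OF w(1)] note Y = fdiag_in[OF w(2)]
  have "deval (on0 F A) (map (on1 F) p) (fdiag F xs) = deval (on0 F A) (map (on1 F) p) (fdiag F ys)"
  proof (rule vcomp_cancel_right)
    show "fpc F A (run p xs) \<in> iso2 C (pcomp (on0 F A) (map (on1 F) (run p xs))) (on1 F (pcomp A (run p xs)))"
      using fpc_iso wt_path[OF w(1)] by blast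
  qed (use iso2D[OF deval_in[OF X(1)]] iso2D[OF deval_in[OF Y(1)]] X Y w in auto)
  then show ?thesis using X Y w by (simp add: deq_def)
qed

end

section \<open>Composite and identity pseudofunctors\<close>

context two_category
begin

lemma fpc_comp:
  assumes "pseudofunctor C F" "pseudofunctor C G" "path A B p"
  shows "fpc (G \<bullet> F) A p = fpc G (on0 F A) (map (on1 F) p) \<Zsemi> on2 G (fpc F A p)"
  using assms(3)
proof (induction p arbitrary: B)
  case Nil then show ?case by (simp add: pf_comp_def)
next
  case (Cons f p)
  interpret F: pseudofunctor C F by fact
  interpret G: pseudofunctor C G by fact
  have f: "f \<in> Arr C" and p: "path A (Dom C f) p" using Cons.prems by auto
  let ?P = "pcomp A p" and ?FP = "pcomp (on0 F A) (map (on1 F) p)"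
    and ?GFP = "pcomp (on0 G (on0 F A)) (map (on1 G) (map (on1 F) p))"
  note Fp = F.path_map[OF p] note GFp = G.path_map[OF Fp]
  have arr: "?P \<in> Arr C" "Cod C ?P = Dom C f" "?FP \<in> Arr C" "Cod C ?FP = on0 F (Dom C f)"
     "?GFP \<in> Arr C" "Cod C ?GFP = on0 G (on0 F (Dom C f))"
    using pcomp_Arr[OF p] pcomp_Cod[OF p] pcomp_Arr[OF Fp] pcomp_Cod[OF Fp] pcomp_Arr[OF GFp] pcomp_Cod[OF GFp] by auto
  note c1 = F.fpc_in[OF p] and c2 = G.fpc_in[OF Fp]
  note g1 = G.on2_in[OF c1]
  have k1: "fcmp F f ?P \<in> hom2 C (on1 F f \<cdot> on1 F ?P) (on1 F (f \<cdot> ?P))"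
    using iso2D[OF F.fcmp_iso_Arr] arr f by simp
  have k2: "fcmp G (on1 F f) (on1 F ?P) \<in> hom2 C (on1 G (on1 F f) \<cdot> on1 G (on1 F ?P)) (on1 G (on1 F f \<cdot> on1 F ?P))"
    using iso2D[OF G.fcmp_iso_Arr] arr f by simp
  have k3: "fcmp G (on1 F f) ?FP \<in> hom2 C (on1 G (on1 F f) \<cdot> on1 G ?FP) (on1 G (on1 F f \<cdot> ?FP))"
    using iso2D[OF G.fcmp_iso_Arr] arr f by simp
  have l1: "on1 F f \<rhd> fpc F A p \<in> hom2 C (on1 F f \<cdot> ?FP) (on1 F f \<cdot> on1 F ?P)"
    using lwhisk_in[OF c1] arr f by simp
  note gl1 = G.on2_in[OF l1] and gk1 = G.on2_in[OF k1]
  have l2: "on1 G (on1 F f) \<rhd> fpc G (on0 F A) (map (on1 F) p) \<in> hom2 C (on1 G (on1 F f) \<cdot> ?GFP) (on1 G (on1 F f) \<cdot> on1 G ?FP)"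
    using lwhisk_in[OF c2] arr f by simp
  have l3: "on1 G (on1 F f) \<rhd> on2 G (fpc F A p) \<in> hom2 C (on1 G (on1 F f) \<cdot> on1 G ?FP) (on1 G (on1 F f) \<cdot> on1 G (on1 F ?P))"
    using lwhisk_in[OF g1] arr f by simp
  have n: "fcmp G (on1 F f) ?FP \<Zsemi> on2 G (on1 F f \<rhd> fpc F A p)
      = (on1 G (on1 F f) \<rhd> on2 G (fpc F A p)) \<Zsemi> fcmp G (on1 F f) (on1 F ?P)"
    unfolding lwhisk_def using G.fcmp_natural[OF c1 Id2_in[of "on1 F f"]] arr f G.on2_Id2 by simp
  have "fpc (G \<bullet> F) A (f # p) = (on1 G (on1 F f) \<rhd> (fpc G (on0 F A) (map (on1 F) p) \<Zsemi> on2 G (fpc F A p))) \<Zsemi>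
      (fcmp G (on1 F f) (on1 F ?P) \<Zsemi> on2 G (fcmp F f ?P))"
    using Cons.IH[OF p] by (simp add: pf_comp_def)
  also have "on1 G (on1 F f) \<rhd> (fpc G (on0 F A) (map (on1 F) p) \<Zsemi> on2 G (fpc F A p))
      = (on1 G (on1 F f) \<rhd> fpc G (on0 F A) (map (on1 F) p)) \<Zsemi> (on1 G (on1 F f) \<rhd> on2 G (fpc F A p))"
    using lwhisk_vcomp[OF c2 g1] arr f by simp
  also have "\<dots> \<Zsemi> (fcmp G (on1 F f) (on1 F ?P) \<Zsemi> on2 G (fcmp F f ?P))
      = (on1 G (on1 F f) \<rhd> fpc G (on0 F A) (map (on1 F) p)) \<Zsemi> (((on1 G (on1 F f) \<rhd> on2 G (fpc F A p))
          \<Zsemi> fcmp G (on1 F f) (on1 F ?P)) \<Zsemi> on2 G (fcmp F f ?P))"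
    using vcomp_assoc[OF l2 l3 vcomp_in[OF k2 gk1]] vcomp_assoc[OF l3 k2 gk1] by simp
  also have "\<dots> = (on1 G (on1 F f) \<rhd> fpc G (on0 F A) (map (on1 F) p)) \<Zsemi> ((fcmp G (on1 F f) ?FP \<Zsemi> on2 G (on1 F f \<rhd> fpc F A p))
       \<Zsemi> on2 G (fcmp F f ?P))"
    by (simp only: n)
  also have "\<dots> = ((on1 G (on1 F f) \<rhd> fpc G (on0 F A) (map (on1 F) p)) \<Zsemi> fcmp G (on1 F f) ?FP) \<Zsemi>
       (on2 G (on1 F f \<rhd> fpc F A p) \<Zsemi> on2 G (fcmp F f ?P))"
    using vcomp_assoc[OF l2 k3 vcomp_in[OF gl1 gk1]] vcomp_assoc[OF k3 gl1 gk1] by simp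
  also have "\<dots> = fpc G (on0 F A) (map (on1 F) (f # p)) \<Zsemi> on2 G (fpc F A (f # p))"
    using G.on2_vcomp[OF l1 k1] by simp
  finally show ?case .
qed

text \<open>The constraints of \<open>TP\<close> or \<open>PT\<close> are thereby split into those
  of T and P, so that naturality of a transformation between composites and repeated application of
  single functors produce literally the same atoms.\<close>

lemma fatom_comp:
  assumes "pseudofunctor C F" "pseudofunctor C G" "atom_ok a"
  shows "fatom (G \<bullet> F) a = fatom G (fatom F a)"
proof -
  interpret F: pseudofunctor C F by fact
  interpret G: pseudofunctor C G by fact
  have s: "path (adom a) (acod a) (asrc a)" "path (adom a) (acod a) (atgt a)"
    using assms(3) by (auto simp: atom_ok_def)
  let ?s = "fpc G (on0 F (adom a)) (map (on1 F) (asrc a))" and ?t = "fpc G (on0 F (adom a)) (map (on1 F) (atgt a))"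
  note S = G.fpc_in[OF F.path_map[OF s(1)]] and T = G.fpc_iso[OF F.path_map[OF s(2)]]
  note Ti = iso2D[OF iso2_vinv(1)[OF T]]
  note fs = F.fpc_in[OF s(1)] and ft = F.fpc_iso[OF s(2)]
  note fti = iso2D[OF iso2_vinv(1)[OF ft]]
  note x = F.on2_in[OF iso2D[OF atom_ok_hom2[OF assms(3)]]]
  note gfs = G.on2_in[OF fs] and gx = G.on2_in[OF x] and gft = G.on2_iso[OF ft]
  note gfti = G.on2_in[OF fti]
  have "acell (fatom (G \<bullet> F) a) = ((?s \<Zsemi> on2 G (fpc F (adom a) (asrc a))) \<Zsemi> on2 G (on2 F (acell a))) \<Zsemi>
      (on2 G (vinv (fpc F (adom a) (atgt a))) \<Zsemi> vinv ?t)"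
    using iso2_vcomp(2)[OF T gft(1)] gft(2)
    by (simp add: fatom_def fpc_comp[OF assms(1,2) s(1)] fpc_comp[OF assms(1,2) s(2)])
  also have "\<dots> = (?s \<Zsemi> ((on2 G (fpc F (adom a) (asrc a)) \<Zsemi> on2 G (on2 F (acell a))) \<Zsemi>
      on2 G (vinv (fpc F (adom a) (atgt a))))) \<Zsemi> vinv ?t"
    using vcomp_assoc[OF S gfs gx] vcomp_assoc[OF S vcomp_in[OF gfs gx] vcomp_in[OF gfti Ti]]
      vcomp_assoc[OF vcomp_in[OF gfs gx] gfti Ti] vcomp_assoc[OF S vcomp_in[OF vcomp_in[OF gfs gx] gfti] Ti] by simp
  also have "\<dots> = acell (fatom G (fatom F a))"
    using G.on2_vcomp[OF fs x] G.on2_vcomp[OF vcomp_in[OF fs x] fti] by (simp add: fatom_def)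
  finally show ?thesis
    by (simp add: fatom_def)
qed

lemma fatom_pf_id [simp]:
  assumes "atom_ok a"
  shows "fatom (pf_id C) a = a"
proof -
  have fpc: "fpc (pf_id C) A p = Id2 C (pcomp A p)" if "path A B p" for A B p
    using that
  proof (induction p arbitrary: B)
    case (Cons f p)
    then have "f \<rhd> Id2 C (pcomp A p) = Id2 C (f \<cdot> pcomp A p)"
      using lwhisk_Id2[OF pcomp_Arr] pcomp_Cod by simp
    moreover have "Id2 C (f \<cdot> pcomp A p) \<Zsemi> Id2 C (f \<cdot> pcomp A p) = Id2 C (f \<cdot> pcomp A p)"
      using vcomp_Id2_left[OF Id2_in] pcomp_Arr[OF Cons.prems] by simp
    ultimately show ?case using Cons.IH[of "Dom C f"] Cons.prems by simp
  qed simp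
  have s: "path (adom a) (acod a) (asrc a)" "path (adom a) (acod a) (atgt a)"
    using assms by (auto simp: atom_ok_def)
  have "vinv (Id2 C (pcomp (adom a) (atgt a))) = Id2 C (pcomp (adom a) (atgt a))"
    using vinv_unique[OF Id2_in Id2_in] vcomp_Id2_left[OF Id2_in] pcomp_Arr[OF s(2)] by simp
  then show ?thesis
    using vcomp_Id2_left[OF iso2D[OF atom_ok_hom2[OF assms]]] vcomp_Id2_right[OF iso2D[OF atom_ok_hom2[OF assms]]]
      fpc[OF s(1)] fpc[OF s(2)] by (cases a) (simp add: fatom_def map_idI)
qed

lemma deq_whisk_left:
  "\<lbrakk>deq A B' q xs ys; path B' B l\<rbrakk> \<Longrightarrow> deq A B (l @ q) (shift (length l) xs) (shift (length l) ys)"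
  using deq_whisk[of A B' q xs ys A "[]" B l] path_Obj by (fastforce simp: deq_def dest: wt_path)

lemma shift_0 [simp]: "shift 0 xs = xs"
  by (induction xs) auto

lemma deq_whisk_right: "\<lbrakk>deq A' B q xs ys; path A A' r\<rbrakk> \<Longrightarrow> deq A B (q @ r) xs ys"
  using deq_whisk[of A' B q xs ys A r B "[]"] path_Obj by (fastforce simp: deq_def dest: wt_path)

lemma deval_shift_left:
  assumes "wt A B' q xs" "path B' B l"
  shows "wt A B (l @ q) (shift (length l) xs)" "run (l @ q) (shift (length l) xs) = l @ run q xs"
    "deval A (l @ q) (shift (length l) xs) = pcomp B' l \<rhd> deval A q xs"
proof -
  have p: "path A B' q" using wt_path[OF assms(1)] by blast
  have A: "path A A []" using path_Obj[OF p] by simp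
  have c: "Cod C (pcomp A q) = Dom C (pcomp B' l)" using pcomp_Cod[OF p] pcomp_Dom[OF assms(2)] by simp
  note t = lwhisk_in[OF iso2D[OF deval_in[OF assms(1)]] pcomp_Arr[OF assms(2)] c]
  have d: "Dom C (pcomp B' l \<cdot> pcomp A q) = A"
    using comp1_Arr[OF pcomp_Arr[OF p] pcomp_Arr[OF assms(2)] c] pcomp_Dom[OF p] by simp
  show "wt A B (l @ q) (shift (length l) xs)" "run (l @ q) (shift (length l) xs) = l @ run q xs"
    "deval A (l @ q) (shift (length l) xs) = pcomp B' l \<rhd> deval A q xs"
    using shift_in[OF assms(1) A assms(2)] rwhisk_Id1[OF t d] by auto
qed

lemma deval_whisk_right:
  assumes "wt A' B q xs" "path A A' r"
  shows "wt A B (q @ r) xs" "run (q @ r) xs = run q xs @ r"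
    "deval A (q @ r) xs = deval A' q xs \<lhd> pcomp A r"
proof -
  have p: "path A' B q" using wt_path[OF assms(1)] by blast
  have B: "path B B []" using path_Obj[OF p] by simp
  note t = lwhisk_Id1[OF iso2D[OF deval_in[OF assms(1)]] pcomp_Cod[OF p]]
  show "wt A B (q @ r) xs" "run (q @ r) xs = run q xs @ r"
    "deval A (q @ r) xs = deval A' q xs \<lhd> pcomp A r"
    using shift_in[OF assms(1,2) B] t by auto
qed

lemma deval_snoc:
  assumes "wt A B p xs" "fits A B (run p xs) d"
  shows "deval A p (xs @ [d]) = deval A p xs \<Zsemi> lay A (run p xs) d"
  using deval_append[OF assms(1), of "[d]"] assms(2) fits_path[OF assms(2)] vcomp_Id2_right[OF iso2D[OF lay_in[OF assms(2)]]]
  by simp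

end

section \<open>Pasting naturality squares along a path\<close>

context pseudonatural
begin

lemma cmpt_simps [simp]:
  assumes "A \<in> Obj C"
  shows "\<alpha>\<langle>A\<rangle> \<in> Arr C" "Dom C (\<alpha>\<langle>A\<rangle>) = on0 F A" "Cod C (\<alpha>\<langle>A\<rangle>) = on0 G A"
  using cmpt_in[OF assms] by (auto simp: hom1_iff)

lemma natom_ok [simp]: "f \<in> Arr C \<Longrightarrow> atom_ok (natom F G \<alpha> f)"
proof -
  assume f: "f \<in> Arr C"
  have "\<alpha>\<llangle>f\<rrangle> \<in> iso2 C (on1 G f \<cdot> \<alpha>\<langle>Dom C f\<rangle>) (\<alpha>\<langle>Cod C f\<rangle> \<cdot> on1 F f)"
    using cnat_iso[of f "Dom C f" "Cod C f"] f by (simp add: hom1_iff)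
  moreover have "pcomp (on0 F (Dom C f)) [\<alpha>\<langle>Dom C f\<rangle>] = \<alpha>\<langle>Dom C f\<rangle>" "pcomp (on0 F (Dom C f)) [on1 F f] = on1 F f"
    using pcomp_single f Dom_in by auto
  ultimately show ?thesis
    using f Dom_in Cod_in F.on0_in by (auto simp: atom_ok_def simp del: pcomp.simps(2) simp: pcomp.simps(2)[of _ _ "[_]"])
qed

text \<open>The third claim identifies the pasted squares with the single constraint at the
  composite 1-cell, up to constraints of the functors. It is the iterated form of
  \<open>cnat_Id1\<close> and \<open>cnat_comp1\<close>.\<close>

lemma cross_in:
  assumes "path A B p"
  shows "wt (on0 F A) (on0 G B) (map (on1 G) p @ [\<alpha>\<langle>A\<rangle>]) (cross F G \<alpha> p)"
    "run (map (on1 G) p @ [\<alpha>\<langle>A\<rangle>]) (cross F G \<alpha> p) = \<alpha>\<langle>B\<rangle> # map (on1 F) p"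
    "deval (on0 F A) (map (on1 G) p @ [\<alpha>\<langle>A\<rangle>]) (cross F G \<alpha> p) \<Zsemi> (\<alpha>\<langle>B\<rangle> \<rhd> fpc F A p)
      = (fpc G A p \<lhd> \<alpha>\<langle>A\<rangle>) \<Zsemi> \<alpha>\<llangle>pcomp A p\<rrangle>"
proof -
  have A: "A \<in> Obj C" using path_Obj[OF assms] by simp
  let ?w = "\<lambda>p. map (on1 G) p @ [\<alpha>\<langle>A\<rangle>]" and ?D = "\<lambda>p. deval (on0 F A) (map (on1 G) p @ [\<alpha>\<langle>A\<rangle>]) (cross F G \<alpha> p)"
  have "wt (on0 F A) (on0 G B) (?w p) (cross F G \<alpha> p) \<and> run (?w p) (cross F G \<alpha> p) = \<alpha>\<langle>B\<rangle> # map (on1 F) p \<and>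
    ?D p \<Zsemi> (\<alpha>\<langle>B\<rangle> \<rhd> fpc F A p) = (fpc G A p \<lhd> \<alpha>\<langle>A\<rangle>) \<Zsemi> \<alpha>\<llangle>pcomp A p\<rrangle>"
    using assms
  proof (induction p arbitrary: B)
    case Nil
    have l: "\<alpha>\<langle>A\<rangle> \<rhd> funt F A \<in> hom2 C (\<alpha>\<langle>A\<rangle> \<cdot> Id1 C (on0 F A)) (\<alpha>\<langle>A\<rangle> \<cdot> on1 F (Id1 C A))"
      using lwhisk_in[OF iso2D[OF F.funt_iso[OF A]], of "\<alpha>\<langle>A\<rangle>"] A Id1_in[OF F.on0_in[OF A]] by (simp add: hom1_iff)
    then show ?case using Nil A F.on0_in G.on0_in cnat_Id1[OF A] pcomp_single vcomp_Id2_left[OF l]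
      by simp
  next
    case (Cons f p)
    have f: "f \<in> Arr C" "Cod C f = B" and p: "path A (Dom C f) p" using Cons.prems by auto
    let ?X = "Dom C f"
    have ob: "?X \<in> Obj C" "B \<in> Obj C" using f Dom_in Cod_in by auto
    note IH = Cons.IH[OF p]
    let ?P = "pcomp A p" and ?FP = "pcomp (on0 F A) (map (on1 F) p)" and ?GP = "pcomp (on0 G A) (map (on1 G) p)"
    have pG: "path (on0 G ?X) (on0 G B) [on1 G f]" using f ob G.on0_in by simp
    note sh = deval_shift_left[OF IH[THEN conjunct1] pG]
    have sh': "wt (on0 F A) (on0 G B) (?w (f # p)) (shift 1 (cross F G \<alpha> p))"
      "run (?w (f # p)) (shift 1 (cross F G \<alpha> p)) = on1 G f # \<alpha>\<langle>?X\<rangle> # map (on1 F) p"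
      "deval (on0 F A) (?w (f # p)) (shift 1 (cross F G \<alpha> p)) = on1 G f \<rhd> ?D p"
      using sh IH pcomp_single[of "on1 G f" "on0 G ?X"] f by auto
    have fi: "fits (on0 F A) (on0 G B) (on1 G f # \<alpha>\<langle>?X\<rangle> # map (on1 F) p) (0, natom F G \<alpha> f)"
      using f ob G.on0_in F.path_map[OF p] by (simp add: fits.simps)
    have st: "step (on1 G f # \<alpha>\<langle>?X\<rangle> # map (on1 F) p) (0, natom F G \<alpha> f) = \<alpha>\<langle>B\<rangle> # map (on1 F) (f # p)"
      using f by (simp add: step.simps)
    have la: "lay (on0 F A) (on1 G f # \<alpha>\<langle>?X\<rangle> # map (on1 F) p) (0, natom F G \<alpha> f) = \<alpha>\<llangle>f\<rrangle> \<lhd> ?FP"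
      using layer_left[OF natom_ok[OF f(1)]] F.path_map[OF p] by (simp add: lay.simps)
    have w: "wt (on0 F A) (on0 G B) (?w (f # p)) (cross F G \<alpha> (f # p))"
      and r: "run (?w (f # p)) (cross F G \<alpha> (f # p)) = \<alpha>\<langle>B\<rangle> # map (on1 F) (f # p)"
      using sh' fi st fits_path[OF fi] by auto
    have d: "?D (f # p) = (on1 G f \<rhd> ?D p) \<Zsemi> (\<alpha>\<llangle>f\<rrangle> \<lhd> ?FP)"
      using deval_snoc[OF sh'(1)] fi sh' la by simp
    note Fp = F.path_map[OF p] and Gp = G.path_map[OF p]
    have arr: "?P \<in> Arr C" "Dom C ?P = A" "Cod C ?P = ?X" "?FP \<in> Arr C" "Dom C ?FP = on0 F A" "Cod C ?FP = on0 F ?X"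
      "?GP \<in> Arr C" "Dom C ?GP = on0 G A" "Cod C ?GP = on0 G ?X"
      using pcomp_Arr pcomp_Dom pcomp_Cod p Fp Gp by auto
    have aA: "\<alpha>\<langle>A\<rangle> \<in> Arr C" "path (on0 F A) (on0 G A) [\<alpha>\<langle>A\<rangle>]" using A F.on0_in by auto
    have wp: "pcomp (on0 F A) (?w p) = ?GP \<cdot> \<alpha>\<langle>A\<rangle>"
      using pcomp_append[OF Gp aA(2)] pcomp_single[OF aA(1)] A by simp
    have D: "?D p \<in> hom2 C (?GP \<cdot> \<alpha>\<langle>A\<rangle>) (\<alpha>\<langle>?X\<rangle> \<cdot> ?FP)"
      using iso2D[OF deval_in[OF IH[THEN conjunct1]]] IH wp by simp
    note phF = cellD[OF F.fpc_in[OF p]] and phG = cellD[OF G.fpc_in[OF p]]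
    have kF: "fcmp F f ?P \<in> hom2 C (on1 F f \<cdot> on1 F ?P) (on1 F (f \<cdot> ?P))"
      and kG: "fcmp G f ?P \<in> hom2 C (on1 G f \<cdot> on1 G ?P) (on1 G (f \<cdot> ?P))"
      using iso2D[OF F.fcmp_iso_Arr] iso2D[OF G.fcmp_iso_Arr] arr f by auto
    have nf: "\<alpha>\<llangle>f\<rrangle> \<in> hom2 C (on1 G f \<cdot> \<alpha>\<langle>?X\<rangle>) (\<alpha>\<langle>B\<rangle> \<cdot> on1 F f)"
      using iso2D[OF cnat_iso[of f ?X B]] f by (simp add: hom1_iff)
    have np: "\<alpha>\<llangle>?P\<rrangle> \<in> hom2 C (on1 G ?P \<cdot> \<alpha>\<langle>A\<rangle>) (\<alpha>\<langle>?X\<rangle> \<cdot> on1 F ?P)"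
      using iso2D[OF cnat_iso] pcomp_in[OF p] by simp
    have fP: "f \<cdot> ?P \<in> Arr C" "Dom C (f \<cdot> ?P) = A" "Cod C (f \<cdot> ?P) = B"
      using comp1_simps[OF arr(1) f(1) arr(3)] arr f by auto
    have nfP: "\<alpha>\<llangle>f \<cdot> ?P\<rrangle> \<in> hom2 C (on1 G (f \<cdot> ?P) \<cdot> \<alpha>\<langle>A\<rangle>) (\<alpha>\<langle>B\<rangle> \<cdot> on1 F (f \<cdot> ?P))"
      using iso2D[OF cnat_iso[of "f \<cdot> ?P" A B]] fP by (simp add: hom1_iff)
    note [simp] = cellD[OF D] phF phG cellD[OF kF] cellD[OF kG] cellD[OF nf] cellD[OF np] cellD[OF nfP] arr f(1)
      fP aA(1) ob A
    have as: "on1 G f \<cdot> (\<alpha>\<langle>?X\<rangle> \<cdot> h) = (on1 G f \<cdot> \<alpha>\<langle>?X\<rangle>) \<cdot> h" "\<alpha>\<langle>B\<rangle> \<cdot> (on1 F f \<cdot> h) = (\<alpha>\<langle>B\<rangle> \<cdot> on1 F f) \<cdot> h"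
       if "h \<in> Arr C" "Cod C h = on0 F ?X" for h
      using that comp1_assoc[of h "Dom C h" "on0 F ?X" "\<alpha>\<langle>?X\<rangle>" "on0 G ?X" "on1 G f" "on0 G B"]
        comp1_assoc[of h "Dom C h" "on0 F ?X" "on1 F f" "on0 F B" "\<alpha>\<langle>B\<rangle>" "on0 G B"] f(2) by (auto simp: hom1_iff)
    have as': "(on1 G f \<cdot> h) \<cdot> \<alpha>\<langle>A\<rangle> = on1 G f \<cdot> (h \<cdot> \<alpha>\<langle>A\<rangle>)"
       if "h \<in> Arr C" "Dom C h = on0 G A" "Cod C h = on0 G ?X" for h
      using that comp1_assoc[of "\<alpha>\<langle>A\<rangle>" "on0 F A" "on0 G A" h "on0 G ?X" "on1 G f" "on0 G B"] f(2) by (auto simp: hom1_iff)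
    \<comment> \<open>Interchange carries the functor constraint of the tail from before the square
      at \<open>f\<close> to after it, where it joins \<open>fcmp F f\<close>.\<close>
    have i: "((on1 G f \<cdot> \<alpha>\<langle>?X\<rangle>) \<rhd> fpc F A p) \<Zsemi> (\<alpha>\<llangle>f\<rrangle> \<lhd> on1 F ?P)
        = (\<alpha>\<llangle>f\<rrangle> \<lhd> ?FP) \<Zsemi> ((\<alpha>\<langle>B\<rangle> \<cdot> on1 F f) \<rhd> fpc F A p)"
      by (rule whisk_interchange(1)[OF F.fpc_in[OF p] nf]) (simp add: cell_simps)
    have ll: "on1 G f \<rhd> (\<alpha>\<langle>?X\<rangle> \<rhd> fpc F A p) = (on1 G f \<cdot> \<alpha>\<langle>?X\<rangle>) \<rhd> fpc F A p"
      "\<alpha>\<langle>B\<rangle> \<rhd> (on1 F f \<rhd> fpc F A p) = (\<alpha>\<langle>B\<rangle> \<cdot> on1 F f) \<rhd> fpc F A p"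
      by (rule lwhisk_lwhisk[OF F.fpc_in[OF p]]; use f(2) in simp)+
    have lr: "(on1 G f \<rhd> fpc G A p) \<lhd> \<alpha>\<langle>A\<rangle> = on1 G f \<rhd> (fpc G A p \<lhd> \<alpha>\<langle>A\<rangle>)"
      by (rule lwhisk_rwhisk[OF G.fpc_in[OF p]]; simp)
    have c: "(fcmp G f ?P \<lhd> \<alpha>\<langle>A\<rangle>) \<Zsemi> \<alpha>\<llangle>f \<cdot> ?P\<rrangle> =
          (on1 G f \<rhd> \<alpha>\<llangle>?P\<rrangle>) \<Zsemi> (\<alpha>\<llangle>f\<rrangle> \<lhd> on1 F ?P) \<Zsemi> (\<alpha>\<langle>B\<rangle> \<rhd> fcmp F f ?P)"
      by (rule cnat_comp1[OF pcomp_in[OF p]]) (use f in \<open>simp add: hom1_iff\<close>)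
    have "(fpc G A (f # p) \<lhd> \<alpha>\<langle>A\<rangle>) \<Zsemi> \<alpha>\<llangle>pcomp A (f # p)\<rrangle>
      = (on1 G f \<rhd> (fpc G A p \<lhd> \<alpha>\<langle>A\<rangle>)) \<Zsemi> ((fcmp G f ?P \<lhd> \<alpha>\<langle>A\<rangle>) \<Zsemi> \<alpha>\<llangle>f \<cdot> ?P\<rrangle>)"
      by (simp add: cell_simps as as')
    also have "\<dots> = (on1 G f \<rhd> ((fpc G A p \<lhd> \<alpha>\<langle>A\<rangle>) \<Zsemi> \<alpha>\<llangle>?P\<rrangle>)) \<Zsemi> ((\<alpha>\<llangle>f\<rrangle> \<lhd> on1 F ?P) \<Zsemi> (\<alpha>\<langle>B\<rangle> \<rhd> fcmp F f ?P))"
      unfolding c using f(2) by (simp add: cell_simps as as')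
    also have "\<dots> = (on1 G f \<rhd> (?D p \<Zsemi> (\<alpha>\<langle>?X\<rangle> \<rhd> fpc F A p))) \<Zsemi> ((\<alpha>\<llangle>f\<rrangle> \<lhd> on1 F ?P) \<Zsemi> (\<alpha>\<langle>B\<rangle> \<rhd> fcmp F f ?P))"
      using IH by simp
    also have "\<dots> = (on1 G f \<rhd> ?D p) \<Zsemi> ((((on1 G f \<cdot> \<alpha>\<langle>?X\<rangle>) \<rhd> fpc F A p) \<Zsemi> (\<alpha>\<llangle>f\<rrangle> \<lhd> on1 F ?P)) \<Zsemi> (\<alpha>\<langle>B\<rangle> \<rhd> fcmp F f ?P))"
      using f(2) by (simp add: cell_simps as as' ll)
    also have "\<dots> = (on1 G f \<rhd> ?D p) \<Zsemi> (((\<alpha>\<llangle>f\<rrangle> \<lhd> ?FP) \<Zsemi> ((\<alpha>\<langle>B\<rangle> \<cdot> on1 F f) \<rhd> fpc F A p)) \<Zsemi> (\<alpha>\<langle>B\<rangle> \<rhd> fcmp F f ?P))"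
      unfolding i ..
    also have "\<dots> = ?D (f # p) \<Zsemi> (\<alpha>\<langle>B\<rangle> \<rhd> fpc F A (f # p))"
      unfolding d using f(2) by (simp add: cell_simps as as' ll)
    finally show ?case using w r by simp
  qed
  then show "wt (on0 F A) (on0 G B) (?w p) (cross F G \<alpha> p)" "run (?w p) (cross F G \<alpha> p) = \<alpha>\<langle>B\<rangle> # map (on1 F) p"
    "?D p \<Zsemi> (\<alpha>\<langle>B\<rangle> \<rhd> fpc F A p) = (fpc G A p \<lhd> \<alpha>\<langle>A\<rangle>) \<Zsemi> \<alpha>\<llangle>pcomp A p\<rrangle>"
    by auto
qed

end

section \<open>Naturality\<close>

context pseudonatural
begin

text \<open>This is \<open>cnat_natural\<close> for the cell of \<open>x\<close>, with the squares
  at both composites resolved into strands by \<open>cross_in\<close>. The two sides are compared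
  after adding the constraint at the target path, which is invertible and cancels.\<close>

lemma deq_natural:
  assumes "atom_ok x"
  shows "deq (on0 F (adom x)) (on0 G (acod x)) (map (on1 G) (asrc x) @ [\<alpha>\<langle>adom x\<rangle>])
    ((0, fatom G x) # cross F G \<alpha> (atgt x)) (cross F G \<alpha> (asrc x) @ [(1, fatom F x)])"
proof -
  define A B p q where e: "A = adom x" "B = acod x" "p = asrc x" "q = atgt x"
  have p: "path A B p" and q: "path A B q" using assms by (auto simp: e atom_ok_def)
  have A: "A \<in> Obj C" and B: "B \<in> Obj C" using path_Obj[OF p] by auto
  let ?w = "\<lambda>p. map (on1 G) p @ [\<alpha>\<langle>A\<rangle>]" and ?D = "\<lambda>p. deval (on0 F A) (map (on1 G) p @ [\<alpha>\<langle>A\<rangle>]) (cross F G \<alpha> p)"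
  note P = cross_in[OF p] and Q = cross_in[OF q]
  have aA: "path (on0 F A) (on0 G A) [\<alpha>\<langle>A\<rangle>]" and aB: "path (on0 F B) (on0 G B) [\<alpha>\<langle>B\<rangle>]"
    using A B F.on0_in by auto
  note fG = G.fatom_ok(1)[OF assms] and fF = F.fatom_ok(1)[OF assms]
  have f0: "fits (on0 F A) (on0 G B) (?w p) (0, fatom G x)"
    using fG aA G.on0_in[OF B] by (simp add: fits.simps e)
  have s0: "step (?w p) (0, fatom G x) = ?w q" by (simp add: step.simps e)
  have f1: "fits (on0 F A) (on0 G B) (\<alpha>\<langle>B\<rangle> # map (on1 F) p) (1, fatom F x)"
    using fF aB F.on0_in[OF A] by (simp add: fits.simps e)
  have s1: "step (\<alpha>\<langle>B\<rangle> # map (on1 F) p) (1, fatom F x) = \<alpha>\<langle>B\<rangle> # map (on1 F) q" by (simp add: step.simps e)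
  have pA: "pcomp (on0 F A) [\<alpha>\<langle>A\<rangle>] = \<alpha>\<langle>A\<rangle>" "pcomp (on0 F B) [\<alpha>\<langle>B\<rangle>] = \<alpha>\<langle>B\<rangle>" using A B pcomp_single by simp_all
  have l0: "lay (on0 F A) (?w p) (0, fatom G x) = acell (fatom G x) \<lhd> \<alpha>\<langle>A\<rangle>"
    using layer_left[OF fG] aA pA by (simp add: lay.simps e)
  have l1: "lay (on0 F A) (\<alpha>\<langle>B\<rangle> # map (on1 F) p) (1, fatom F x) = \<alpha>\<langle>B\<rangle> \<rhd> acell (fatom F x)"
    using layer_right[OF fF] aB pA by (simp add: lay.simps e)
  have w1: "wt (on0 F A) (on0 G B) (?w p) ((0, fatom G x) # cross F G \<alpha> q)" using f0 s0 Q by simp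
  have w2: "wt (on0 F A) (on0 G B) (?w p) (cross F G \<alpha> p @ [(1, fatom F x)])" using f1 P s1 fits_path[OF f1] by simp
  have d1: "deval (on0 F A) (?w p) ((0, fatom G x) # cross F G \<alpha> q) = (acell (fatom G x) \<lhd> \<alpha>\<langle>A\<rangle>) \<Zsemi> ?D q"
    using s0 l0 by simp
  have d2: "deval (on0 F A) (?w p) (cross F G \<alpha> p @ [(1, fatom F x)]) = ?D p \<Zsemi> (\<alpha>\<langle>B\<rangle> \<rhd> acell (fatom F x))"
    using deval_snoc[OF P(1)] f1 P l1 by simp
  let ?P = "pcomp A p" and ?Q = "pcomp A q"
  have arr: "?P \<in> Arr C" "Dom C ?P = A" "Cod C ?P = B" "?Q \<in> Arr C" "Dom C ?Q = A" "Cod C ?Q = B"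
    "pcomp (on0 F A) (map (on1 F) p) \<in> Arr C" "Cod C (pcomp (on0 F A) (map (on1 F) p)) = on0 F B"
    "pcomp (on0 F A) (map (on1 F) q) \<in> Arr C" "Cod C (pcomp (on0 F A) (map (on1 F) q)) = on0 F B"
    "pcomp (on0 G A) (map (on1 G) p) \<in> Arr C" "Dom C (pcomp (on0 G A) (map (on1 G) p)) = on0 G A"
    "pcomp (on0 G A) (map (on1 G) q) \<in> Arr C" "Dom C (pcomp (on0 G A) (map (on1 G) q)) = on0 G A"
    using p q F.path_map[OF p] F.path_map[OF q] G.path_map[OF p] G.path_map[OF q] pcomp_Arr pcomp_Dom pcomp_Cod by auto
  have wp: "pcomp (on0 F A) (?w p) = pcomp (on0 G A) (map (on1 G) p) \<cdot> \<alpha>\<langle>A\<rangle>"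
    "pcomp (on0 F A) (?w q) = pcomp (on0 G A) (map (on1 G) q) \<cdot> \<alpha>\<langle>A\<rangle>"
    using pcomp_append[OF G.path_map[OF p] aA] pcomp_append[OF G.path_map[OF q] aA] pA by auto
  have Dp: "?D p \<in> hom2 C (pcomp (on0 G A) (map (on1 G) p) \<cdot> \<alpha>\<langle>A\<rangle>) (\<alpha>\<langle>B\<rangle> \<cdot> pcomp (on0 F A) (map (on1 F) p))"
    and Dq: "?D q \<in> hom2 C (pcomp (on0 G A) (map (on1 G) q) \<cdot> \<alpha>\<langle>A\<rangle>) (\<alpha>\<langle>B\<rangle> \<cdot> pcomp (on0 F A) (map (on1 F) q))"
    using iso2D[OF deval_in[OF P(1)]] iso2D[OF deval_in[OF Q(1)]] P Q wp by auto
  have x: "acell x \<in> hom2 C ?P ?Q" using iso2D[OF atom_ok_hom2[OF assms]] by (simp add: e)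
  have xG: "acell (fatom G x) \<in> hom2 C (pcomp (on0 G A) (map (on1 G) p)) (pcomp (on0 G A) (map (on1 G) q))"
    and xF: "acell (fatom F x) \<in> hom2 C (pcomp (on0 F A) (map (on1 F) p)) (pcomp (on0 F A) (map (on1 F) q))"
    using iso2D[OF atom_ok_hom2[OF fG]] iso2D[OF atom_ok_hom2[OF fF]] by (auto simp: e)
  have np: "\<alpha>\<llangle>?P\<rrangle> \<in> hom2 C (on1 G ?P \<cdot> \<alpha>\<langle>A\<rangle>) (\<alpha>\<langle>B\<rangle> \<cdot> on1 F ?P)" "\<alpha>\<llangle>?Q\<rrangle> \<in> hom2 C (on1 G ?Q \<cdot> \<alpha>\<langle>A\<rangle>) (\<alpha>\<langle>B\<rangle> \<cdot> on1 F ?Q)"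
    using iso2D[OF cnat_iso[OF pcomp_in[OF p]]] iso2D[OF cnat_iso[OF pcomp_in[OF q]]] by auto
  note [simp] = cellD[OF Dp] cellD[OF Dq] cellD[OF xG] cellD[OF xF] cellD[OF np(1)] cellD[OF np(2)] cellD[OF F.on2_in[OF x]]
    cellD[OF G.on2_in[OF x]] cellD[OF F.fpc_in[OF p]] cellD[OF F.fpc_in[OF q]] cellD[OF G.fpc_in[OF p]] cellD[OF G.fpc_in[OF q]] arr A B
  have nat: "(on2 G (acell x) \<lhd> \<alpha>\<langle>A\<rangle>) \<Zsemi> \<alpha>\<llangle>?Q\<rrangle> = \<alpha>\<llangle>?P\<rrangle> \<Zsemi> (\<alpha>\<langle>B\<rangle> \<rhd> on2 F (acell x))"
    by (rule cnat_natural[OF pcomp_in[OF p] x])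
  have sq: "fpc G A p \<Zsemi> on2 G (acell x) = acell (fatom G x) \<Zsemi> fpc G A q"
    "fpc F A p \<Zsemi> on2 F (acell x) = acell (fatom F x) \<Zsemi> fpc F A q"
    using G.fatom_ok(2)[OF assms] F.fatom_ok(2)[OF assms] by (auto simp: e)
  have "((acell (fatom G x) \<lhd> \<alpha>\<langle>A\<rangle>) \<Zsemi> ?D q) \<Zsemi> (\<alpha>\<langle>B\<rangle> \<rhd> fpc F A q)
      = (acell (fatom G x) \<lhd> \<alpha>\<langle>A\<rangle>) \<Zsemi> ((fpc G A q \<lhd> \<alpha>\<langle>A\<rangle>) \<Zsemi> \<alpha>\<llangle>?Q\<rrangle>)"
    using Q(3) by (simp add: cell_simps)
  also have "\<dots> = ((acell (fatom G x) \<Zsemi> fpc G A q) \<lhd> \<alpha>\<langle>A\<rangle>) \<Zsemi> \<alpha>\<llangle>?Q\<rrangle>"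
    by (simp add: cell_simps)
  also have "\<dots> = (fpc G A p \<lhd> \<alpha>\<langle>A\<rangle>) \<Zsemi> ((on2 G (acell x) \<lhd> \<alpha>\<langle>A\<rangle>) \<Zsemi> \<alpha>\<llangle>?Q\<rrangle>)"
    unfolding sq[symmetric] by (simp add: cell_simps)
  also have "\<dots> = ((fpc G A p \<lhd> \<alpha>\<langle>A\<rangle>) \<Zsemi> \<alpha>\<llangle>?P\<rrangle>) \<Zsemi> (\<alpha>\<langle>B\<rangle> \<rhd> on2 F (acell x))"
    unfolding nat by (simp add: cell_simps)
  also have "\<dots> = ?D p \<Zsemi> (\<alpha>\<langle>B\<rangle> \<rhd> (fpc F A p \<Zsemi> on2 F (acell x)))"
    unfolding P(3)[symmetric] by (simp add: cell_simps)
  also have "\<dots> = (?D p \<Zsemi> (\<alpha>\<langle>B\<rangle> \<rhd> acell (fatom F x))) \<Zsemi> (\<alpha>\<langle>B\<rangle> \<rhd> fpc F A q)"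
    unfolding sq by (simp add: cell_simps)
  finally have eq: "((acell (fatom G x) \<lhd> \<alpha>\<langle>A\<rangle>) \<Zsemi> ?D q) \<Zsemi> (\<alpha>\<langle>B\<rangle> \<rhd> fpc F A q)
      = (?D p \<Zsemi> (\<alpha>\<langle>B\<rangle> \<rhd> acell (fatom F x))) \<Zsemi> (\<alpha>\<langle>B\<rangle> \<rhd> fpc F A q)" .
  have "(acell (fatom G x) \<lhd> \<alpha>\<langle>A\<rangle>) \<Zsemi> ?D q = ?D p \<Zsemi> (\<alpha>\<langle>B\<rangle> \<rhd> acell (fatom F x))"
  proof (rule vcomp_cancel_right[OF _ _ _ eq])
    show "\<alpha>\<langle>B\<rangle> \<rhd> fpc F A q \<in> iso2 C (\<alpha>\<langle>B\<rangle> \<cdot> pcomp (on0 F A) (map (on1 F) q)) (\<alpha>\<langle>B\<rangle> \<cdot> on1 F ?Q)"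
      by (rule iso2_lwhisk[OF F.fpc_iso[OF q]]) simp_all
    show "(acell (fatom G x) \<lhd> \<alpha>\<langle>A\<rangle>) \<Zsemi> ?D q
        \<in> hom2 C (pcomp (on0 G A) (map (on1 G) p) \<cdot> \<alpha>\<langle>A\<rangle>) (\<alpha>\<langle>B\<rangle> \<cdot> pcomp (on0 F A) (map (on1 F) q))"
      by (rule vcomp_in[OF rwhisk_in[OF xG] Dq]) simp_all
    show "?D p \<Zsemi> (\<alpha>\<langle>B\<rangle> \<rhd> acell (fatom F x))
        \<in> hom2 C (pcomp (on0 G A) (map (on1 G) p) \<cdot> \<alpha>\<langle>A\<rangle>) (\<alpha>\<langle>B\<rangle> \<cdot> pcomp (on0 F A) (map (on1 F) q))"
      by (rule vcomp_in[OF Dp lwhisk_in[OF xF]]) simp_all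
  qed
  then have "deq (on0 F A) (on0 G B) (?w p) ((0, fatom G x) # cross F G \<alpha> q) (cross F G \<alpha> p @ [(1, fatom F x)])"
    unfolding deq_def using w1 w2 d1 d2 s0 P Q s1 by simp
  then show ?thesis by (simp add: e)
qed

end

section \<open>Modifications as atoms that slide past a strand\<close>

context two_category
begin

text \<open>
  The diagram \<open>xs\<close> moves the strand of the 1-cell \<open>g = G f\<close> from the left of \<open>a\<close> to the right of \<open>a'\<close>,
  where it becomes \<open>h = F f\<close>; it evaluates to the constraint \<open>x\<close> at \<open>f\<close> of a composite transformation.
\<close>

definition crosses :: "'a \<Rightarrow> 'a \<Rightarrow> 'a list \<Rightarrow> 'a list \<Rightarrow> ('o, 'a, 'c) diagram \<Rightarrow> 'c \<Rightarrow> bool" where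
  "crosses g h a a' xs x \<longleftrightarrow> g \<in> Arr C \<and> h \<in> Arr C \<and> wt (Dom C h) (Cod C g) (g # a) xs \<and>
    run (g # a) xs = a' @ [h] \<and> deval (Dom C h) (g # a) xs = x"

lemma crosses_paths:
  assumes "crosses g h a a' xs x"
  shows "path (Dom C h) (Dom C g) a" "path (Cod C h) (Cod C g) a'"
  using assms wt_path[of "Dom C h" "Cod C g" "g # a" xs] by (auto simp: crosses_def path_append)

lemma crosses_Nil: "g \<in> Arr C \<Longrightarrow> crosses g g [] [] [] (Id2 C g)"
  using pcomp_single by (auto simp: crosses_def intro: Dom_in)

lemma crosses_atom:
  assumes "atom_ok x" "asrc x = g # a" "atgt x = a' @ [h]" "g \<in> Arr C" "h \<in> Arr C"
  shows "crosses g h a a' [(0, x)] (acell x)"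
proof -
  have p: "path (adom x) (acod x) (g # a)" "path (adom x) (acod x) (a' @ [h])"
    using assms(1-3) by (auto simp: atom_ok_def)
  then have d: "adom x = Dom C h" "acod x = Cod C g" by (auto simp: path_append)
  show ?thesis
    unfolding crosses_def using wt_atom[OF assms(1)] deval_atom[OF assms(1)] assms d by (simp add: step.simps)
qed

text \<open>The resulting 2-cell has the shape of the constraint in \<open>pn_comp\<close>, so the
  crossing of a composite transformation is assembled from those of its factors.\<close>

lemma crosses_append:
  assumes b: "crosses k g b b' ys y" and a: "crosses g h a a' xs x"
  shows "crosses k h (b @ a) (b' @ a') (ys @ shift (length b') xs) ((y \<lhd> pcomp (Dom C h) a) \<Zsemi> (pcomp (Cod C g) b' \<rhd> x))"
proof -
  note pa = crosses_paths[OF a] and pb = crosses_paths[OF b]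
  have wb: "wt (Dom C g) (Cod C k) (k # b) ys" "run (k # b) ys = b' @ [g]" "deval (Dom C g) (k # b) ys = y"
    and wa: "wt (Dom C h) (Cod C g) (g # a) xs" "run (g # a) xs = a' @ [h]" "deval (Dom C h) (g # a) xs = x"
    and arr: "k \<in> Arr C" "h \<in> Arr C"
    using a b by (auto simp: crosses_def)
  note B = deval_whisk_right[OF wb(1) pa(1)] and A = deval_shift_left[OF wa(1) pb(2)]
  have r: "run (k # b @ a) ys = b' @ g # a" using B(2) wb(2) by simp
  show ?thesis
    unfolding crosses_def using A B r arr wa wb deval_append[of "Dom C h" "Cod C k" "k # b @ a" ys "shift (length b') xs"]
    by simp
qed

text \<open>\<open>eq\<close> has the shape of the modification axiom: \<open>c\<close> applied
  before the strand passes equals \<open>d\<close> applied afterwards.\<close>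

lemma deq_modification:
  assumes D: "crosses g h a a' xs x" and E: "crosses g h b b' ys y"
    and c: "atom_ok c" "asrc c = a" "atgt c = b" "adom c = Dom C h" "acod c = Dom C g"
    and d: "atom_ok d" "asrc d = a'" "atgt d = b'" "adom d = Cod C h" "acod d = Cod C g"
    and eq: "(g \<rhd> acell c) \<Zsemi> y = x \<Zsemi> (acell d \<lhd> h)"
  shows "deq (Dom C h) (Cod C g) (g # a) ((1, c) # ys) (xs @ [(0, d)])"
proof -
  have wd: "wt (Dom C h) (Cod C g) (g # a) xs" "run (g # a) xs = a' @ [h]" "deval (Dom C h) (g # a) xs = x"
    and we: "wt (Dom C h) (Cod C g) (g # b) ys" "run (g # b) ys = b' @ [h]" "deval (Dom C h) (g # b) ys = y"
    and arr: "g \<in> Arr C" "h \<in> Arr C"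
    using D E by (auto simp: crosses_def)
  have ob: "Dom C h \<in> Obj C" "Cod C g \<in> Obj C" "Dom C g \<in> Obj C" "Cod C h \<in> Obj C" using arr Dom_in Cod_in by auto
  have f: "fits (Dom C h) (Cod C g) (g # a) (1, c)" using c arr ob by (simp add: fits.simps)
  have f': "fits (Dom C h) (Cod C g) (a' @ [h]) (0, d)" using d arr ob by (simp add: fits.simps)
  have l: "lay (Dom C h) (g # a) (1, c) = g \<rhd> acell c"
    using layer_right[OF c(1), of "Cod C g" "[g]"] c arr ob pcomp_single[OF arr(1)] by (simp add: lay.simps)
  have l': "lay (Dom C h) (a' @ [h]) (0, d) = acell d \<lhd> h"
    using layer_left[OF d(1), of "Dom C h" "[h]"] d arr ob pcomp_single[OF arr(2)] by (simp add: lay.simps)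
  have s: "step (g # a) (1, c) = g # b" "step (a' @ [h]) (0, d) = b' @ [h]" using c d by (auto simp: step.simps)
  have f'': "fits (Dom C h) (Cod C g) (run (g # a) xs) (0, d)" using f' wd by simp
  show ?thesis
    unfolding deq_def using f f' wd we s l l' eq deval_snoc[OF wd(1) f''] fits_path[OF f'] by simp
qed

text \<open>Interchange first gathers the layers \<open>us\<close> into a block, then the whiskered
  equation replaces them. The path forces the types of the surrounding context when \<open>q\<close>
  is nonempty; an empty \<open>q\<close> has no endpoints of its own, and they must be
  supplied.\<close>

lemma deq_rewrite:
  assumes eq: "deq A' B' q us vs" and w: "wt A B p xs" "wt A B p (pre @ shift k us @ post)"
    and n: "nf xs = nf (pre @ shift k us @ post)" and ys: "ys = pre @ shift k vs @ post"
    and q: "take (length q) (drop k (run p pre)) = q" "k \<le> length (run p pre)"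
      "q \<noteq> [] \<or> (path B' B (take k (run p pre)) \<and> path A A' (drop k (run p pre)))"
  shows "deq A B p xs ys"
proof -
  define l r where lr: "l = take k (run p pre)" "r = drop (length q) (drop k (run p pre))"
  have e: "run p pre = l @ q @ r"
    unfolding lr by (metis q(1) append_take_drop_id)
  have k: "length l = k" using q(2) by (simp add: lr)
  have pq: "path A' B' q" using eq wt_path by (auto simp: deq_def)
  have "path A B (l @ q @ r)" using w(2) wt_path[of A B p pre] e by simp
  then obtain X Y where XY: "path X B l" "path Y X q" "path A Y r" by (auto simp: path_append)
  have "path B' B l \<and> path A A' r"
  proof (cases "q = []")
    case True then show ?thesis using q(3) lr by simp
  next
    case False then show ?thesis using path_unique[OF pq XY(2)] XY by simp
  qed
  then have "deq A B (run p pre) (shift k us) (shift k vs)"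
    using deq_whisk[OF eq] e k by metis
  moreover have "wt A B p pre" "wt A B (run (run p pre) (shift k us)) post" using w(2) by auto
  ultimately have "deq A B p (pre @ shift k us @ post) (pre @ shift k vs @ post)"
    by (intro deq_append[OF deq_refl] deq_append[OF _ deq_refl]) auto
  then show ?thesis
    unfolding ys using deq_interchange[OF w n] deq_trans by blast
qed

lemma deq_inv: "atom_ok a \<Longrightarrow> deq (adom a) (acod a) (asrc a) [(0, a), (0, ainv a)] []"
  using deq_dinv_right[OF wt_atom] by (simp add: dinv_def)

lemma deq_inv': "atom_ok a \<Longrightarrow> deq (adom a) (acod a) (atgt a) [(0, ainv a), (0, a)] []"
  using deq_inv[OF ainv_ok] by simp

end

text \<open>
  Whiskering with \<open>\<upsilon>\<close> and using its naturality turns \<open>w \<cdot> G x\<close> into \<open>w \<cdot> \<upsilon> \<cdot> x\<close>, and \<open>w \<cdot> \<upsilon> \<cong> 1\<close>.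
\<close>

lemma (in two_category) deq_cancel_functor:
  assumes ups: "pseudonatural C (pf_id C) G \<upsilon>"
    and d: "atom_ok d" "asrc d = w @ [\<upsilon>\<langle>Y\<rangle>]" "atgt d = []" "adom d = Y" "acod d = Y"
    and x: "wt X Y p xs" "wt X Y p ys" "run p xs = run p ys"
    and eq: "deq X Y (w @ map (on1 G) p @ [\<upsilon>\<langle>X\<rangle>]) (shift (length w) (fdiag G xs)) (shift (length w) (fdiag G ys))"
  shows "deq X Y p xs ys"
proof -
  interpret U: pseudonatural C "pf_id C" G \<upsilon> by fact
  let ?k = "length w" and ?x = "box X Y p xs" and ?y = "box X Y p ys"
  let ?Gp = "map (on1 G) p" and ?c = "\<lambda>p. cross (pf_id C) G \<upsilon> p"
  have p: "path X Y p" using wt_path[OF x(1)] by blast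
  have X: "X \<in> Obj C" "Y \<in> Obj C" using path_Obj[OF p] by auto
  note ok = box_ok[OF x(1)] box_ok[OF x(2)]
  have pw: "path (on0 G Y) Y w"
    using d X by (auto simp: atom_ok_def path_append)
  have pu: "path X (on0 G X) [\<upsilon>\<langle>X\<rangle>]" "path Y (on0 G Y) [\<upsilon>\<langle>Y\<rangle>]" using X by auto
  \<comment> \<open>Naturality of \<upsilon> for the diagram \<open>zs\<close> as a whole, boxed
    into a single 2-cell.\<close>
  have slide: "deq X Y (w @ ?Gp @ [\<upsilon>\<langle>X\<rangle>]) (shift ?k (fdiag G zs) @ shift ?k (?c (run p zs)))
      (shift ?k (?c p) @ [(?k + 1, box X Y p zs)])" if zs: "wt X Y p zs" for zs
  proof -
    let ?z = "box X Y p zs"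
    note okz = box_ok[OF zs]
    note N = U.deq_natural[OF okz, simplified fatom_pf_id[OF okz] box_simps pf_id_simps]
    note cz = U.cross_in[of X Y "run p zs"] 
    have "deq (on0 G X) (on0 G Y) ?Gp [(0, fatom G ?z)] (fdiag G zs)"
      using U.G.deq_fdiag[OF deq_box[OF zs]] by simp
    from deq_whisk_right[OF this pu(1)]
    have 1: "deq X (on0 G Y) (?Gp @ [\<upsilon>\<langle>X\<rangle>]) [(0, fatom G ?z)] (fdiag G zs)" .
    have r: "run (?Gp @ [\<upsilon>\<langle>X\<rangle>]) [(0, fatom G ?z)] = map (on1 G) (run p zs) @ [\<upsilon>\<langle>X\<rangle>]" by (simp add: step.simps)
    have "deq X (on0 G Y) (?Gp @ [\<upsilon>\<langle>X\<rangle>]) ([(0, fatom G ?z)] @ ?c (run p zs)) (fdiag G zs @ ?c (run p zs))"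
      by (rule deq_append[OF 1]) (unfold r, use cz wt_path[OF zs] in \<open>simp add: deq_refl\<close>)
    from deq_trans[OF deq_sym[OF this]] N
    have "deq X (on0 G Y) (?Gp @ [\<upsilon>\<langle>X\<rangle>]) (fdiag G zs @ ?c (run p zs)) (?c p @ [(1, ?z)])" by simp
    from deq_whisk_left[OF this pw] show ?thesis by simp
  qed
  have rr: "run (w @ ?Gp @ [\<upsilon>\<langle>X\<rangle>]) (shift ?k (fdiag G ys)) = w @ map (on1 G) (run p ys) @ [\<upsilon>\<langle>X\<rangle>]"
  proof -
    note f = U.G.fdiag_in[OF x(2)]
    from shift_in[OF f(1) pu(1) pw] f(2) show ?thesis by simp
  qed
  have cy: "wt X Y (w @ map (on1 G) (run p ys) @ [\<upsilon>\<langle>X\<rangle>]) (shift ?k (?c (run p ys)))"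
    using deval_shift_left(1)[OF U.cross_in(1)[of X Y "run p ys"]] pw wt_path[OF x(2)] by simp
  have "deq X Y (w @ ?Gp @ [\<upsilon>\<langle>X\<rangle>]) (shift ?k (fdiag G xs) @ shift ?k (?c (run p xs)))
      (shift ?k (fdiag G ys) @ shift ?k (?c (run p ys)))"
    unfolding x(3) using eq cy rr by (intro deq_append[OF eq] deq_refl) (simp add: deq_def)
  from deq_trans[OF deq_trans[OF deq_sym[OF slide[OF x(1)]] this] slide[OF x(2)]]
  have "deq X Y (w @ ?Gp @ [\<upsilon>\<langle>X\<rangle>]) (shift ?k (?c p) @ [(?k + 1, ?x)]) (shift ?k (?c p) @ [(?k + 1, ?y)])" .
  from deq_cancel_left[OF this]
  have 2: "deq X Y ((w @ [\<upsilon>\<langle>Y\<rangle>]) @ p) [(?k + 1, ?x)] [(?k + 1, ?y)]"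
    using deval_shift_left(2)[OF U.cross_in(1)[OF p] pw[simplified]] U.cross_in(2)[OF p] by simp
  have rz: "run ((w @ [\<upsilon>\<langle>Y\<rangle>]) @ p) [(?k + 1, box X Y p zs)] = (w @ [\<upsilon>\<langle>Y\<rangle>]) @ run p zs" for zs
    by (simp add: step.simps)
  have wd: "wt X Y ((w @ [\<upsilon>\<langle>Y\<rangle>]) @ q) [(0, d)]" "run ((w @ [\<upsilon>\<langle>Y\<rangle>]) @ q) [(0, d)] = q" if "path X Y q" for q
    using that d X by (auto simp: fits.simps step.simps)
  have ry: "path X Y (run p ys)" using wt_path[OF x(2)] by blast
  have 3: "deq X Y ((w @ [\<upsilon>\<langle>Y\<rangle>]) @ p) ([(?k + 1, ?x)] @ [(0, d)]) ([(?k + 1, ?y)] @ [(0, d)])"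
    by (rule deq_append[OF 2 deq_refl]) (unfold rz x(3), rule wd(1)[OF ry])
  \<comment> \<open>\<open>d\<close> consumes exactly the strands to the left of \<open>p\<close>,
    so it may act before the boxed diagram; as a common first layer it then cancels.\<close>
  have sw: "deq X Y ((w @ [\<upsilon>\<langle>Y\<rangle>]) @ p) ([(?k + 1, box X Y p zs)] @ [(0, d)]) ([(0, d)] @ [(0, box X Y p zs)])"
    if "wt X Y ((w @ [\<upsilon>\<langle>Y\<rangle>]) @ p) ([(?k + 1, box X Y p zs)] @ [(0, d)])" for zs
    using deq_swap[of X Y "(w @ [\<upsilon>\<langle>Y\<rangle>]) @ p" "?k + 1" "box X Y p zs" 0 d "[]"] that d by simp
  have "deq X Y ((w @ [\<upsilon>\<langle>Y\<rangle>]) @ p) ([(0, d)] @ [(0, ?x)]) ([(0, d)] @ [(0, ?y)])"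
    by (rule deq_trans[OF deq_sym[OF sw] deq_trans[OF 3 sw]]; use 3 in \<open>unfold deq_def, blast\<close>)
  from deq_cancel_left[OF this] wd(2)[OF p] have "deq X Y p [(0, ?x)] [(0, ?y)]" by simp
  then show ?thesis using deq_box[OF x(1)] deq_box[OF x(2)] deq_trans deq_sym by blast
qed

section \<open>Pseudomonads\<close>

context two_category
begin

declare pcomp.simps(2) [simp del] fpc.simps(2) [simp del]

text \<open>These replace the recursion clause, under which a one-element path would be
  \<open>f\<close> composed with an identity. Evaluated paths then look like the 1-cells in the
  axioms.\<close>

lemma pcomp_simps [simp]:
  "\<lbrakk>f \<in> Arr C; Dom C f = A\<rbrakk> \<Longrightarrow> pcomp A [f] = f"
  "pcomp A (f # g # p) = f \<cdot> pcomp A (g # p)"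
  by (simp add: pcomp_single) (simp add: pcomp.simps(2))

declare step.simps [simp] fits.simps [simp]

text \<open>The chains in the axioms are bracketed to the left, whereas \<open>deval\<close>
  brackets to the right and ends in an identity. With an accumulator the value comes out in the form
  in which the axioms are stated.\<close>

primrec evl :: "'o \<Rightarrow> 'c \<Rightarrow> 'a list \<Rightarrow> ('o, 'a, 'c) diagram \<Rightarrow> 'c" where
  "evl A c p [] = c"
| "evl A c p (d # ds) = evl A (c \<Zsemi> lay A p d) (step p d) ds"

lemma deval_evl: "wt A B p (d # ds) \<Longrightarrow> deval A p (d # ds) = evl A (lay A p d) (step p d) ds"
proof -
  have *: "evl A c p ds = c \<Zsemi> deval A p ds" if "wt A B p ds" "c \<in> hom2 C f (pcomp A p)" for c f p ds
    using that
  proof (induction ds arbitrary: c p)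
    case Nil then show ?case using vcomp_Id2_right by simp
  next
    case (Cons d ds)
    have f: "fits A B p d" "wt A B (step p d) ds" using Cons.prems by auto
    note l = iso2D[OF lay_in[OF f(1)]]
    show ?case
      using Cons.IH[OF f(2) vcomp_in[OF Cons.prems(2) l]]
        vcomp_assoc[OF Cons.prems(2) l iso2D[OF deval_in[OF f(2)]]] by simp
  qed
  assume w: "wt A B p (d # ds)"
  then have f: "fits A B p d" "wt A B (step p d) ds" by auto
  show ?thesis using *[OF f(2) iso2D[OF lay_in[OF f(1)]]] by simp
qed

lemma deq_evl:
  assumes "wt A B p (d # ds)" "wt A B p (e # es)" "run p (d # ds) = run p (e # es)"
    "evl A (lay A p d) (step p d) ds = evl A (lay A p e) (step p e) es"
  shows "deq A B p (d # ds) (e # es)"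
  using assms(3,4) unfolding deq_def deval_evl[OF assms(1)] deval_evl[OF assms(2)]
  using assms(1,2) by blast

text \<open>Empty contexts must leave no whiskering by an identity behind, as the axioms contain
  none.\<close>

lemma lay_simps:
  "\<lbrakk>atom_ok a; adom a = A\<rbrakk> \<Longrightarrow> layer A [] a [] = acell a"
  "\<lbrakk>atom_ok a; path A (adom a) (f # r)\<rbrakk> \<Longrightarrow> layer A [] a (f # r) = acell a \<lhd> pcomp A (f # r)"
  "\<lbrakk>atom_ok a; adom a = A; path (acod a) (Cod C g) (g # l)\<rbrakk> \<Longrightarrow>
    layer A (g # l) a [] = pcomp (acod a) (g # l) \<rhd> acell a"
  "layer A (g # l) a (f # r) = pcomp (acod a) (g # l) \<rhd> acell a \<lhd> pcomp A (f # r)"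
  "lay A p (n, a) = layer A (take n p) a (drop (n + length (asrc a)) p)"
  using layer_both layer_left layer_right by (auto simp: layer_def lay.simps)

end

context pseudofunctor
begin

text \<open>The right unit law removes \<open>funt\<close> from the innermost 1-cell. What is left
  on two and three 1-cells is \<open>fcmp\<close> and \<open>fcmp3\<close>, the constraints that
  occur in the axioms.\<close>

lemma fpc_simps [simp]:
  "f \<in> Arr C \<Longrightarrow> Dom C f = A \<Longrightarrow> fpc F A [f] = Id2 C (on1 F f)"
  "\<lbrakk>g \<in> Arr C; f \<in> Arr C; Cod C f = Dom C g; Dom C f = A\<rbrakk> \<Longrightarrow> fpc F A [g, f] = fcmp F g f"
  "\<lbrakk>h \<in> Arr C; g \<in> Arr C; f \<in> Arr C; Cod C g = Dom C h; Cod C f = Dom C g; Dom C f = A\<rbrakk>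
    \<Longrightarrow> fpc F A [h, g, f] = fcmp3 C F h g f"
proof -
  show 1: "fpc F A [f] = Id2 C (on1 F f)" if "f \<in> Arr C" "Dom C f = A" for f A
    using fcmp_unit_right[of f A "Cod C f"] that by (simp add: hom1_iff fpc.simps(2))
  show 2: "fpc F A [g, f] = fcmp F g f" if "g \<in> Arr C" "f \<in> Arr C" "Cod C f = Dom C g" "Dom C f = A" for g f A
    using 1[of f A] that lwhisk_Id2[of "on1 F f" "on1 F g"] vcomp_Id2_left[OF iso2D[OF fcmp_iso_Arr[of f g]]]
    by (simp add: fpc.simps(2)[of _ _ _ "[_]"])
  show "fpc F A [h, g, f] = fcmp3 C F h g f"
    if "h \<in> Arr C" "g \<in> Arr C" "f \<in> Arr C" "Cod C g = Dom C h" "Cod C f = Dom C g" "Dom C f = A"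
    using 2[of g f A] that by (simp add: fpc.simps(2)[of _ _ _ "_ # [_]"] fcmp3_def)
qed

text \<open>On a one-element path the constraint is an identity and disappears. The case distinction
  yields the formulas of the axioms, where \<open>funt\<close> stays at an empty path.\<close>

lemma acell_fatom:
  assumes "atom_ok a"
  shows "acell (fatom F a) =
    (let x = if length (asrc a) = 1 then on2 F (acell a) else fpc F (adom a) (asrc a) \<Zsemi> on2 F (acell a)
     in if length (atgt a) = 1 then x else x \<Zsemi> vinv (fpc F (adom a) (atgt a)))"
proof -
  have s: "path (adom a) (acod a) (asrc a)" "path (adom a) (acod a) (atgt a)" using assms by (auto simp: atom_ok_def)
  note x = on2_in[OF iso2D[OF atom_ok_hom2[OF assms]]]
  note y = vcomp_in[OF fpc_in[OF s(1)] x]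
  have 1: "fpc F (adom a) (asrc a) \<Zsemi> on2 F (acell a) = on2 F (acell a)" if len: "length (asrc a) = 1"
  proof -
    obtain f where f: "asrc a = [f]" using len by (cases "asrc a") auto
    then show ?thesis using s(1) vcomp_Id2_left[OF x] by simp
  qed
  have i: "vinv (Id2 C f) = Id2 C f" if "f \<in> Arr C" for f
    using vinv_unique[OF Id2_in Id2_in] vcomp_Id2_left[OF Id2_in] that by simp
  have 2: "(fpc F (adom a) (asrc a) \<Zsemi> on2 F (acell a)) \<Zsemi> vinv (fpc F (adom a) (atgt a)) = fpc F (adom a) (asrc a) \<Zsemi> on2 F (acell a)"
    if len: "length (atgt a) = 1"
  proof -
    obtain f where f: "atgt a = [f]" using len by (cases "atgt a") auto
    then show ?thesis using s(2) vcomp_Id2_right[OF y] i by simp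
  qed
  show ?thesis using 1 2 by (simp add: fatom_def Let_def del: One_nat_def)
qed

end

text \<open>The constraint in \<open>pn_lwhisk\<close> is the image of a naturality square
  conjugated by \<open>fcmp\<close>, which is what \<open>fatom\<close> does to that square.\<close>

lemma (in two_category) crosses_lwhisk:
  assumes "pseudonatural C F G \<alpha>" "pseudofunctor C H" "f \<in> Arr C"
  shows "crosses (on1 H (on1 G f)) (on1 H (on1 F f)) [on1 H (\<alpha>\<langle>Dom C f\<rangle>)] [on1 H (\<alpha>\<langle>Cod C f\<rangle>)]
    [(0, fatom H (natom F G \<alpha> f))] (pn_lwhisk C H F G \<alpha>)\<llangle>f\<rrangle>"
proof -
  interpret N: pseudonatural C F G \<alpha> by fact
  interpret H: pseudofunctor C H by fact
  have ob: "Dom C f \<in> Obj C" "Cod C f \<in> Obj C" using assms(3) Dom_in Cod_in by auto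
  have "acell (fatom H (natom F G \<alpha> f)) = (pn_lwhisk C H F G \<alpha>)\<llangle>f\<rrangle>"
    using H.acell_fatom[OF N.natom_ok[OF assms(3)]] assms(3) ob by (simp add: pn_lwhisk_def)
  then show ?thesis
    using crosses_atom[OF H.fatom_ok(1)[OF N.natom_ok[OF assms(3)]]] assms(3) by simp
qed

lemma (in pseudonatural) crosses_natom:
  assumes "f \<in> Arr C"
  shows "crosses (on1 G f) (on1 F f) [\<alpha>\<langle>Dom C f\<rangle>] [\<alpha>\<langle>Cod C f\<rangle>] [(0, natom F G \<alpha> f)] \<alpha>\<llangle>f\<rrangle>"
  using crosses_atom[OF natom_ok[OF assms]] assms by simp

context pseudomonad
begin

sublocale F: pseudofunctor C T by (rule pseudofunctor)
sublocale u: pseudonatural C "pf_id C" T u by (rule unit_pseudonatural)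
sublocale m: pseudonatural C "T \<bullet> T" T m by (rule mult_pseudonatural)

text \<open>
  \<open>nu f\<close> and \<open>nm f\<close> are the naturality squares of \<open>u\<close> and \<open>m\<close> at \<open>f\<close>; \<open>la\<close>, \<open>ra\<close>, \<open>aa\<close> are the atoms of
  \<open>m \<cdot> uT \<cong> 1\<close>, \<open>m \<cdot> Tu \<cong> 1\<close>, \<open>m \<cdot> Tm \<cong> m \<cdot> mT\<close>.
\<close>

abbreviation "nu \<equiv> natom (pf_id C) T u"
abbreviation "nm \<equiv> natom (T \<bullet> T) T m"

definition "la A = Atom (on0 T A) (on0 T A) [m\<langle>A\<rangle>, u\<langle>on0 T A\<rangle>] [] (lunit M A)"
definition "ra A = Atom (on0 T A) (on0 T A) [m\<langle>A\<rangle>, on1 T (u\<langle>A\<rangle>)] [] (runit M A)"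
definition "aa A = Atom (on0 T (on0 T (on0 T A))) (on0 T A) [m\<langle>A\<rangle>, on1 T (m\<langle>A\<rangle>)] [m\<langle>A\<rangle>, m\<langle>on0 T A\<rangle>] (massoc M A)"

lemma la_simps [simp]:
  "adom (la A) = on0 T A" "acod (la A) = on0 T A" "asrc (la A) = [m\<langle>A\<rangle>, u\<langle>on0 T A\<rangle>]" "atgt (la A) = []"
  "acell (la A) = lunit M A"
  by (simp_all add: la_def)

lemma ra_simps [simp]:
  "adom (ra A) = on0 T A" "acod (ra A) = on0 T A" "asrc (ra A) = [m\<langle>A\<rangle>, on1 T (u\<langle>A\<rangle>)]" "atgt (ra A) = []"
  "acell (ra A) = runit M A"
  by (simp_all add: ra_def)

lemma aa_simps [simp]:
  "adom (aa A) = on0 T (on0 T (on0 T A))" "acod (aa A) = on0 T A" "asrc (aa A) = [m\<langle>A\<rangle>, on1 T (m\<langle>A\<rangle>)]"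
  "atgt (aa A) = [m\<langle>A\<rangle>, m\<langle>on0 T A\<rangle>]" "acell (aa A) = massoc M A"
  by (simp_all add: aa_def)

declare F.on0_in [simp]

lemma ok_simps [simp]:
  assumes "A \<in> Obj C"
  shows "atom_ok (la A)" "atom_ok (ra A)" "atom_ok (aa A)"
  using lunit_modification runit_modification massoc_modification assms
  by (auto simp: atom_ok_def inv_modification_def pn_comp_def pn_rwhisk_def pn_lwhisk_def pn_id_def)

text \<open>The modification axiom of \<open>runit\<close>. Its target is the identity
  transformation, whose crossing has no layers; hence only one side contains squares.\<close>

lemma r_natural:
  assumes "f \<in> Arr C"
  shows "deq (on0 T (Dom C f)) (on0 T (Cod C f)) [on1 T f, m\<langle>Dom C f\<rangle>, on1 T (u\<langle>Dom C f\<rangle>)]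
    [(1, ra (Dom C f))] [(0, nm f), (1, fatom T (nu f)), (0, ra (Cod C f))]"
proof -
  have ob: "Dom C f \<in> Obj C" "Cod C f \<in> Obj C" using assms Dom_in Cod_in by auto
  note c1 = m.crosses_natom[OF assms] and c2 = crosses_lwhisk[OF unit_pseudonatural pseudofunctor assms]
  have "(on1 T f \<rhd> runit M (Dom C f)) \<Zsemi> Id2 C (on1 T f) =
    (m \<odot> pn_lwhisk C T (pf_id C) T u)\<llangle>f\<rrangle> \<Zsemi> (runit M (Cod C f) \<lhd> on1 T f)"
    using runit_modification assms by (auto simp: inv_modification_def pn_id_def hom1_iff)
  moreover have "(m \<odot> pn_lwhisk C T (pf_id C) T u)\<llangle>f\<rrangle> = 
    (m\<llangle>f\<rrangle> \<lhd> pcomp (Dom C (on1 T f)) [on1 T (u\<langle>Dom C f\<rangle>)]) \<Zsemi>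
    (pcomp (Cod C (on1 (T \<bullet> T) f)) [m\<langle>Cod C f\<rangle>] \<rhd> (pn_lwhisk C T (pf_id C) T u)\<llangle>f\<rrangle>)"
    using assms ob by (simp add: pn_comp_def pn_lwhisk_def)
  ultimately show ?thesis
    using deq_modification[OF crosses_append[OF c1, simplified pf_comp_simps pf_id_simps, OF c2[simplified pf_id_simps]] crosses_Nil[of "on1 T f"], of "ra (Dom C f)" "ra (Cod C f)"]
      assms ob by simp
qed

text \<open>A unit inserted in the middle can be absorbed on either side. All derivations of unit
  conditions from associativity conditions below start from this exchange.\<close>

lemma deq_triangle:
  assumes "A \<in> Obj C"
  shows "deq (on0 T (on0 T A)) (on0 T A) [m\<langle>A\<rangle>, on1 T (m\<langle>A\<rangle>), on1 T (u\<langle>on0 T A\<rangle>)]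
    [(0, aa A), (1, ra (on0 T A))] [(1, fatom T (la A))]"
  by (rule deq_evl, simp add: assms F.fatom_ok(1), simp add: assms F.fatom_ok(1), simp)
    (use triangle[OF assms] assms in \<open>simp add: lay_simps F.fatom_ok(1) F.acell_fatom\<close>)

end

section \<open>Pseudodistributive laws\<close>

locale pseudodist_calculus = two_category C + pseudodistributive_law C MT MP L
  for C :: "('o, 'a, 'c, 'z) two_cat_scheme" (structure) and MT MP L
begin

sublocale law: pseudonatural C "T \<bullet> P" "P \<bullet> T" \<Lambda> by (rule law_pseudonatural)

abbreviation "FT \<equiv> fatom T"
abbreviation "FP \<equiv> fatom P"
abbreviation "nl \<equiv> natom (T \<bullet> P) (P \<bullet> T) \<Lambda>"

definition "w1 A = Atom (P\<^sub>0 A) (P\<^sub>0 (T\<^sub>0 A)) [P\<^sub>1 (u\<langle>A\<rangle>)] [\<Lambda>\<langle>A\<rangle>, u\<langle>P\<^sub>0 A\<rangle>] (\<omega>\<^sub>1 A)"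
definition "w2 A = Atom (T\<^sub>0 A) (P\<^sub>0 (T\<^sub>0 A)) [\<Lambda>\<langle>A\<rangle>, T\<^sub>1 (\<eta>\<langle>A\<rangle>)] [\<eta>\<langle>T\<^sub>0 A\<rangle>] (\<omega>\<^sub>2 A)"
definition "w3 A = Atom (T\<^sub>0 (T\<^sub>0 (P\<^sub>0 A))) (P\<^sub>0 (T\<^sub>0 A))
  [P\<^sub>1 (m\<langle>A\<rangle>), \<Lambda>\<langle>T\<^sub>0 A\<rangle>, T\<^sub>1 (\<Lambda>\<langle>A\<rangle>)] [\<Lambda>\<langle>A\<rangle>, m\<langle>P\<^sub>0 A\<rangle>] (\<omega>\<^sub>3 A)"
definition "w4 A = Atom (T\<^sub>0 (P\<^sub>0 (P\<^sub>0 A))) (P\<^sub>0 (T\<^sub>0 A))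
  [\<Lambda>\<langle>A\<rangle>, T\<^sub>1 (\<mu>\<langle>A\<rangle>)] [\<mu>\<langle>T\<^sub>0 A\<rangle>, P\<^sub>1 (\<Lambda>\<langle>A\<rangle>), \<Lambda>\<langle>P\<^sub>0 A\<rangle>] (\<omega>\<^sub>4 A)"

lemma w_simps [simp]:
  "adom (w1 A) = P\<^sub>0 A" "acod (w1 A) = P\<^sub>0 (T\<^sub>0 A)" "asrc (w1 A) = [P\<^sub>1 (u\<langle>A\<rangle>)]"
  "atgt (w1 A) = [\<Lambda>\<langle>A\<rangle>, u\<langle>P\<^sub>0 A\<rangle>]" "acell (w1 A) = \<omega>\<^sub>1 A"
  "adom (w2 A) = T\<^sub>0 A" "acod (w2 A) = P\<^sub>0 (T\<^sub>0 A)" "asrc (w2 A) = [\<Lambda>\<langle>A\<rangle>, T\<^sub>1 (\<eta>\<langle>A\<rangle>)]"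
  "atgt (w2 A) = [\<eta>\<langle>T\<^sub>0 A\<rangle>]" "acell (w2 A) = \<omega>\<^sub>2 A"
  "adom (w3 A) = T\<^sub>0 (T\<^sub>0 (P\<^sub>0 A))" "acod (w3 A) = P\<^sub>0 (T\<^sub>0 A)"
  "asrc (w3 A) = [P\<^sub>1 (m\<langle>A\<rangle>), \<Lambda>\<langle>T\<^sub>0 A\<rangle>, T\<^sub>1 (\<Lambda>\<langle>A\<rangle>)]"
  "atgt (w3 A) = [\<Lambda>\<langle>A\<rangle>, m\<langle>P\<^sub>0 A\<rangle>]" "acell (w3 A) = \<omega>\<^sub>3 A"
  "adom (w4 A) = T\<^sub>0 (P\<^sub>0 (P\<^sub>0 A))" "acod (w4 A) = P\<^sub>0 (T\<^sub>0 A)"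
  "asrc (w4 A) = [\<Lambda>\<langle>A\<rangle>, T\<^sub>1 (\<mu>\<langle>A\<rangle>)]"
  "atgt (w4 A) = [\<mu>\<langle>T\<^sub>0 A\<rangle>, P\<^sub>1 (\<Lambda>\<langle>A\<rangle>), \<Lambda>\<langle>P\<^sub>0 A\<rangle>]" "acell (w4 A) = \<omega>\<^sub>4 A"
  by (simp_all add: w1_def w2_def w3_def w4_def)

lemma w_ok [simp]:
  assumes "A \<in> Obj C"
  shows "atom_ok (w1 A)" "atom_ok (w2 A)" "atom_ok (w3 A)" "atom_ok (w4 A)"
  using omega1_modification omega2_modification omega3_modification omega4_modification assms
  by (auto simp: atom_ok_def inv_modification_def pn_comp_def pn_rwhisk_def pn_lwhisk_def)

text \<open>As rewrite rules these turn every atom into iterated \<open>FT\<close> and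
  \<open>FP\<close> with the inverse innermost, so that equal layers become syntactically
  equal.\<close>

lemma F_ok [simp]:
  assumes "atom_ok a"
  shows "atom_ok (FT a)" "ainv (FT a) = FT (ainv a)" "atom_ok (FP a)" "ainv (FP a) = FP (ainv a)"
    "fatom (T \<bullet> P) a = FT (FP a)" "fatom (P \<bullet> T) a = FP (FT a)"
    "fatom (T \<bullet> T) a = FT (FT a)" "fatom (P \<bullet> P) a = FP (FP a)"
  using MT.F.fatom_ok[OF assms] MP.F.fatom_ok[OF assms] fatom_comp[OF _ _ assms]
    MT.pseudofunctor MP.pseudofunctor by auto

section \<open>The axioms of the law as equations of diagrams\<close>

lemmas cell_eqs = lay_simps MT.F.acell_fatom MP.F.acell_fatom

text \<open>There is one layer for each factor of the axiom; the constraints \<open>funt\<close> and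
  \<open>fcmp\<close> written out there are the conjugations inside \<open>FP\<close> and
  \<open>FT\<close>.\<close>

lemma W1_deq:
  assumes [simp]: "A \<in> Obj C"
  shows "deq (T\<^sub>0 (P\<^sub>0 A)) (P\<^sub>0 (T\<^sub>0 A)) [\<Lambda>\<langle>A\<rangle>]
    [(0, FP (ainv (MT.ra A))), (1, nl (u\<langle>A\<rangle>)), (2, FT (w1 A)), (0, w3 A), (1, MT.ra (P\<^sub>0 A))] []"
    (is "deq ?X ?Y ?p ?xs _")
proof -
  have w: "wt ?X ?Y ?p ?xs" by simp
  show ?thesis
    unfolding deq_def using w deval_evl[OF w] bspec[OF W1[unfolded W1_def], of A]
    by (simp add: cell_eqs)
qed

lemma W2_deq:
  assumes [simp]: "A \<in> Obj C"
  shows "deq (T\<^sub>0 (P\<^sub>0 A)) (P\<^sub>0 (T\<^sub>0 A)) [\<Lambda>\<langle>A\<rangle>]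
    [(1, FT (ainv (MP.la A))), (0, w4 A), (2, w2 (P\<^sub>0 A)), (1, MP.nu (\<Lambda>\<langle>A\<rangle>)), (0, MP.la (T\<^sub>0 A))] []"
    (is "deq ?X ?Y ?p ?xs _")
proof -
  have w: "wt ?X ?Y ?p ?xs" by simp
  show ?thesis
    unfolding deq_def using w deval_evl[OF w] bspec[OF W2[unfolded W2_def], of A]
    by (simp add: cell_eqs)
qed

lemma W3_deq:
  assumes [simp]: "A \<in> Obj C"
  shows "deq (T\<^sub>0 (T\<^sub>0 (T\<^sub>0 (P\<^sub>0 A)))) (P\<^sub>0 (T\<^sub>0 A))
      [P\<^sub>1 (m\<langle>A\<rangle>), P\<^sub>1 (T\<^sub>1 (m\<langle>A\<rangle>)), \<Lambda>\<langle>T\<^sub>0 (T\<^sub>0 A)\<rangle>, T\<^sub>1 (\<Lambda>\<langle>T\<^sub>0 A\<rangle>), T\<^sub>1 (T\<^sub>1 (\<Lambda>\<langle>A\<rangle>))]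
    [(1, nl (m\<langle>A\<rangle>)), (2, FT (w3 A)), (0, w3 A), (1, MT.aa (P\<^sub>0 A))]
    [(0, FP (MT.aa A)), (1, w3 (T\<^sub>0 A)), (2, ainv (MT.nm (\<Lambda>\<langle>A\<rangle>))), (0, w3 A)]"
  by (rule deq_evl, simp, simp, simp) (use bspec[OF W3[unfolded W3_def], of A] in \<open>simp add: cell_eqs\<close>)

lemma W4_deq:
  assumes [simp]: "A \<in> Obj C"
  shows "deq (T\<^sub>0 (P\<^sub>0 (P\<^sub>0 (P\<^sub>0 A)))) (P\<^sub>0 (T\<^sub>0 A)) [\<Lambda>\<langle>A\<rangle>, T\<^sub>1 (\<mu>\<langle>A\<rangle>), T\<^sub>1 (P\<^sub>1 (\<mu>\<langle>A\<rangle>))]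
    [(1, FT (MP.aa A)), (0, w4 A), (2, w4 (P\<^sub>0 A)), (1, MP.nm (\<Lambda>\<langle>A\<rangle>))]
    [(0, w4 A), (2, ainv (nl (\<mu>\<langle>A\<rangle>))), (1, FP (w4 A)), (0, MP.aa (T\<^sub>0 A))]"
  by (rule deq_evl, simp, simp, simp) (use bspec[OF W4[unfolded W4_def], of A] in \<open>simp add: cell_eqs\<close>)

lemma W5_deq:
  assumes [simp]: "A \<in> Obj C"
  shows "deq (T\<^sub>0 (T\<^sub>0 (P\<^sub>0 (P\<^sub>0 A)))) (P\<^sub>0 (T\<^sub>0 A)) [P\<^sub>1 (m\<langle>A\<rangle>), \<Lambda>\<langle>T\<^sub>0 A\<rangle>, T\<^sub>1 (\<Lambda>\<langle>A\<rangle>), T\<^sub>1 (T\<^sub>1 (\<mu>\<langle>A\<rangle>))]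
    [(2, FT (w4 A)), (1, w4 (T\<^sub>0 A)), (0, MP.nm (m\<langle>A\<rangle>)), (3, ainv (nl (\<Lambda>\<langle>A\<rangle>))), (1, FP (w3 A)), (2, w3 (P\<^sub>0 A))]
    [(0, w3 A), (1, ainv (MT.nm (\<mu>\<langle>A\<rangle>))), (0, w4 A)]"
  by (rule deq_evl, simp, simp, simp) (use bspec[OF W5[unfolded W5_def], of A] in \<open>simp add: cell_eqs\<close>)

section \<open>The modification axioms of the law as equations of diagrams\<close>

lemma w2_natural:
  assumes f: "f \<in> Arr C"
  shows "deq (T\<^sub>0 (Dom C f)) (P\<^sub>0 (T\<^sub>0 (Cod C f)))
      [P\<^sub>1 (T\<^sub>1 f), \<Lambda>\<langle>Dom C f\<rangle>, T\<^sub>1 (\<eta>\<langle>Dom C f\<rangle>)]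
    [(1, w2 (Dom C f)), (0, MP.nu (T\<^sub>1 f))] [(0, nl f), (1, FT (MP.nu f)), (0, w2 (Cod C f))]"
proof -
  have [simp]: "Dom C f \<in> Obj C" "Cod C f \<in> Obj C" using f Dom_in Cod_in by auto
  have a: "crosses (P\<^sub>1 (T\<^sub>1 f)) (T\<^sub>1 f) [\<Lambda>\<langle>Dom C f\<rangle>, T\<^sub>1 (\<eta>\<langle>Dom C f\<rangle>)] [\<Lambda>\<langle>Cod C f\<rangle>, T\<^sub>1 (\<eta>\<langle>Cod C f\<rangle>)]
      [(0, nl f), (1, FT (MP.nu f))] (\<Lambda> \<odot> pn_lwhisk C T (pf_id C) P \<eta>)\<llangle>f\<rrangle>"
    using crosses_append[OF law.crosses_natom[OF f, simplified]
        crosses_lwhisk[OF MP.unit_pseudonatural MT.pseudofunctor f, simplified]] f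
    by (simp add: pn_comp_def pn_lwhisk_def)
  have b: "crosses (P\<^sub>1 (T\<^sub>1 f)) (T\<^sub>1 f) [\<eta>\<langle>T\<^sub>0 (Dom C f)\<rangle>] [\<eta>\<langle>T\<^sub>0 (Cod C f)\<rangle>]
      [(0, MP.nu (T\<^sub>1 f))] (pn_rwhisk \<eta> T)\<llangle>f\<rrangle>"
    using MP.u.crosses_natom[of "T\<^sub>1 f"] f by (simp add: pn_rwhisk_def)
  have "(P\<^sub>1 (T\<^sub>1 f) \<rhd> \<omega>\<^sub>2 (Dom C f)) \<Zsemi> (pn_rwhisk \<eta> T)\<llangle>f\<rrangle>
      = (\<Lambda> \<odot> pn_lwhisk C T (pf_id C) P \<eta>)\<llangle>f\<rrangle> \<Zsemi> (\<omega>\<^sub>2 (Cod C f) \<lhd> T\<^sub>1 f)"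
    using omega2_modification f by (simp add: inv_modification_def hom1_iff)
  then show ?thesis
    using deq_modification[OF a b, of "w2 (Dom C f)" "w2 (Cod C f)"] f by simp
qed

text \<open>The source of \<open>omega3\<close> is crossed factor by factor: \<open>m\<close> stands
  under P and the second \<lambda> under T, which accounts for the conjugated squares.\<close>

lemma w3_natural:
  assumes f: "f \<in> Arr C"
  shows "deq (T\<^sub>0 (T\<^sub>0 (P\<^sub>0 (Dom C f)))) (P\<^sub>0 (T\<^sub>0 (Cod C f)))
      [P\<^sub>1 (T\<^sub>1 f), P\<^sub>1 (m\<langle>Dom C f\<rangle>), \<Lambda>\<langle>T\<^sub>0 (Dom C f)\<rangle>, T\<^sub>1 (\<Lambda>\<langle>Dom C f\<rangle>)]
    [(1, w3 (Dom C f)), (0, nl f), (1, MT.nm (P\<^sub>1 f))]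
    [(0, FP (MT.nm f)), (1, nl (T\<^sub>1 f)), (2, FT (nl f)), (0, w3 (Cod C f))]"
proof -
  have [simp]: "Dom C f \<in> Obj C" "Cod C f \<in> Obj C" using f Dom_in Cod_in by auto
  have a: "crosses (P\<^sub>1 (T\<^sub>1 f)) (T\<^sub>1 (T\<^sub>1 (P\<^sub>1 f)))
      [P\<^sub>1 (m\<langle>Dom C f\<rangle>), \<Lambda>\<langle>T\<^sub>0 (Dom C f)\<rangle>, T\<^sub>1 (\<Lambda>\<langle>Dom C f\<rangle>)]
      [P\<^sub>1 (m\<langle>Cod C f\<rangle>), \<Lambda>\<langle>T\<^sub>0 (Cod C f)\<rangle>, T\<^sub>1 (\<Lambda>\<langle>Cod C f\<rangle>)]
      [(0, FP (MT.nm f)), (1, nl (T\<^sub>1 f)), (2, FT (nl f))]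
      (pn_lwhisk C P (T \<bullet> T) T m \<odot> pn_rwhisk \<Lambda> T \<odot> pn_lwhisk C T (T \<bullet> P) (P \<bullet> T) \<Lambda>)\<llangle>f\<rrangle>"
    using crosses_append[OF crosses_lwhisk[OF MT.mult_pseudonatural MP.pseudofunctor f, simplified]
      crosses_append[OF law.crosses_natom[of "T\<^sub>1 f", simplified]
        crosses_lwhisk[OF law_pseudonatural MT.pseudofunctor f, simplified]]] f
    by (simp add: pn_comp_def pn_lwhisk_def pn_rwhisk_def numeral_2_eq_2)
  have b: "crosses (P\<^sub>1 (T\<^sub>1 f)) (T\<^sub>1 (T\<^sub>1 (P\<^sub>1 f))) [\<Lambda>\<langle>Dom C f\<rangle>, m\<langle>P\<^sub>0 (Dom C f)\<rangle>] [\<Lambda>\<langle>Cod C f\<rangle>, m\<langle>P\<^sub>0 (Cod C f)\<rangle>]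
      [(0, nl f), (1, MT.nm (P\<^sub>1 f))] (\<Lambda> \<odot> pn_rwhisk m P)\<llangle>f\<rrangle>"
    using crosses_append[OF law.crosses_natom[OF f, simplified] MT.m.crosses_natom[of "P\<^sub>1 f", simplified]] f
    by (simp add: pn_comp_def pn_rwhisk_def)
  have "(P\<^sub>1 (T\<^sub>1 f) \<rhd> \<omega>\<^sub>3 (Dom C f)) \<Zsemi> (\<Lambda> \<odot> pn_rwhisk m P)\<llangle>f\<rrangle>
      = (pn_lwhisk C P (T \<bullet> T) T m \<odot> pn_rwhisk \<Lambda> T \<odot> pn_lwhisk C T (T \<bullet> P) (P \<bullet> T) \<Lambda>)\<llangle>f\<rrangle>
        \<Zsemi> (\<omega>\<^sub>3 (Cod C f) \<lhd> T\<^sub>1 (T\<^sub>1 (P\<^sub>1 f)))"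
    using omega3_modification f by (simp add: inv_modification_def hom1_iff)
  then show ?thesis
    using deq_modification[OF a b, of "w3 (Dom C f)" "w3 (Cod C f)"] f by simp
qed

lemma w4_natural:
  assumes f: "f \<in> Arr C"
  shows "deq (T\<^sub>0 (P\<^sub>0 (P\<^sub>0 (Dom C f)))) (P\<^sub>0 (T\<^sub>0 (Cod C f)))
      [P\<^sub>1 (T\<^sub>1 f), \<Lambda>\<langle>Dom C f\<rangle>, T\<^sub>1 (\<mu>\<langle>Dom C f\<rangle>)]
    [(1, w4 (Dom C f)), (0, MP.nm (T\<^sub>1 f)), (1, FP (nl f)), (2, nl (P\<^sub>1 f))]
    [(0, nl f), (1, FT (MP.nm f)), (0, w4 (Cod C f))]"
proof -
  have [simp]: "Dom C f \<in> Obj C" "Cod C f \<in> Obj C" using f Dom_in Cod_in by auto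
  have a: "crosses (P\<^sub>1 (T\<^sub>1 f)) (T\<^sub>1 (P\<^sub>1 (P\<^sub>1 f))) [\<Lambda>\<langle>Dom C f\<rangle>, T\<^sub>1 (\<mu>\<langle>Dom C f\<rangle>)] [\<Lambda>\<langle>Cod C f\<rangle>, T\<^sub>1 (\<mu>\<langle>Cod C f\<rangle>)]
      [(0, nl f), (1, FT (MP.nm f))] (\<Lambda> \<odot> pn_lwhisk C T (P \<bullet> P) P \<mu>)\<llangle>f\<rrangle>"
    using crosses_append[OF law.crosses_natom[OF f, simplified]
        crosses_lwhisk[OF MP.mult_pseudonatural MT.pseudofunctor f, simplified]] f
    by (simp add: pn_comp_def pn_lwhisk_def)
  have b: "crosses (P\<^sub>1 (T\<^sub>1 f)) (T\<^sub>1 (P\<^sub>1 (P\<^sub>1 f)))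
      [\<mu>\<langle>T\<^sub>0 (Dom C f)\<rangle>, P\<^sub>1 (\<Lambda>\<langle>Dom C f\<rangle>), \<Lambda>\<langle>P\<^sub>0 (Dom C f)\<rangle>]
      [\<mu>\<langle>T\<^sub>0 (Cod C f)\<rangle>, P\<^sub>1 (\<Lambda>\<langle>Cod C f\<rangle>), \<Lambda>\<langle>P\<^sub>0 (Cod C f)\<rangle>]
      [(0, MP.nm (T\<^sub>1 f)), (1, FP (nl f)), (2, nl (P\<^sub>1 f))]
      (pn_rwhisk \<mu> T \<odot> pn_lwhisk C P (T \<bullet> P) (P \<bullet> T) \<Lambda> \<odot> pn_rwhisk \<Lambda> P)\<llangle>f\<rrangle>"
    using crosses_append[OF MP.m.crosses_natom[of "T\<^sub>1 f", simplified]
      crosses_append[OF crosses_lwhisk[OF law_pseudonatural MP.pseudofunctor f, simplified]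
         law.crosses_natom[of "P\<^sub>1 f", simplified]]] f
    by (simp add: pn_comp_def pn_lwhisk_def pn_rwhisk_def numeral_2_eq_2)
  have "(P\<^sub>1 (T\<^sub>1 f) \<rhd> \<omega>\<^sub>4 (Dom C f)) \<Zsemi> (pn_rwhisk \<mu> T \<odot> pn_lwhisk C P (T \<bullet> P) (P \<bullet> T) \<Lambda> \<odot> pn_rwhisk \<Lambda> P)\<llangle>f\<rrangle>
      = (\<Lambda> \<odot> pn_lwhisk C T (P \<bullet> P) P \<mu>)\<llangle>f\<rrangle> \<Zsemi> (\<omega>\<^sub>4 (Cod C f) \<lhd> T\<^sub>1 (P\<^sub>1 (P\<^sub>1 f)))"
    using omega4_modification f by (simp add: inv_modification_def hom1_iff)
  then show ?thesis
    using deq_modification[OF a b, of "w4 (Dom C f)" "w4 (Cod C f)"] f by simp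
qed

end

section \<open>Rotating equations and rewriting with them\<close>

context two_category
begin

lemma dinv_simps [simp]: "dinv [] = []" "dinv ((n, a) # xs) = dinv xs @ [(n, ainv a)]"
  by (simp_all add: dinv_def)

text \<open>Invertibility lets a final segment of one side and an initial segment of the other
  change sides. Axioms and naturality are needed with varying layers inverted, and are brought into
  shape in this way.\<close>

lemma deq_transpose:
  assumes "deq A B p xs ys" "xs = b @ c" "ys = d @ e" "q = run p d" "us = dinv d @ b" "vs = e @ dinv c"
  shows "deq A B q us vs"
proof -
  have "deq A B p b (d @ (e @ dinv c))"
    using deq_move_right[of A B p b c ys] assms(1-3) by simp
  from deq_sym[OF deq_move_left[OF deq_sym[OF this]]] show ?thesis
    using assms(4-6) by simp
qed

lemma deq_inverse:
  assumes "deq A B p xs ys" "q = run p xs" "us = dinv xs" "vs = dinv ys"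
  shows "deq A B q us vs"
proof -
  have w: "wt A B p xs" "run p xs = run p ys" using assms(1) by (auto simp: deq_def)
  have "deq A B p (ys @ dinv xs) []"
    using deq_trans[OF deq_append[OF deq_sym[OF assms(1)] deq_refl] deq_dinv_right[OF w(1)]] wt_dinv(1)[OF w(1)] w(2) by simp
  from deq_move_left[OF this] show ?thesis
    using assms(2-4) w(2) by simp
qed

text \<open>
  Replaces the layers \<open>us\<close> by \<open>vs\<close>, up to interchange; in the result \<open>ys\<close> these layers come after \<open>i\<close>
  others and act on the strands from position \<open>k\<close> on.
\<close>

lemma deq_step:
  assumes "deq A' B' q us vs" "wt A B p xs" "take (length vs) (drop i ys) = shift k vs"
    "wt A B p (take i ys @ shift k us @ drop (i + length vs) ys)"
    "nf xs = nf (take i ys @ shift k us @ drop (i + length vs) ys)"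
    "take (length q) (drop k (run p (take i ys))) = q" "k \<le> length (run p (take i ys))"
    "q \<noteq> [] \<or> (path B' B (take k (run p (take i ys))) \<and> path A A' (drop k (run p (take i ys))))"
  shows "deq A B p xs ys"
proof (rule deq_rewrite[OF assms(1,2,4,5) _ assms(6-8)])
  show "ys = take i ys @ shift k vs @ drop (i + length vs) ys"
    unfolding assms(3)[symmetric] by (metis append_take_drop_id drop_drop add.commute)
qed

end

section \<open>Derivation of (W6) to (W10)\<close>

context pseudodist_calculus
begin

lemma T_faithful:
  assumes A [simp]: "A \<in> Obj C"
    and x: "wt X (P\<^sub>0 (T\<^sub>0 A)) p xs" "wt X (P\<^sub>0 (T\<^sub>0 A)) p ys" "run p xs = run p ys"
    and eq: "deq (T\<^sub>0 X) (P\<^sub>0 (T\<^sub>0 A)) ([P\<^sub>1 (m\<langle>A\<rangle>), \<Lambda>\<langle>T\<^sub>0 A\<rangle>] @ map T\<^sub>1 p)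
      (shift 2 (fdiag T xs)) (shift 2 (fdiag T ys))"
  shows "deq X (P\<^sub>0 (T\<^sub>0 A)) p xs ys"
proof -
  have [simp]: "X \<in> Obj C" using wt_path[OF x(1)] path_Obj by blast
  let ?w = "[P\<^sub>1 (m\<langle>A\<rangle>), \<Lambda>\<langle>T\<^sub>0 A\<rangle>]" and ?Y = "P\<^sub>0 (T\<^sub>0 A)"
  \<comment> \<open>The cancellation asks for an invertible cell from \<open>?w\<close> followed by
    \<open>u\<close> to the identity. The inverse of \<open>omega1\<close> turns \<lambda>T and
    \<open>u\<close> into the image of \<open>u\<close> under P, and the left unit of T under P
    finishes.\<close>
  let ?d = "box ?Y ?Y (?w @ [u\<langle>?Y\<rangle>]) [(1, ainv (w1 (T\<^sub>0 A))), (0, FP (MT.la A))]"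
  have d: "wt ?Y ?Y (?w @ [u\<langle>?Y\<rangle>]) [(1, ainv (w1 (T\<^sub>0 A))), (0, FP (MT.la A))]"
    by simp
  have "deq X ?Y ((?w @ map T\<^sub>1 p) @ [u\<langle>X\<rangle>]) (shift 2 (fdiag T xs)) (shift 2 (fdiag T ys))"
    by (rule deq_whisk_right[OF eq]) simp
  then show ?thesis
    using deq_cancel_functor[OF MT.unit_pseudonatural box_ok[OF d], of ?w ?Y X p xs ys] x
    by (simp add: numeral_2_eq_2)
qed

text \<open>The left unit of P itself is the contraction. Unlike for T, the strand \<eta> stands
  already in the hypothesis, because the equation to which this is applied is obtained only along
  \<eta>.\<close>

lemma P_faithful:
  assumes A [simp]: "A \<in> Obj C"
    and x: "wt X (P\<^sub>0 (T\<^sub>0 A)) p xs" "wt X (P\<^sub>0 (T\<^sub>0 A)) p ys" "run p xs = run p ys"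
    and eq: "deq X (P\<^sub>0 (T\<^sub>0 A)) ([\<mu>\<langle>T\<^sub>0 A\<rangle>] @ map P\<^sub>1 p @ [\<eta>\<langle>X\<rangle>]) (shift 1 (fdiag P xs)) (shift 1 (fdiag P ys))"
  shows "deq X (P\<^sub>0 (T\<^sub>0 A)) p xs ys"
  using deq_cancel_functor[OF MP.unit_pseudonatural, of "MP.la (T\<^sub>0 A)" "[\<mu>\<langle>T\<^sub>0 A\<rangle>]" "P\<^sub>0 (T\<^sub>0 A)" X p xs ys] x eq
  by simp

text \<open>(W1) solved for \<open>omega3\<close> followed by the right unit. Read in either
  direction it trades an \<open>omega3\<close> for an inverse \<open>omega1\<close>.\<close>

lemma W1_flip:
  assumes [simp]: "A \<in> Obj C"
  shows "deq (T\<^sub>0 (P\<^sub>0 A)) (P\<^sub>0 (T\<^sub>0 A)) [P\<^sub>1 (m\<langle>A\<rangle>), \<Lambda>\<langle>T\<^sub>0 A\<rangle>, T\<^sub>1 (\<Lambda>\<langle>A\<rangle>), T\<^sub>1 (u\<langle>P\<^sub>0 A\<rangle>)]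
    [(0, w3 A), (1, MT.ra (P\<^sub>0 A))]
    [(2, FT (ainv (w1 A))), (1, ainv (nl (u\<langle>A\<rangle>))), (0, FP (MT.ra A))]"
  by (rule deq_sym, rule deq_transpose[OF deq_sym[OF W1_deq[OF assms]], where c = "[]" and d = "[(0, FP (ainv (MT.ra A))), (1, nl (u\<langle>A\<rangle>)), (2, FT (w1 A))]"]) simp_all

text \<open>
  Inserting \<open>u\<close> between the two outer copies of \<open>T\<close> in (W3) gives \<open>Pm \<cdot> \<lambda>T \<cdot> T e = 1\<close> for the composite \<open>e\<close> of (W6).
\<close>

lemma unit_left:
  assumes [simp]: "A \<in> Obj C"
  shows "deq (T\<^sub>0 (P\<^sub>0 A)) (P\<^sub>0 (T\<^sub>0 A)) [\<Lambda>\<langle>A\<rangle>]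
    [(0, FP (ainv (MT.la A))), (1, w1 (T\<^sub>0 A)), (2, ainv (MT.nu (\<Lambda>\<langle>A\<rangle>))), (0, w3 A), (1, MT.la (P\<^sub>0 A))]
    []"
proof -
  let ?D = "deq (T\<^sub>0 (T\<^sub>0 (P\<^sub>0 A))) (P\<^sub>0 (T\<^sub>0 A)) [P\<^sub>1 (m\<langle>A\<rangle>), \<Lambda>\<langle>T\<^sub>0 A\<rangle>, T\<^sub>1 (\<Lambda>\<langle>A\<rangle>)]"
  let ?e = "[(0, FP (ainv (MT.la A))), (1, w1 (T\<^sub>0 A)), (2, ainv (MT.nu (\<Lambda>\<langle>A\<rangle>))), (0, w3 A), (1, MT.la (P\<^sub>0 A))]"
  \<comment> \<open>Naturality of the right unit of T along \<lambda>, with the square of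
    \<open>m\<close> carried to the other side.\<close>
  have rn: "deq (T\<^sub>0 (T\<^sub>0 (P\<^sub>0 A))) (T\<^sub>0 (P\<^sub>0 (T\<^sub>0 A))) [m\<langle>P\<^sub>0 (T\<^sub>0 A)\<rangle>, T\<^sub>1 (T\<^sub>1 (\<Lambda>\<langle>A\<rangle>)), T\<^sub>1 (u\<langle>T\<^sub>0 (P\<^sub>0 A)\<rangle>)]
      [(0, ainv (MT.nm (\<Lambda>\<langle>A\<rangle>))), (1, MT.ra (T\<^sub>0 (P\<^sub>0 A)))]
      [(1, FT (MT.nu (\<Lambda>\<langle>A\<rangle>))), (0, MT.ra (P\<^sub>0 (T\<^sub>0 A)))]"
    by (rule deq_transpose[OF MT.r_natural[of "\<Lambda>\<langle>A\<rangle>", simplified], where c = "[]" and d = "[(0, MT.nm (\<Lambda>\<langle>A\<rangle>))]"]) simp_all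
  \<comment> \<open>Naturality of \<lambda> with respect to the left unit of T, regarded as a
    2-cell.\<close>
  have ln: "deq (T\<^sub>0 (P\<^sub>0 (T\<^sub>0 A))) (P\<^sub>0 (T\<^sub>0 (T\<^sub>0 A))) [\<Lambda>\<langle>T\<^sub>0 A\<rangle>, T\<^sub>1 (P\<^sub>1 (m\<langle>A\<rangle>)), T\<^sub>1 (P\<^sub>1 (u\<langle>T\<^sub>0 A\<rangle>))]
      [(0, ainv (nl (m\<langle>A\<rangle>))), (1, ainv (nl (u\<langle>T\<^sub>0 A\<rangle>))), (0, FP (FT (MT.la A)))]
      [(1, FT (FP (MT.la A)))]"
    by (rule deq_transpose[OF law.deq_natural[of "MT.la A", simplified], where c = "[]" and d = "[(1, nl (u\<langle>T\<^sub>0 A\<rangle>)), (0, nl (m\<langle>A\<rangle>))]"]) simp_all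
  \<comment> \<open>The image of \<open>?e\<close> is followed by \<open>w3 A\<close>, and a
    cancelling pair of squares of \<lambda> at \<open>m\<close> is inserted. Together with the
    associativity cell that the triangle supplies next, this completes the left side of
    (W3).\<close>
  have "?D (shift 2 (fdiag T ?e) @ [(0, w3 A)])
      [(2, FT (FP (ainv (MT.la A)))), (3, FT (w1 (T\<^sub>0 A))), (4, FT (ainv (MT.nu (\<Lambda>\<langle>A\<rangle>)))), (1, ainv (nl (m\<langle>A\<rangle>))),
      (1, nl (m\<langle>A\<rangle>)), (2, FT (w3 A)), (0, w3 A), (2, FT (MT.la (P\<^sub>0 A)))]"
    by (rule deq_step[OF deq_sym[OF deq_inv'[of "nl (m\<langle>A\<rangle>)"]], where i = 3 and k = 1]) simp_all
  also have "?D \<dots> [(2, FT (FP (ainv (MT.la A)))), (3, FT (w1 (T\<^sub>0 A))), (4, FT (ainv (MT.nu (\<Lambda>\<langle>A\<rangle>)))), (1, ainv (nl (m\<langle>A\<rangle>))),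
      (1, nl (m\<langle>A\<rangle>)), (2, FT (w3 A)), (0, w3 A), (1, MT.aa (P\<^sub>0 A)), (2, MT.ra (T\<^sub>0 (P\<^sub>0 A)))]"
    by (rule deq_step[OF deq_sym[OF MT.deq_triangle[of "P\<^sub>0 A", simplified]], where i = 7 and k = 1]) simp_all
  also have "?D \<dots> [(2, FT (FP (ainv (MT.la A)))), (3, FT (w1 (T\<^sub>0 A))), (4, FT (ainv (MT.nu (\<Lambda>\<langle>A\<rangle>)))), (1, ainv (nl (m\<langle>A\<rangle>))),
      (0, FP (MT.aa A)), (1, w3 (T\<^sub>0 A)), (2, ainv (MT.nm (\<Lambda>\<langle>A\<rangle>))), (0, w3 A), (2, MT.ra (T\<^sub>0 (P\<^sub>0 A)))]"
    by (rule deq_step[OF W3_deq[of A], where i = 4 and k = 0]) simp_all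
  also have "?D \<dots> [(2, FT (FP (ainv (MT.la A)))), (3, FT (w1 (T\<^sub>0 A))), (4, FT (ainv (MT.nu (\<Lambda>\<langle>A\<rangle>)))), (1, ainv (nl (m\<langle>A\<rangle>))),
      (0, FP (MT.aa A)), (1, w3 (T\<^sub>0 A)), (3, FT (MT.nu (\<Lambda>\<langle>A\<rangle>))), (2, MT.ra (P\<^sub>0 (T\<^sub>0 A))), (0, w3 A)]"
    by (rule deq_step[OF rn, where i = 6 and k = 2]) simp_all
  also have "?D \<dots> [(2, FT (FP (ainv (MT.la A)))), (3, FT (w1 (T\<^sub>0 A))), (1, ainv (nl (m\<langle>A\<rangle>))), (0, FP (MT.aa A)),
      (1, w3 (T\<^sub>0 A)), (2, MT.ra (P\<^sub>0 (T\<^sub>0 A))), (0, w3 A)]"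
    by (rule deq_step[OF deq_inv[of "FT (ainv (MT.nu (\<Lambda>\<langle>A\<rangle>)))", simplified], where i = 2 and k = 4]) simp_all
  \<comment> \<open>(W1) at T A removes the \<open>omega3\<close> produced by (W3) and creates the
    inverse of the \<open>omega1\<close> that came from \<open>?e\<close>.\<close>
  also have "?D \<dots> [(2, FT (FP (ainv (MT.la A)))), (3, FT (w1 (T\<^sub>0 A))), (1, ainv (nl (m\<langle>A\<rangle>))), (0, FP (MT.aa A)),
      (3, FT (ainv (w1 (T\<^sub>0 A)))), (2, ainv (nl (u\<langle>T\<^sub>0 A\<rangle>))), (1, FP (MT.ra (T\<^sub>0 A))), (0, w3 A)]"
    by (rule deq_step[OF W1_flip[of "T\<^sub>0 A"], where i = 4 and k = 1]) simp_all
  also have "?D \<dots> [(2, FT (FP (ainv (MT.la A)))), (1, ainv (nl (m\<langle>A\<rangle>))), (2, ainv (nl (u\<langle>T\<^sub>0 A\<rangle>))), (0, FP (MT.aa A)),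
      (1, FP (MT.ra (T\<^sub>0 A))), (0, w3 A)]"
    by (rule deq_step[OF deq_inv[of "FT (w1 (T\<^sub>0 A))", simplified], where i = 1 and k = 3]) simp_all
  \<comment> \<open>The triangle a second time, now under P, absorbs the associativity cell that
    (W3) has left over.\<close>
  also have "?D \<dots> [(2, FT (FP (ainv (MT.la A)))), (1, ainv (nl (m\<langle>A\<rangle>))), (2, ainv (nl (u\<langle>T\<^sub>0 A\<rangle>))), (1, FP (FT (MT.la A))),
      (0, w3 A)]"
    by (rule deq_step[OF MP.F.deq_fdiag[OF MT.deq_triangle[of A], simplified], where i = 3 and k = 0]) simp_all
  also have "?D \<dots> [(2, FT (FP (ainv (MT.la A)))), (2, FT (FP (MT.la A))), (0, w3 A)]"
    by (rule deq_step[OF ln, where i = 1 and k = 1]) simp_all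
  also have "?D \<dots> [(0, w3 A)]"
    by (rule deq_step[OF deq_inv[of "FT (FP (ainv (MT.la A)))", simplified], where i = 0 and k = 2]) simp_all
  finally have "?D (shift 2 (fdiag T ?e)) []"
    by - (rule deq_cancel_right[where zs = "[(0, w3 A)]"], simp_all)
  then show ?thesis
    by - (rule T_faithful, simp_all)
qed

text \<open>
  (W4) at \<open>T P \<eta> P\<close> yields the composite of (W7) only at \<open>P A\<close> and whiskered by \<open>\<mu>T \<cdot> P\<lambda>\<close>; its naturality
  along \<open>\<eta>\<close> then moves it to \<open>A\<close>, where the whiskering can be cancelled.
\<close>

lemma unit_right_whiskered:
  assumes [simp]: "A \<in> Obj C"
  shows "deq (T\<^sub>0 (P\<^sub>0 (P\<^sub>0 A))) (P\<^sub>0 (T\<^sub>0 A)) [\<mu>\<langle>T\<^sub>0 A\<rangle>, P\<^sub>1 (\<Lambda>\<langle>A\<rangle>), \<Lambda>\<langle>P\<^sub>0 A\<rangle>]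
    [(3, FT (ainv (MP.ra (P\<^sub>0 A)))), (2, w4 (P\<^sub>0 A)), (4, ainv (nl (\<eta>\<langle>P\<^sub>0 A\<rangle>))), (3, FP (w2 (P\<^sub>0 A))),
    (2, MP.ra (T\<^sub>0 (P\<^sub>0 A)))]
    []"
proof -
  let ?D = "deq (T\<^sub>0 (P\<^sub>0 (P\<^sub>0 A))) (P\<^sub>0 (T\<^sub>0 A)) [\<Lambda>\<langle>A\<rangle>, T\<^sub>1 (\<mu>\<langle>A\<rangle>)]"
  \<comment> \<open>The triangle of P solved for the inverse right unit. It turns the unit of the
    composite under study into the associativity cell with which (W4) begins.\<close>
  have tri: "deq (P\<^sub>0 (P\<^sub>0 A)) (P\<^sub>0 A) [\<mu>\<langle>A\<rangle>]
      [(1, ainv (MP.ra (P\<^sub>0 A)))]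
      [(1, FP (ainv (MP.la A))), (0, MP.aa A)]"
    by (rule deq_sym, rule deq_transpose[OF MP.deq_triangle[of A], where c = "[(1, MP.ra (P\<^sub>0 A))]" and d = "[(1, FP (MP.la A))]"]) simp_all
  have ln: "deq (T\<^sub>0 (P\<^sub>0 (P\<^sub>0 A))) (P\<^sub>0 (T\<^sub>0 (P\<^sub>0 A))) [\<Lambda>\<langle>P\<^sub>0 A\<rangle>]
      [(1, FT (FP (ainv (MP.la A)))), (0, ainv (nl (\<mu>\<langle>A\<rangle>)))]
      [(0, FP (FT (ainv (MP.la A)))), (1, nl (\<eta>\<langle>P\<^sub>0 A\<rangle>))]"
    by (rule deq_sym, rule deq_transpose[OF law.deq_natural[of "ainv (MP.la A)", simplified], where c = "[(0, nl (\<mu>\<langle>A\<rangle>))]" and d = "[]"]) simp_all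
  have unit: "deq (T\<^sub>0 (P\<^sub>0 A)) (P\<^sub>0 (T\<^sub>0 A)) [\<Lambda>\<langle>A\<rangle>]
      [(1, FT (ainv (MP.la A))), (0, w4 A), (2, w2 (P\<^sub>0 A))]
      [(0, ainv (MP.la (T\<^sub>0 A))), (1, ainv (MP.nu (\<Lambda>\<langle>A\<rangle>)))]"
    by (rule deq_transpose[OF W2_deq[of A], where c = "[(1, MP.nu (\<Lambda>\<langle>A\<rangle>)), (0, MP.la (T\<^sub>0 A))]" and d = "[]"]) simp_all
  have rn: "deq (P\<^sub>0 (T\<^sub>0 (P\<^sub>0 A))) (P\<^sub>0 (P\<^sub>0 (T\<^sub>0 A))) [\<mu>\<langle>P\<^sub>0 (T\<^sub>0 A)\<rangle>, P\<^sub>1 (\<eta>\<langle>P\<^sub>0 (T\<^sub>0 A)\<rangle>), P\<^sub>1 (\<Lambda>\<langle>A\<rangle>)]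
      [(1, FP (ainv (MP.nu (\<Lambda>\<langle>A\<rangle>)))), (0, ainv (MP.nm (\<Lambda>\<langle>A\<rangle>))), (1, MP.ra (T\<^sub>0 (P\<^sub>0 A)))]
      [(0, MP.ra (P\<^sub>0 (T\<^sub>0 A)))]"
    by (rule deq_transpose[OF MP.r_natural[of "\<Lambda>\<langle>A\<rangle>", simplified], where c = "[]" and d = "[(0, MP.nm (\<Lambda>\<langle>A\<rangle>)), (1, FP (MP.nu (\<Lambda>\<langle>A\<rangle>)))]"]) simp_all
  \<comment> \<open>\<open>w4 A\<close> is prefixed to supply the first \<open>omega4\<close> of
    (W4); it survives the whole chain unchanged and is cancelled at the end.\<close>
  have "?D [(0, w4 A), (3, FT (ainv (MP.ra (P\<^sub>0 A)))), (2, w4 (P\<^sub>0 A)), (4, ainv (nl (\<eta>\<langle>P\<^sub>0 A\<rangle>))), (3, FP (w2 (P\<^sub>0 A))),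
      (2, MP.ra (T\<^sub>0 (P\<^sub>0 A)))]
      [(0, w4 A), (3, FT (ainv (MP.ra (P\<^sub>0 A)))), (2, w4 (P\<^sub>0 A)), (1, MP.nm (\<Lambda>\<langle>A\<rangle>)), (1, ainv (MP.nm (\<Lambda>\<langle>A\<rangle>))),
      (4, ainv (nl (\<eta>\<langle>P\<^sub>0 A\<rangle>))), (3, FP (w2 (P\<^sub>0 A))), (2, MP.ra (T\<^sub>0 (P\<^sub>0 A)))]"
    by (rule deq_step[OF deq_sym[OF deq_inv[of "MP.nm (\<Lambda>\<langle>A\<rangle>)", simplified]], where i = 3 and k = 1]) simp_all
  also have "?D \<dots> [(2, FT (FP (ainv (MP.la A)))), (1, FT (MP.aa A)), (0, w4 A), (2, w4 (P\<^sub>0 A)), (1, MP.nm (\<Lambda>\<langle>A\<rangle>)),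
      (1, ainv (MP.nm (\<Lambda>\<langle>A\<rangle>))), (4, ainv (nl (\<eta>\<langle>P\<^sub>0 A\<rangle>))), (3, FP (w2 (P\<^sub>0 A))), (2, MP.ra (T\<^sub>0 (P\<^sub>0 A)))]"
    by (rule deq_step[OF MT.F.deq_fdiag[OF tri, simplified], where i = 0 and k = 1]) simp_all
  also have "?D \<dots> [(2, FT (FP (ainv (MP.la A)))), (0, w4 A), (2, ainv (nl (\<mu>\<langle>A\<rangle>))), (1, FP (w4 A)), (0, MP.aa (T\<^sub>0 A)),
      (1, ainv (MP.nm (\<Lambda>\<langle>A\<rangle>))), (4, ainv (nl (\<eta>\<langle>P\<^sub>0 A\<rangle>))), (3, FP (w2 (P\<^sub>0 A))), (2, MP.ra (T\<^sub>0 (P\<^sub>0 A)))]"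
    by (rule deq_step[OF W4_deq[of A], where i = 1 and k = 0]) simp_all
  also have "?D \<dots> [(0, w4 A), (2, FP (FT (ainv (MP.la A)))), (3, nl (\<eta>\<langle>P\<^sub>0 A\<rangle>)), (1, FP (w4 A)), (0, MP.aa (T\<^sub>0 A)),
      (1, ainv (MP.nm (\<Lambda>\<langle>A\<rangle>))), (4, ainv (nl (\<eta>\<langle>P\<^sub>0 A\<rangle>))), (3, FP (w2 (P\<^sub>0 A))), (2, MP.ra (T\<^sub>0 (P\<^sub>0 A)))]"
    by (rule deq_step[OF ln, where i = 1 and k = 2]) simp_all
  also have "?D \<dots> [(0, w4 A), (2, FP (FT (ainv (MP.la A)))), (1, FP (w4 A)), (0, MP.aa (T\<^sub>0 A)), (1, ainv (MP.nm (\<Lambda>\<langle>A\<rangle>))),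
      (3, FP (w2 (P\<^sub>0 A))), (2, MP.ra (T\<^sub>0 (P\<^sub>0 A)))]"
    by (rule deq_step[OF deq_inv[of "nl (\<eta>\<langle>P\<^sub>0 A\<rangle>)", simplified], where i = 3 and k = 4]) simp_all
  \<comment> \<open>(W2) at A, applied under P, eliminates the \<open>omega4\<close> that (W4)
    created together with the \<open>omega2\<close> of the original composite.\<close>
  also have "?D \<dots> [(0, w4 A), (1, FP (ainv (MP.la (T\<^sub>0 A)))), (2, FP (ainv (MP.nu (\<Lambda>\<langle>A\<rangle>)))), (0, MP.aa (T\<^sub>0 A)),
      (1, ainv (MP.nm (\<Lambda>\<langle>A\<rangle>))), (2, MP.ra (T\<^sub>0 (P\<^sub>0 A)))]"
    by (rule deq_step[OF MP.F.deq_fdiag[OF unit, simplified], where i = 1 and k = 1]) simp_all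
  also have "?D \<dots> [(0, w4 A), (1, FP (ainv (MP.la (T\<^sub>0 A)))), (0, MP.aa (T\<^sub>0 A)), (1, MP.ra (P\<^sub>0 (T\<^sub>0 A)))]"
    by (rule deq_step[OF rn, where i = 3 and k = 1]) simp_all
  also have "?D \<dots> [(0, w4 A), (1, FP (ainv (MP.la (T\<^sub>0 A)))), (1, FP (MP.la (T\<^sub>0 A)))]"
    by (rule deq_step[OF MP.deq_triangle[of "T\<^sub>0 A", simplified], where i = 2 and k = 0]) simp_all
  also have "?D \<dots> [(0, w4 A)]"
    by (rule deq_step[OF deq_inv[of "FP (ainv (MP.la (T\<^sub>0 A)))", simplified], where i = 1 and k = 1]) simp_all
  finally have "?D ([(0, w4 A)] @ [(3, FT (ainv (MP.ra (P\<^sub>0 A)))), (2, w4 (P\<^sub>0 A)), (4, ainv (nl (\<eta>\<langle>P\<^sub>0 A\<rangle>))), (3, FP (w2 (P\<^sub>0 A))),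
      (2, MP.ra (T\<^sub>0 (P\<^sub>0 A)))])
      ([(0, w4 A)] @ [])"
    by simp
  from deq_cancel_left[OF this] show ?thesis
    by simp
qed

text \<open>The composite of (W7) is assembled from modifications and naturality squares, hence is
  itself a modification. The strand of \<open>f\<close> is carried through its factors, from the
  last one to the first.\<close>

lemma unit_right_natural:
  assumes [simp]: "f \<in> Arr C" "Dom C f = X" "Cod C f = Y"
  shows "deq (T\<^sub>0 (P\<^sub>0 X)) (P\<^sub>0 (T\<^sub>0 Y)) [P\<^sub>1 (T\<^sub>1 f), \<Lambda>\<langle>X\<rangle>]
    [(2, FT (ainv (MP.ra X))), (1, w4 X), (3, ainv (nl (\<eta>\<langle>X\<rangle>))), (2, FP (w2 X)), (1, MP.ra (T\<^sub>0 X)), (0, nl f)]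
    [(0, nl f), (1, FT (ainv (MP.ra Y))), (0, w4 Y), (2, ainv (nl (\<eta>\<langle>Y\<rangle>))), (1, FP (w2 Y)), (0, MP.ra (T\<^sub>0 Y))]"
proof -
  have [simp]: "X \<in> Obj C" "Y \<in> Obj C"
    using Dom_in[OF assms(1)] Cod_in[OF assms(1)] assms(2,3) by simp_all
  let ?D = "deq (T\<^sub>0 (P\<^sub>0 X)) (P\<^sub>0 (T\<^sub>0 Y)) [P\<^sub>1 (T\<^sub>1 f), \<Lambda>\<langle>X\<rangle>]"
  have rn: "deq (P\<^sub>0 X) (P\<^sub>0 Y) [P\<^sub>1 f]
      [(1, ainv (MP.ra X)), (0, MP.nm f), (1, FP (MP.nu f))]
      [(0, ainv (MP.ra Y))]"
    by (rule deq_transpose[OF deq_sym[OF MP.r_natural[of f, simplified]], where c = "[(0, MP.ra Y)]" and d = "[(1, MP.ra X)]"]) simp_all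
  \<comment> \<open>Naturality of \<lambda> with respect to a 2-cell that is itself a naturality
    square, that of \<eta> at \<open>f\<close>.\<close>
  have ln: "deq (T\<^sub>0 (P\<^sub>0 X)) (P\<^sub>0 (T\<^sub>0 (P\<^sub>0 Y))) [P\<^sub>1 (T\<^sub>1 (P\<^sub>1 f)), P\<^sub>1 (T\<^sub>1 (\<eta>\<langle>X\<rangle>)), \<Lambda>\<langle>X\<rangle>]
      [(0, FP (FT (MP.nu f))), (1, nl f)]
      [(1, nl (\<eta>\<langle>X\<rangle>)), (0, nl (P\<^sub>1 f)), (1, FT (FP (MP.nu f))), (0, ainv (nl (\<eta>\<langle>Y\<rangle>)))]"
    by (rule deq_transpose[OF law.deq_natural[of "MP.nu f", simplified], where c = "[(0, nl (\<eta>\<langle>Y\<rangle>))]" and d = "[]"]) simp_all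
  have "?D [(2, FT (ainv (MP.ra X))), (1, w4 X), (3, ainv (nl (\<eta>\<langle>X\<rangle>))), (2, FP (w2 X)), (1, MP.ra (T\<^sub>0 X)), (0, nl f)]
      [(2, FT (ainv (MP.ra X))), (1, w4 X), (3, ainv (nl (\<eta>\<langle>X\<rangle>))), (2, FP (w2 X)), (0, MP.nm (T\<^sub>1 f)),
      (1, FP (MP.nu (T\<^sub>1 f))), (0, MP.ra (T\<^sub>0 Y)), (0, nl f)]"
    by (rule deq_step[OF MP.r_natural[of "T\<^sub>1 f", simplified], where i = 4 and k = 0]) simp_all
  also have "?D \<dots> [(2, FT (ainv (MP.ra X))), (1, w4 X), (3, ainv (nl (\<eta>\<langle>X\<rangle>))), (0, MP.nm (T\<^sub>1 f)), (1, FP (nl f)),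
      (2, FP (FT (MP.nu f))), (1, FP (w2 Y)), (0, MP.ra (T\<^sub>0 Y)), (0, nl f)]"
    by (rule deq_step[OF MP.F.deq_fdiag[OF w2_natural[of f], simplified], where i = 4 and k = 1]) simp_all
  also have "?D \<dots> [(2, FT (ainv (MP.ra X))), (1, w4 X), (3, ainv (nl (\<eta>\<langle>X\<rangle>))), (0, MP.nm (T\<^sub>1 f)), (1, FP (nl f)),
      (3, nl (\<eta>\<langle>X\<rangle>)), (2, nl (P\<^sub>1 f)), (3, FT (FP (MP.nu f))), (2, ainv (nl (\<eta>\<langle>Y\<rangle>))), (1, FP (w2 Y)),
      (0, MP.ra (T\<^sub>0 Y))]"
    by (rule deq_step[OF ln, where i = 5 and k = 2]) simp_all
  also have "?D \<dots> [(2, FT (ainv (MP.ra X))), (1, w4 X), (0, MP.nm (T\<^sub>1 f)), (1, FP (nl f)), (2, nl (P\<^sub>1 f)),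
      (3, FT (FP (MP.nu f))), (2, ainv (nl (\<eta>\<langle>Y\<rangle>))), (1, FP (w2 Y)), (0, MP.ra (T\<^sub>0 Y))]"
    by (rule deq_step[OF deq_inv[of "ainv (nl (\<eta>\<langle>X\<rangle>))", simplified], where i = 2 and k = 3]) simp_all
  also have "?D \<dots> [(2, FT (ainv (MP.ra X))), (0, nl f), (1, FT (MP.nm f)), (0, w4 Y), (3, FT (FP (MP.nu f))),
      (2, ainv (nl (\<eta>\<langle>Y\<rangle>))), (1, FP (w2 Y)), (0, MP.ra (T\<^sub>0 Y))]"
    by (rule deq_step[OF w4_natural[of f, simplified], where i = 1 and k = 0]) simp_all
  also have "?D \<dots> [(0, nl f), (1, FT (ainv (MP.ra Y))), (0, w4 Y), (2, ainv (nl (\<eta>\<langle>Y\<rangle>))), (1, FP (w2 Y)), (0, MP.ra (T\<^sub>0 Y))]"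
    by (rule deq_step[OF MT.F.deq_fdiag[OF rn, simplified], where i = 1 and k = 1]) simp_all
  finally show ?thesis .
qed

text \<open>The three appended layers insert an identity 1-cell as \<mu>T after the image of \<eta>T
  under P, expand it by \<open>omega2\<close>, and move \<eta> past \<lambda>. By interchange the
  composite may act after the first two of them; its naturality along \<eta> then moves it to P A,
  behind the 1-cells where it is already known to be trivial.\<close>

lemma unit_right:
  assumes [simp]: "A \<in> Obj C"
  shows "deq (T\<^sub>0 (P\<^sub>0 A)) (P\<^sub>0 (T\<^sub>0 A)) [\<Lambda>\<langle>A\<rangle>]
    [(1, FT (ainv (MP.ra A))), (0, w4 A), (2, ainv (nl (\<eta>\<langle>A\<rangle>))), (1, FP (w2 A)), (0, MP.ra (T\<^sub>0 A))]
    []"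
proof -
  let ?D = "deq (T\<^sub>0 (P\<^sub>0 A)) (P\<^sub>0 (T\<^sub>0 A)) [\<Lambda>\<langle>A\<rangle>]"
  have "?D [(1, FT (ainv (MP.ra A))), (0, w4 A), (2, ainv (nl (\<eta>\<langle>A\<rangle>))), (1, FP (w2 A)), (0, MP.ra (T\<^sub>0 A)),
      (0, ainv (MP.ra (T\<^sub>0 A))), (1, FP (ainv (w2 A))), (2, nl (\<eta>\<langle>A\<rangle>))]
      [(0, ainv (MP.ra (T\<^sub>0 A))), (1, FP (ainv (w2 A))), (2, nl (\<eta>\<langle>A\<rangle>)), (3, FT (ainv (MP.ra (P\<^sub>0 A)))),
      (2, w4 (P\<^sub>0 A)), (4, ainv (nl (\<eta>\<langle>P\<^sub>0 A\<rangle>))), (3, FP (w2 (P\<^sub>0 A))), (2, MP.ra (T\<^sub>0 (P\<^sub>0 A)))]"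
    by (rule deq_step[OF unit_right_natural[of "\<eta>\<langle>A\<rangle>" A "P\<^sub>0 A"], where i = 2 and k = 2]) simp_all
  also have "?D \<dots> [(0, ainv (MP.ra (T\<^sub>0 A))), (1, FP (ainv (w2 A))), (2, nl (\<eta>\<langle>A\<rangle>))]"
    by (rule deq_step[OF unit_right_whiskered[of A], where i = 3 and k = 0]) simp_all
  finally show ?thesis
    by - (rule deq_cancel_right[where zs = "[(0, ainv (MP.ra (T\<^sub>0 A))), (1, FP (ainv (w2 A))), (2, nl (\<eta>\<langle>A\<rangle>))]"], simp_all)
qed

lemma unit_multiplication:
  assumes [simp]: "A \<in> Obj C"
  shows "deq (T\<^sub>0 (T\<^sub>0 A)) (P\<^sub>0 (T\<^sub>0 A)) [P\<^sub>1 (m\<langle>A\<rangle>), \<Lambda>\<langle>T\<^sub>0 A\<rangle>, T\<^sub>1 (\<Lambda>\<langle>A\<rangle>), T\<^sub>1 (T\<^sub>1 (\<eta>\<langle>A\<rangle>))]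
    [(0, w3 A), (1, ainv (MT.nm (\<eta>\<langle>A\<rangle>))), (0, w2 A)]
    [(2, FT (w2 A)), (1, w2 (T\<^sub>0 A)), (0, MP.nu (m\<langle>A\<rangle>))]"
proof -
  let ?D = "deq (T\<^sub>0 (T\<^sub>0 (P\<^sub>0 A))) (P\<^sub>0 (T\<^sub>0 A)) [P\<^sub>1 (m\<langle>A\<rangle>), \<Lambda>\<langle>T\<^sub>0 A\<rangle>, T\<^sub>1 (\<Lambda>\<langle>A\<rangle>)]"
  \<comment> \<open>The inverse of one side of (W8) followed by the other, so that the claim becomes
    triviality of a loop.\<close>
  let ?z = "[(0, ainv (MP.nu (m\<langle>A\<rangle>))), (1, ainv (w2 (T\<^sub>0 A))), (2, FT (ainv (w2 A))), (0, w3 A),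
      (1, ainv (MT.nm (\<eta>\<langle>A\<rangle>))), (0, w2 A)]"
  have rn: "deq (P\<^sub>0 (T\<^sub>0 (T\<^sub>0 A))) (P\<^sub>0 (T\<^sub>0 A)) [P\<^sub>1 (m\<langle>A\<rangle>)]
      [(0, ainv (MP.ra (T\<^sub>0 A))), (1, FP (ainv (MP.nu (m\<langle>A\<rangle>))))]
      [(1, ainv (MP.ra (T\<^sub>0 (T\<^sub>0 A)))), (0, MP.nm (m\<langle>A\<rangle>))]"
    by (rule deq_sym, rule deq_transpose[OF deq_sym[OF MP.r_natural[of "m\<langle>A\<rangle>", simplified]], where c = "[(1, FP (MP.nu (m\<langle>A\<rangle>))), (0, MP.ra (T\<^sub>0 A))]" and d = "[(1, MP.ra (T\<^sub>0 (T\<^sub>0 A)))]"]) simp_all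
  \<comment> \<open>Naturality of \<lambda> with respect to the inverse of \<open>omega2\<close>;
    the square at \<open>\<Lambda>\<langle>A\<rangle>\<close> that it yields is the one occurring in
    (W5).\<close>
  have ln: "deq (T\<^sub>0 (P\<^sub>0 (T\<^sub>0 A))) (P\<^sub>0 (T\<^sub>0 (P\<^sub>0 (T\<^sub>0 A)))) [P\<^sub>1 (T\<^sub>1 (\<eta>\<langle>T\<^sub>0 A\<rangle>)), \<Lambda>\<langle>T\<^sub>0 A\<rangle>]
      [(0, FP (FT (ainv (w2 A)))), (1, nl (T\<^sub>1 (\<eta>\<langle>A\<rangle>)))]
      [(0, nl (\<eta>\<langle>T\<^sub>0 A\<rangle>)), (1, FT (FP (ainv (w2 A)))), (0, ainv (nl (\<Lambda>\<langle>A\<rangle>)))]"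
    by (rule deq_transpose[OF law.deq_natural[of "ainv (w2 A)", simplified], where c = "[(0, nl (\<Lambda>\<langle>A\<rangle>))]" and d = "[]"]) simp_all
  have mn: "deq (T\<^sub>0 (T\<^sub>0 (P\<^sub>0 A))) (T\<^sub>0 (P\<^sub>0 A)) [m\<langle>P\<^sub>0 A\<rangle>]
      [(1, FT (FT (ainv (MP.ra A)))), (0, ainv (MT.nm (\<mu>\<langle>A\<rangle>)))]
      [(0, FT (ainv (MP.ra A))), (1, MT.nm (P\<^sub>1 (\<eta>\<langle>A\<rangle>)))]"
    by (rule deq_sym, rule deq_transpose[OF MT.m.deq_natural[of "ainv (MP.ra A)", simplified], where c = "[(0, MT.nm (\<mu>\<langle>A\<rangle>))]" and d = "[]"]) simp_all
  \<comment> \<open>(W7) solved for the right unit followed by \<open>omega4\<close>; read backwards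
    it introduces an \<open>omega4\<close>.\<close>
  have flip: "deq (T\<^sub>0 (P\<^sub>0 B)) (P\<^sub>0 (T\<^sub>0 B)) [\<Lambda>\<langle>B\<rangle>]
      [(1, FT (ainv (MP.ra B))), (0, w4 B)]
      [(0, ainv (MP.ra (T\<^sub>0 B))), (1, FP (ainv (w2 B))), (2, nl (\<eta>\<langle>B\<rangle>))]" if [simp]: "B \<in> Obj C" for B
    by (rule deq_transpose[OF unit_right[of B], where c = "[(2, ainv (nl (\<eta>\<langle>B\<rangle>))), (1, FP (w2 B)), (0, MP.ra (T\<^sub>0 B))]" and d = "[]"]) simp_all
  \<comment> \<open>The image of \<open>?z\<close> under P stands between the inverse right unit and
    a tail of four layers. The tail contributes a second \<open>omega3\<close>, which (W5) requires,
    and is cancelled when the chain has come back to it.\<close>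
  have "?D [(0, ainv (MP.ra (T\<^sub>0 A))), (1, FP (ainv (MP.nu (m\<langle>A\<rangle>)))), (2, FP (ainv (w2 (T\<^sub>0 A)))),
      (3, FP (FT (ainv (w2 A)))), (1, FP (w3 A)), (2, FP (ainv (MT.nm (\<eta>\<langle>A\<rangle>)))), (1, FP (w2 A)),
      (1, FP (ainv (w2 A))), (3, w3 A), (2, nl (\<eta>\<langle>A\<rangle>)), (3, MT.nm (P\<^sub>1 (\<eta>\<langle>A\<rangle>)))]
      [(1, ainv (MP.ra (T\<^sub>0 (T\<^sub>0 A)))), (0, MP.nm (m\<langle>A\<rangle>)), (2, FP (ainv (w2 (T\<^sub>0 A)))), (3, FP (FT (ainv (w2 A)))),
      (1, FP (w3 A)), (2, FP (ainv (MT.nm (\<eta>\<langle>A\<rangle>)))), (1, FP (w2 A)), (1, FP (ainv (w2 A))), (3, w3 A),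
      (2, nl (\<eta>\<langle>A\<rangle>)), (3, MT.nm (P\<^sub>1 (\<eta>\<langle>A\<rangle>)))]"
    by (rule deq_step[OF rn, where i = 0 and k = 0]) simp_all
  also have "?D \<dots> [(1, ainv (MP.ra (T\<^sub>0 (T\<^sub>0 A)))), (0, MP.nm (m\<langle>A\<rangle>)), (2, FP (ainv (w2 (T\<^sub>0 A)))), (3, FP (FT (ainv (w2 A)))),
      (1, FP (w3 A)), (2, FP (ainv (MT.nm (\<eta>\<langle>A\<rangle>)))), (3, w3 A), (2, nl (\<eta>\<langle>A\<rangle>)), (3, MT.nm (P\<^sub>1 (\<eta>\<langle>A\<rangle>)))]"
    by (rule deq_step[OF deq_inv[of "FP (w2 A)", simplified], where i = 6 and k = 1]) simp_all
  \<comment> \<open>Naturality along \<eta> replaces the \<open>omega3\<close> of the tail by the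
    one at P A, and yields the square of \<open>m\<close> at \<eta> that cancels the one in the
    image of \<open>?z\<close>.\<close>
  also have "?D \<dots> [(1, ainv (MP.ra (T\<^sub>0 (T\<^sub>0 A)))), (0, MP.nm (m\<langle>A\<rangle>)), (2, FP (ainv (w2 (T\<^sub>0 A)))), (3, FP (FT (ainv (w2 A)))),
      (1, FP (w3 A)), (2, FP (ainv (MT.nm (\<eta>\<langle>A\<rangle>)))), (2, FP (MT.nm (\<eta>\<langle>A\<rangle>))), (3, nl (T\<^sub>1 (\<eta>\<langle>A\<rangle>))),
      (4, FT (nl (\<eta>\<langle>A\<rangle>))), (2, w3 (P\<^sub>0 A))]"
    by (rule deq_step[OF w3_natural[of "\<eta>\<langle>A\<rangle>", simplified], where i = 6 and k = 2]) simp_all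
  also have "?D \<dots> [(1, ainv (MP.ra (T\<^sub>0 (T\<^sub>0 A)))), (0, MP.nm (m\<langle>A\<rangle>)), (2, FP (ainv (w2 (T\<^sub>0 A)))), (3, FP (FT (ainv (w2 A)))),
      (1, FP (w3 A)), (3, nl (T\<^sub>1 (\<eta>\<langle>A\<rangle>))), (4, FT (nl (\<eta>\<langle>A\<rangle>))), (2, w3 (P\<^sub>0 A))]"
    by (rule deq_step[OF deq_inv[of "FP (ainv (MT.nm (\<eta>\<langle>A\<rangle>)))", simplified], where i = 5 and k = 2]) simp_all
  also have "?D \<dots> [(1, ainv (MP.ra (T\<^sub>0 (T\<^sub>0 A)))), (0, MP.nm (m\<langle>A\<rangle>)), (2, FP (ainv (w2 (T\<^sub>0 A)))), (3, nl (\<eta>\<langle>T\<^sub>0 A\<rangle>)),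
      (4, FT (FP (ainv (w2 A)))), (3, ainv (nl (\<Lambda>\<langle>A\<rangle>))), (5, FT (nl (\<eta>\<langle>A\<rangle>))), (1, FP (w3 A)), (2, w3 (P\<^sub>0 A))]"
    by (rule deq_step[OF ln, where i = 3 and k = 3]) simp_all
  \<comment> \<open>(W7) backwards, here at T A and in the next step at A under T, produces the two
    copies of \<open>omega4\<close> with which the left side of (W5) begins.\<close>
  also have "?D \<dots> [(2, FT (ainv (MP.ra (T\<^sub>0 A)))), (1, w4 (T\<^sub>0 A)), (0, MP.nm (m\<langle>A\<rangle>)), (4, FT (FP (ainv (w2 A)))),
      (3, ainv (nl (\<Lambda>\<langle>A\<rangle>))), (5, FT (nl (\<eta>\<langle>A\<rangle>))), (1, FP (w3 A)), (2, w3 (P\<^sub>0 A))]"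
    by (rule deq_step[OF deq_sym[OF flip[of "T\<^sub>0 A", simplified]], where i = 0 and k = 1]) simp_all
  also have "?D \<dots> [(3, FT (FT (ainv (MP.ra A)))), (2, FT (w4 A)), (1, w4 (T\<^sub>0 A)), (0, MP.nm (m\<langle>A\<rangle>)), (3, ainv (nl (\<Lambda>\<langle>A\<rangle>))),
      (1, FP (w3 A)), (2, w3 (P\<^sub>0 A))]"
    by (rule deq_step[OF deq_sym[OF MT.F.deq_fdiag[OF flip[of A], simplified]], where i = 0 and k = 2]) simp_all
  also have "?D \<dots> [(3, FT (FT (ainv (MP.ra A)))), (0, w3 A), (1, ainv (MT.nm (\<mu>\<langle>A\<rangle>))), (0, w4 A)]"
    by (rule deq_step[OF W5_deq[of A], where i = 1 and k = 0]) simp_all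
  also have "?D \<dots> [(0, w3 A), (1, FT (ainv (MP.ra A))), (2, MT.nm (P\<^sub>1 (\<eta>\<langle>A\<rangle>))), (0, w4 A)]"
    by (rule deq_step[OF mn, where i = 1 and k = 1]) simp_all
  also have "?D \<dots> [(0, w3 A), (0, ainv (MP.ra (T\<^sub>0 A))), (1, FP (ainv (w2 A))), (2, nl (\<eta>\<langle>A\<rangle>)), (3, MT.nm (P\<^sub>1 (\<eta>\<langle>A\<rangle>)))]"
    by (rule deq_step[OF flip[of A], where i = 1 and k = 0]) simp_all
  also have "?D \<dots> [(0, ainv (MP.ra (T\<^sub>0 A))), (1, FP (ainv (w2 A))), (3, w3 A), (2, nl (\<eta>\<langle>A\<rangle>)), (3, MT.nm (P\<^sub>1 (\<eta>\<langle>A\<rangle>)))]"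
    by (rule deq_interchange) simp_all
  finally have "?D ([(0, ainv (MP.ra (T\<^sub>0 A)))] @ shift 1 (fdiag P ?z)) ([(0, ainv (MP.ra (T\<^sub>0 A)))] @ [])"
    by - (rule deq_cancel_right[where zs = "[(1, FP (ainv (w2 A))), (3, w3 A), (2, nl (\<eta>\<langle>A\<rangle>)), (3, MT.nm (P\<^sub>1 (\<eta>\<langle>A\<rangle>)))]"], simp_all add: numeral_eq_Suc)
  from deq_cancel_left[OF this] have *: "deq (T\<^sub>0 (T\<^sub>0 (P\<^sub>0 A))) (P\<^sub>0 (T\<^sub>0 A)) [\<mu>\<langle>T\<^sub>0 A\<rangle>, P\<^sub>1 (\<eta>\<langle>T\<^sub>0 A\<rangle>), P\<^sub>1 (m\<langle>A\<rangle>), \<Lambda>\<langle>T\<^sub>0 A\<rangle>, T\<^sub>1 (\<Lambda>\<langle>A\<rangle>)]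
      (shift 1 (fdiag P ?z)) []"
    by simp
  \<comment> \<open>The loop is now trivial along \<lambda>T and T\<lambda>. Restricted further
    along \<eta> under two copies of T, these strands are converted by the two inverse
    \<open>omega2\<close> layers into the component of \<eta> at T T A that faithfulness of P asks
    for.\<close>
  have "deq (T\<^sub>0 (T\<^sub>0 A)) (P\<^sub>0 (T\<^sub>0 A)) [\<mu>\<langle>T\<^sub>0 A\<rangle>, P\<^sub>1 (\<eta>\<langle>T\<^sub>0 A\<rangle>), P\<^sub>1 (m\<langle>A\<rangle>), \<eta>\<langle>T\<^sub>0 (T\<^sub>0 A)\<rangle>]
      (shift 1 (fdiag P ?z) @ [(3, ainv (w2 (T\<^sub>0 A))), (4, FT (ainv (w2 A)))]) [(3, ainv (w2 (T\<^sub>0 A))), (4, FT (ainv (w2 A)))]"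
    by (rule deq_step[OF *, where i = 2 and k = 0]) simp_all
  then have "deq (T\<^sub>0 (T\<^sub>0 A)) (P\<^sub>0 (T\<^sub>0 A)) [\<mu>\<langle>T\<^sub>0 A\<rangle>, P\<^sub>1 (\<eta>\<langle>T\<^sub>0 A\<rangle>), P\<^sub>1 (m\<langle>A\<rangle>), \<eta>\<langle>T\<^sub>0 (T\<^sub>0 A)\<rangle>]
      (shift 1 (fdiag P ?z)) []"
    by - (rule deq_cancel_right[where zs = "[(3, ainv (w2 (T\<^sub>0 A))), (4, FT (ainv (w2 A)))]"], simp_all)
  then have "deq (T\<^sub>0 (T\<^sub>0 A)) (P\<^sub>0 (T\<^sub>0 A)) [\<eta>\<langle>T\<^sub>0 A\<rangle>, m\<langle>A\<rangle>] ?z []"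
    by - (rule P_faithful, simp_all)
  then show ?thesis
    by - (rule deq_sym, rule deq_transpose[OF deq_sym, where c = "[]" and d = "[(0, ainv (MP.nu (m\<langle>A\<rangle>))), (1, ainv (w2 (T\<^sub>0 A))), (2, FT (ainv (w2 A)))]"], assumption, simp_all)
qed

lemma multiplication_unit:
  assumes [simp]: "A \<in> Obj C"
  shows "deq (P\<^sub>0 (P\<^sub>0 A)) (P\<^sub>0 (T\<^sub>0 A)) [P\<^sub>1 (u\<langle>A\<rangle>), \<mu>\<langle>A\<rangle>]
    [(0, w1 A), (1, ainv (MT.nu (\<mu>\<langle>A\<rangle>))), (0, w4 A)]
    [(0, MP.nm (u\<langle>A\<rangle>)), (1, FP (w1 A)), (2, w1 (P\<^sub>0 A))]"
proof -
  let ?D = "deq (T\<^sub>0 (P\<^sub>0 (P\<^sub>0 A))) (P\<^sub>0 (T\<^sub>0 A)) [P\<^sub>1 (m\<langle>A\<rangle>), \<Lambda>\<langle>T\<^sub>0 A\<rangle>, T\<^sub>1 (P\<^sub>1 (u\<langle>A\<rangle>)), T\<^sub>1 (\<mu>\<langle>A\<rangle>)]"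
  let ?x = "[(0, w1 A), (1, ainv (MT.nu (\<mu>\<langle>A\<rangle>))), (0, w4 A)]" and ?y = "[(0, MP.nm (u\<langle>A\<rangle>)), (1, FP (w1 A)), (2, w1 (P\<^sub>0 A))]"
  \<comment> \<open>Naturality of \<open>omega4\<close> along \<open>u\<close>: this lets the
    \<open>omega4\<close> at A in the tail become the one at T A that (W5) contains.\<close>
  have w4n: "deq (T\<^sub>0 (P\<^sub>0 (P\<^sub>0 A))) (P\<^sub>0 (T\<^sub>0 (T\<^sub>0 A))) [\<Lambda>\<langle>T\<^sub>0 A\<rangle>, T\<^sub>1 (\<mu>\<langle>T\<^sub>0 A\<rangle>), T\<^sub>1 (P\<^sub>1 (P\<^sub>1 (u\<langle>A\<rangle>)))]
      [(1, FT (ainv (MP.nm (u\<langle>A\<rangle>)))), (0, ainv (nl (u\<langle>A\<rangle>))), (1, w4 A)]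
      [(0, w4 (T\<^sub>0 A)), (2, ainv (nl (P\<^sub>1 (u\<langle>A\<rangle>)))), (1, FP (ainv (nl (u\<langle>A\<rangle>)))), (0, ainv (MP.nm (T\<^sub>1 (u\<langle>A\<rangle>))))]"
    by (rule deq_transpose[OF w4_natural[of "u\<langle>A\<rangle>", simplified], where c = "[(0, MP.nm (T\<^sub>1 (u\<langle>A\<rangle>))), (1, FP (nl (u\<langle>A\<rangle>))), (2, nl (P\<^sub>1 (u\<langle>A\<rangle>)))]" and d = "[(0, nl (u\<langle>A\<rangle>)), (1, FT (MP.nm (u\<langle>A\<rangle>)))]"]) simp_all
  have mn: "deq (P\<^sub>0 (P\<^sub>0 (T\<^sub>0 A))) (P\<^sub>0 (T\<^sub>0 A)) [P\<^sub>1 (m\<langle>A\<rangle>), \<mu>\<langle>T\<^sub>0 (T\<^sub>0 A)\<rangle>, P\<^sub>1 (P\<^sub>1 (T\<^sub>1 (u\<langle>A\<rangle>)))]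
      [(1, ainv (MP.nm (T\<^sub>1 (u\<langle>A\<rangle>)))), (0, FP (MT.ra A))]
      [(0, MP.nm (m\<langle>A\<rangle>)), (1, FP (FP (MT.ra A)))]"
    by (rule deq_transpose[OF MP.m.deq_natural[of "MT.ra A", simplified], where c = "[]" and d = "[(1, MP.nm (T\<^sub>1 (u\<langle>A\<rangle>)))]"]) simp_all
  have ln: "deq (T\<^sub>0 (P\<^sub>0 (P\<^sub>0 A))) (P\<^sub>0 (T\<^sub>0 (P\<^sub>0 (T\<^sub>0 A)))) [\<Lambda>\<langle>P\<^sub>0 (T\<^sub>0 A)\<rangle>, T\<^sub>1 (P\<^sub>1 (\<Lambda>\<langle>A\<rangle>)), T\<^sub>1 (P\<^sub>1 (u\<langle>P\<^sub>0 A\<rangle>))]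
      [(1, FT (FP (ainv (w1 A)))), (0, ainv (nl (P\<^sub>1 (u\<langle>A\<rangle>))))]
      [(0, ainv (nl (\<Lambda>\<langle>A\<rangle>))), (1, ainv (nl (u\<langle>P\<^sub>0 A\<rangle>))), (0, FP (FT (ainv (w1 A))))]"
    by (rule deq_sym, rule deq_inverse[OF law.deq_natural[of "w1 A", simplified]]) simp_all
  have rn: "deq (T\<^sub>0 (P\<^sub>0 (P\<^sub>0 A))) (T\<^sub>0 (P\<^sub>0 A)) [m\<langle>P\<^sub>0 A\<rangle>, T\<^sub>1 (T\<^sub>1 (\<mu>\<langle>A\<rangle>)), T\<^sub>1 (u\<langle>P\<^sub>0 (P\<^sub>0 A)\<rangle>)]
      [(0, ainv (MT.nm (\<mu>\<langle>A\<rangle>))), (1, MT.ra (P\<^sub>0 (P\<^sub>0 A)))]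
      [(1, FT (MT.nu (\<mu>\<langle>A\<rangle>))), (0, MT.ra (P\<^sub>0 A))]"
    by (rule deq_transpose[OF MT.r_natural[of "\<mu>\<langle>A\<rangle>", simplified], where c = "[]" and d = "[(0, MT.nm (\<mu>\<langle>A\<rangle>))]"]) simp_all
  \<comment> \<open>The image of \<open>?x\<close>, then the image of the inverse of
    \<open>?y\<close>, then a tail that contracts the inserted unit and applies
    \<open>omega4\<close>. The chain reduces this to the tail alone.\<close>
  have "?D [(2, FT (w1 A)), (3, FT (ainv (MT.nu (\<mu>\<langle>A\<rangle>)))), (2, FT (w4 A)), (4, FT (ainv (w1 (P\<^sub>0 A)))),
      (3, FT (FP (ainv (w1 A)))), (2, FT (ainv (MP.nm (u\<langle>A\<rangle>)))), (1, ainv (nl (u\<langle>A\<rangle>))), (0, FP (MT.ra A)),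
      (0, w4 A)]
      [(2, FT (w1 A)), (3, FT (ainv (MT.nu (\<mu>\<langle>A\<rangle>)))), (2, FT (w4 A)), (4, FT (ainv (w1 (P\<^sub>0 A)))),
      (3, FT (FP (ainv (w1 A)))), (1, w4 (T\<^sub>0 A)), (3, ainv (nl (P\<^sub>1 (u\<langle>A\<rangle>)))), (2, FP (ainv (nl (u\<langle>A\<rangle>)))),
      (1, ainv (MP.nm (T\<^sub>1 (u\<langle>A\<rangle>)))), (0, FP (MT.ra A))]"
    by (rule deq_step[OF w4n, where i = 5 and k = 1]) simp_all
  also have "?D \<dots> [(2, FT (w1 A)), (3, FT (ainv (MT.nu (\<mu>\<langle>A\<rangle>)))), (2, FT (w4 A)), (4, FT (ainv (w1 (P\<^sub>0 A)))),
      (3, FT (FP (ainv (w1 A)))), (1, w4 (T\<^sub>0 A)), (3, ainv (nl (P\<^sub>1 (u\<langle>A\<rangle>)))), (2, FP (ainv (nl (u\<langle>A\<rangle>)))),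
      (0, MP.nm (m\<langle>A\<rangle>)), (1, FP (FP (MT.ra A)))]"
    by (rule deq_step[OF mn, where i = 8 and k = 0]) simp_all
  also have "?D \<dots> [(2, FT (w1 A)), (3, FT (ainv (MT.nu (\<mu>\<langle>A\<rangle>)))), (2, FT (w4 A)), (4, FT (ainv (w1 (P\<^sub>0 A)))), (1, w4 (T\<^sub>0 A)),
      (3, ainv (nl (\<Lambda>\<langle>A\<rangle>))), (4, ainv (nl (u\<langle>P\<^sub>0 A\<rangle>))), (3, FP (FT (ainv (w1 A)))), (2, FP (ainv (nl (u\<langle>A\<rangle>)))),
      (0, MP.nm (m\<langle>A\<rangle>)), (1, FP (FP (MT.ra A)))]"
    by (rule deq_step[OF ln, where i = 5 and k = 3]) simp_all
  \<comment> \<open>(W1) backwards, at A under P and then at P A, trades inverses of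
    \<open>omega1\<close> for the two copies of \<open>omega3\<close> on the left side of
    (W5).\<close>
  also have "?D \<dots> [(2, FT (w1 A)), (3, FT (ainv (MT.nu (\<mu>\<langle>A\<rangle>)))), (2, FT (w4 A)), (4, FT (ainv (w1 (P\<^sub>0 A)))), (1, w4 (T\<^sub>0 A)),
      (3, ainv (nl (\<Lambda>\<langle>A\<rangle>))), (4, ainv (nl (u\<langle>P\<^sub>0 A\<rangle>))), (0, MP.nm (m\<langle>A\<rangle>)), (1, FP (w3 A)), (2, FP (MT.ra (P\<^sub>0 A)))]"
    by (rule deq_step[OF deq_sym[OF MP.F.deq_fdiag[OF W1_flip[of A], simplified]], where i = 8 and k = 1]) simp_all
  also have "?D \<dots> [(2, FT (w1 A)), (3, FT (ainv (MT.nu (\<mu>\<langle>A\<rangle>)))), (2, FT (w4 A)), (1, w4 (T\<^sub>0 A)), (0, MP.nm (m\<langle>A\<rangle>)),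
      (3, ainv (nl (\<Lambda>\<langle>A\<rangle>))), (1, FP (w3 A)), (2, w3 (P\<^sub>0 A)), (3, MT.ra (P\<^sub>0 (P\<^sub>0 A)))]"
    by (rule deq_step[OF deq_sym[OF W1_flip[of "P\<^sub>0 A", simplified]], where i = 7 and k = 2]) simp_all
  also have "?D \<dots> [(2, FT (w1 A)), (3, FT (ainv (MT.nu (\<mu>\<langle>A\<rangle>)))), (0, w3 A), (1, ainv (MT.nm (\<mu>\<langle>A\<rangle>))), (0, w4 A),
      (3, MT.ra (P\<^sub>0 (P\<^sub>0 A)))]"
    by (rule deq_step[OF W5_deq[of A], where i = 2 and k = 0]) simp_all
  also have "?D \<dots> [(2, FT (w1 A)), (3, FT (ainv (MT.nu (\<mu>\<langle>A\<rangle>)))), (0, w3 A), (2, FT (MT.nu (\<mu>\<langle>A\<rangle>))), (1, MT.ra (P\<^sub>0 A)),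
      (0, w4 A)]"
    by (rule deq_step[OF rn, where i = 3 and k = 1]) simp_all
  also have "?D \<dots> [(2, FT (w1 A)), (0, w3 A), (1, MT.ra (P\<^sub>0 A)), (0, w4 A)]"
    by (rule deq_step[OF deq_inv[of "FT (ainv (MT.nu (\<mu>\<langle>A\<rangle>)))", simplified], where i = 1 and k = 3]) simp_all
  also have "?D \<dots> [(2, FT (w1 A)), (2, FT (ainv (w1 A))), (1, ainv (nl (u\<langle>A\<rangle>))), (0, FP (MT.ra A)), (0, w4 A)]"
    by (rule deq_step[OF W1_flip[of A], where i = 1 and k = 0]) simp_all
  also have "?D \<dots> [(1, ainv (nl (u\<langle>A\<rangle>))), (0, FP (MT.ra A)), (0, w4 A)]"
    by (rule deq_step[OF deq_inv[of "FT (w1 A)", simplified], where i = 0 and k = 2]) simp_all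
  finally have "?D (shift 2 (fdiag T ?x) @ shift 2 (fdiag T (dinv ?y))) []"
    by - (rule deq_cancel_right[where zs = "[(1, ainv (nl (u\<langle>A\<rangle>))), (0, FP (MT.ra A)), (0, w4 A)]"], simp_all)
  then have "?D (shift 2 (fdiag T ?x)) (shift 2 (fdiag T ?y))"
    by - (rule deq_transpose[where c = "shift 2 (fdiag T (dinv ?y))" and d = "[]"], simp_all)
  then show ?thesis
    by - (rule T_faithful, simp_all)
qed

text \<open>The pattern is that of (W9), with \<open>omega2\<close> in place of
  \<open>omega4\<close> and (W8) in place of (W5). The naturality of \<eta> takes over the part
  played there by that of \<mu>.\<close>

lemma unit_unit:
  assumes [simp]: "A \<in> Obj C"
  shows "deq A (P\<^sub>0 (T\<^sub>0 A)) [P\<^sub>1 (u\<langle>A\<rangle>), \<eta>\<langle>A\<rangle>]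
    [(0, w1 A), (1, ainv (MT.nu (\<eta>\<langle>A\<rangle>))), (0, w2 A)]
    [(0, MP.nu (u\<langle>A\<rangle>))]"
proof -
  let ?D = "deq (T\<^sub>0 A) (P\<^sub>0 (T\<^sub>0 A)) [P\<^sub>1 (m\<langle>A\<rangle>), \<Lambda>\<langle>T\<^sub>0 A\<rangle>, T\<^sub>1 (P\<^sub>1 (u\<langle>A\<rangle>)), T\<^sub>1 (\<eta>\<langle>A\<rangle>)]"
  let ?x = "[(0, w1 A), (1, ainv (MT.nu (\<eta>\<langle>A\<rangle>))), (0, w2 A)]" and ?y = "[(0, MP.nu (u\<langle>A\<rangle>))]"
  have w2n: "deq (T\<^sub>0 A) (P\<^sub>0 (T\<^sub>0 (T\<^sub>0 A))) [\<Lambda>\<langle>T\<^sub>0 A\<rangle>, T\<^sub>1 (\<eta>\<langle>T\<^sub>0 A\<rangle>), T\<^sub>1 (u\<langle>A\<rangle>)]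
      [(1, FT (ainv (MP.nu (u\<langle>A\<rangle>)))), (0, ainv (nl (u\<langle>A\<rangle>))), (1, w2 A)]
      [(0, w2 (T\<^sub>0 A)), (0, ainv (MP.nu (T\<^sub>1 (u\<langle>A\<rangle>))))]"
    by (rule deq_transpose[OF w2_natural[of "u\<langle>A\<rangle>", simplified], where c = "[(0, MP.nu (T\<^sub>1 (u\<langle>A\<rangle>)))]" and d = "[(0, nl (u\<langle>A\<rangle>)), (1, FT (MP.nu (u\<langle>A\<rangle>)))]"]) simp_all
  \<comment> \<open>Naturality of \<eta> with respect to the right unit of T, regarded as a
    2-cell.\<close>
  have en: "deq (T\<^sub>0 A) (P\<^sub>0 (T\<^sub>0 A)) [P\<^sub>1 (m\<langle>A\<rangle>), \<eta>\<langle>T\<^sub>0 (T\<^sub>0 A)\<rangle>, T\<^sub>1 (u\<langle>A\<rangle>)]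
      [(1, ainv (MP.nu (T\<^sub>1 (u\<langle>A\<rangle>)))), (0, FP (MT.ra A))]
      [(0, MP.nu (m\<langle>A\<rangle>)), (1, MT.ra A)]"
    by (rule deq_transpose[OF MP.u.deq_natural[of "MT.ra A", simplified], where c = "[]" and d = "[(1, MP.nu (T\<^sub>1 (u\<langle>A\<rangle>)))]"]) simp_all
  have rn: "deq (T\<^sub>0 A) (T\<^sub>0 (P\<^sub>0 A)) [m\<langle>P\<^sub>0 A\<rangle>, T\<^sub>1 (T\<^sub>1 (\<eta>\<langle>A\<rangle>)), T\<^sub>1 (u\<langle>A\<rangle>)]
      [(0, ainv (MT.nm (\<eta>\<langle>A\<rangle>))), (1, MT.ra A)]
      [(1, FT (MT.nu (\<eta>\<langle>A\<rangle>))), (0, MT.ra (P\<^sub>0 A))]"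
    by (rule deq_transpose[OF MT.r_natural[of "\<eta>\<langle>A\<rangle>", simplified], where c = "[]" and d = "[(0, MT.nm (\<eta>\<langle>A\<rangle>))]"]) simp_all
  have "?D [(2, FT (w1 A)), (3, FT (ainv (MT.nu (\<eta>\<langle>A\<rangle>)))), (2, FT (w2 A)), (2, FT (ainv (MP.nu (u\<langle>A\<rangle>)))),
      (1, ainv (nl (u\<langle>A\<rangle>))), (0, FP (MT.ra A)), (0, w2 A)]
      [(2, FT (w1 A)), (3, FT (ainv (MT.nu (\<eta>\<langle>A\<rangle>)))), (2, FT (w2 A)), (1, w2 (T\<^sub>0 A)),
      (1, ainv (MP.nu (T\<^sub>1 (u\<langle>A\<rangle>)))), (0, FP (MT.ra A))]"
    by (rule deq_step[OF w2n, where i = 3 and k = 1]) simp_all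
  also have "?D \<dots> [(2, FT (w1 A)), (3, FT (ainv (MT.nu (\<eta>\<langle>A\<rangle>)))), (2, FT (w2 A)), (1, w2 (T\<^sub>0 A)), (0, MP.nu (m\<langle>A\<rangle>)),
      (1, MT.ra A)]"
    by (rule deq_step[OF en, where i = 4 and k = 0]) simp_all
  also have "?D \<dots> [(2, FT (w1 A)), (3, FT (ainv (MT.nu (\<eta>\<langle>A\<rangle>)))), (0, w3 A), (1, ainv (MT.nm (\<eta>\<langle>A\<rangle>))), (0, w2 A),
      (1, MT.ra A)]"
    by (rule deq_step[OF deq_sym[OF unit_multiplication[of A]], where i = 2 and k = 0]) simp_all
  also have "?D \<dots> [(2, FT (w1 A)), (3, FT (ainv (MT.nu (\<eta>\<langle>A\<rangle>)))), (0, w3 A), (2, FT (MT.nu (\<eta>\<langle>A\<rangle>))), (1, MT.ra (P\<^sub>0 A)),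
      (0, w2 A)]"
    by (rule deq_step[OF rn, where i = 3 and k = 1]) simp_all
  also have "?D \<dots> [(2, FT (w1 A)), (0, w3 A), (1, MT.ra (P\<^sub>0 A)), (0, w2 A)]"
    by (rule deq_step[OF deq_inv[of "FT (ainv (MT.nu (\<eta>\<langle>A\<rangle>)))", simplified], where i = 1 and k = 3]) simp_all
  also have "?D \<dots> [(2, FT (w1 A)), (2, FT (ainv (w1 A))), (1, ainv (nl (u\<langle>A\<rangle>))), (0, FP (MT.ra A)), (0, w2 A)]"
    by (rule deq_step[OF W1_flip[of A], where i = 1 and k = 0]) simp_all
  also have "?D \<dots> [(1, ainv (nl (u\<langle>A\<rangle>))), (0, FP (MT.ra A)), (0, w2 A)]"
    by (rule deq_step[OF deq_inv[of "FT (w1 A)", simplified], where i = 0 and k = 2]) simp_all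
  finally have "?D (shift 2 (fdiag T ?x) @ shift 2 (fdiag T (dinv ?y))) []"
    by - (rule deq_cancel_right[where zs = "[(1, ainv (nl (u\<langle>A\<rangle>))), (0, FP (MT.ra A)), (0, w2 A)]"], simp_all)
  then have "?D (shift 2 (fdiag T ?x)) (shift 2 (fdiag T ?y))"
    by - (rule deq_transpose[where c = "shift 2 (fdiag T (dinv ?y))" and d = "[]"], simp_all)
  then show ?thesis
    by - (rule T_faithful, simp_all)
qed

end

section \<open>Return to the stated form of the conditions\<close>

context pseudodist_calculus
begin

lemma W_derived: "W6 \<and> W7 \<and> W8 \<and> W9 \<and> W10"
proof (intro conjI)
  \<comment> \<open>(W6) and (W7) compare a chain with an identity, the value of the empty diagram;
    the other three compare two nonempty chains, for which \<open>eq2\<close> brackets both sides to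
    the left.\<close>
  have eq: "evl X (lay X p d) (step p d) ds = deval X p es" if "deq X Y p (d # ds) es" for X Y p d ds es
    using that deval_evl[of X Y p d ds] by (simp add: deq_def)
  have eq2: "evl X (lay X p d) (step p d) ds = evl X (lay X p e) (step p e) es"
    if "deq X Y p (d # ds) (e # es)" for X Y p d ds e es
    using that deval_evl[of X Y p d ds] deval_evl[of X Y p e es] by (simp add: deq_def)
  show W6
    unfolding W6_def by (rule ballI, insert eq[OF unit_left]) (simp add: cell_eqs)
  show W7
    unfolding W7_def by (rule ballI, insert eq[OF unit_right]) (simp add: cell_eqs)
  show W8
    unfolding W8_def by (rule ballI, insert eq2[OF unit_multiplication]) (simp add: cell_eqs)
  show W9
    unfolding W9_def by (rule ballI, insert eq2[OF multiplication_unit]) (simp add: cell_eqs)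
  show W10
    unfolding W10_def by (rule ballI, insert eq2[OF unit_unit]) (simp add: cell_eqs)
qed

end

theorem theorem4p1p5:
  fixes C :: "('o, 'a, 'c) two_cat"
    and T P :: "('o, 'a, 'c) pseudomon"
    and L :: "('o, 'a, 'c) pseudodist"
  assumes "two_category C"
    and "pseudomonad C T"
    and "pseudomonad C P"
    and "pseudodistributive_law C T P L"
  shows "pseudodist_data.W6 C T P L
    \<and> pseudodist_data.W7 C T P L
    \<and> pseudodist_data.W8 C T P L
    \<and> pseudodist_data.W9 C T P L
    \<and> pseudodist_data.W10 C T P L"
proof -
  interpret pseudodist_calculus C T P L
    using assms by (simp add: pseudodist_calculus_def)
  show ?thesis by (rule W_derived)
qed

end
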